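(* Let $G$ be a nontrivial finite group, and write $I = \operatorname{IrPt}$, $C = \operatorname{ClPt}$, $G^{\#} = G\setminus\{1\}$ and $\operatorname{Irr}^{\#} G = \operatorname{Irr} G \setminus \{1_G\}$. Construct a set $\mathcal{S}$, initially empty, as follows. 1. For every nonempty $G$-invariant subset $S \subset G^{\#}$ such that $S$ contains at most half of the nontrivial conjugacy classes of $G$: compute the partitions $I(\{S\})$, $CI(\{S\})$, $ICI(\{S\})$, $\dotsc$, until either $S \notin (CI)^n(\{S\})$ for some $n\ge 1$, or the number of blocks in these partitions stabilizes. In the latter case, one has found the coarsest supercharacter theory $\mathcal{L}(S)$ of $G$ which has $S$ as one of its superclasses; add $\mathcal{L}(S)$ to $\mathcal{S}$. 2. Form all possible meets of two or more members of $\mathcal{S}$, in the lattice of supercharacter theories of $G$, and add them to $\mathcal{S}$. 3. Add to $\mathcal{S}$ the coarse supercharacter theory $\mathsf{M}(G) = \big( \{ \{1_G\}, \operatorname{Irr}^{\#} G \}, \{ \{1\}, G^{\#} \} \big)$. Then the resulting set $\mathcal{S}$ is the set of all supercharacter theories of $G$.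
   Context: $\operatorname{Irr} G$ is the set of irreducible complex characters of the finite group $G$, and $1_G$ is the trivial character. For $X \subseteq \operatorname{Irr} G$ put $\sigma_X = \sum_{\chi \in X} \chi(1)\chi$. For $K \subseteq G$ put $\hat{K} = \sum_{g \in K} g \in \mathbb{C}G$; characters are extended linearly to $\mathbb{C}G$. A subset of $G$ is $G$-invariant if it is a union of conjugacy classes. A partition $\mathcal{K}$ is finer than $\mathcal{L}$ (written $\mathcal{K} \preceq \mathcal{L}$) if every block of $\mathcal{K}$ is contained in a block of $\mathcal{L}$; then $\mathcal{L}$ is coarser than $\mathcal{K}$. Supercharacter theory: a pair $(\mathcal{X},\mathcal{K})$ with $\mathcal{X}$ a partition of $\operatorname{Irr} G$ and $\mathcal{K}$ a partition of $G$ (whose members are the superclasses) such that $|\mathcal{X}| = |\mathcal{K}|$ and, for every $X \in \mathcal{X}$, the character $\sigma_X$ is constant on each member of $\mathcal{K}$. A supercharacter theory $(\mathcal{X},\mathcal{K})$ is finer than $(\mathcal{Y},\mathcal{L})$, and $(\mathcal{Y},\mathcal{L})$ is coarser than $(\mathcal{X},\mathcal{K})$, if $\mathcal{X} \preceq \mathcal{Y}$ (for supercharacter theories this is equivalent to $\mathcal{K} \preceq \mathcal{L}$). With this order the supercharacter theories of $G$ form a lattice; the meet is the greatest lower bound in it, i.e. the coarsest supercharacter theory that is finer than all the given ones. For a collection $\mathcal{X}$ of subsets of $\operatorname{Irr} G$, $\operatorname{ClPt}(\mathcal{X})$ is the partition of $G$ into equivalence classes of the relation: $g \sim h$ if and only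 if $\sigma_X(g) = \sigma_X(h)$ for all $X \in \mathcal{X}$. For a collection $\mathcal{K}$ of $G$-invariant subsets of $G$, $\operatorname{IrPt}(\mathcal{K})$ is the partition of $\operatorname{Irr} G$ into equivalence classes of the relation: $\chi \sim \psi$ if and only if $\chi(\hat{K})/\chi(1) = \psi(\hat{K})/\psi(1)$ for all $K \in \mathcal{K}$. Juxtaposition denotes composition of maps, and $\{S\}$ is the collection whose only member is $S$. "The number of blocks stabilizes" means that two consecutive partitions in the alternating sequence $I(\{S\}), CI(\{S\}), ICI(\{S\}), \dotsc$ have the same number of blocks, while all partitions of $G$ computed so far (including at least $CI(\{S\})$) contain $S$ as a block; these two consecutive partitions then form the supercharacter theory $\mathcal{L}(S)$. *)

theory Defs
  imports
    "HOL-Algebra.Group_Action"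
    "HOL-Library.Disjoint_Sets"
    "Jordan_Normal_Form.VS_Connect"
begin

abbreviation GL :: "nat \<Rightarrow> complex mat monoid" where
  "GL n \<equiv> units_of (ring_mat TYPE(complex) n ())"

definition irreducible_rep ::
  "('a, 'm) monoid_scheme \<Rightarrow> nat \<Rightarrow> ('a \<Rightarrow> complex mat) \<Rightarrow> bool" where
  "irreducible_rep G n \<rho> \<longleftrightarrow>
     \<rho> \<in> hom G (GL n) \<and> 0 < n \<and>
     (\<forall>W. subspace class_ring W (module_vec TYPE(complex) n) \<and>
          (\<forall>g\<in>carrier G. \<forall>w\<in>W. \<rho> g *\<^sub>v w \<in> W)
          \<longrightarrow> W = {0\<^sub>v n} \<or> W = carrier_vec n)"

definition mat_trace :: "complex mat \<Rightarrow> complex" where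
  "mat_trace A = (\<Sum>i<dim_row A. A $$ (i, i))"

text \<open>Characters are functions on the carrier, extended by \<^term>\<open>undefined\<close> outside it, so that
  characters that agree on the group are equal in HOL.\<close>

definition Irr :: "('a, 'm) monoid_scheme \<Rightarrow> ('a \<Rightarrow> complex) set" where
  "Irr G = {\<chi>. \<exists>n \<rho>. irreducible_rep G n \<rho> \<and> \<chi> = (\<lambda>g\<in>carrier G. mat_trace (\<rho> g))}"

definition trivial_char :: "('a, 'm) monoid_scheme \<Rightarrow> 'a \<Rightarrow> complex" where
  "trivial_char G = (\<lambda>g\<in>carrier G. 1)"

definition sigma_char ::
  "('a, 'm) monoid_scheme \<Rightarrow> ('a \<Rightarrow> complex) set \<Rightarrow> 'a \<Rightarrow> complex" where
  "sigma_char G X g = (\<Sum>\<chi>\<in>X. \<chi> \<one>\<^bsub>G\<^esub> * \<chi> g)"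

text \<open>Elements of the complex group algebra are represented by their coefficient functions.\<close>

definition lin_ext ::
  "('a, 'm) monoid_scheme \<Rightarrow> ('a \<Rightarrow> complex) \<Rightarrow> ('a \<Rightarrow> complex) \<Rightarrow> complex" where
  "lin_ext G \<chi> a = (\<Sum>g\<in>carrier G. a g * \<chi> g)"

definition hat :: "'a set \<Rightarrow> 'a \<Rightarrow> complex" where
  "hat K = (\<lambda>g. if g \<in> K then 1 else 0)"

definition conj_classes :: "('a, 'm) monoid_scheme \<Rightarrow> 'a set set" where
  "conj_classes G =
     orbits G (carrier G) (\<lambda>g. \<lambda>h\<in>carrier G. g \<otimes>\<^bsub>G\<^esub> h \<otimes>\<^bsub>G\<^esub> inv\<^bsub>G\<^esub> g)"

definition G_invariant :: "('a, 'm) monoid_scheme \<Rightarrow> 'a set \<Rightarrow> bool" where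
  "G_invariant G S \<longleftrightarrow> (\<exists>\<C>\<subseteq>conj_classes G. S = \<Union>\<C>)"

type_synonym 'a char_pair = "('a \<Rightarrow> complex) set set \<times> 'a set set"

definition supercharacter_theory :: "('a, 'm) monoid_scheme \<Rightarrow> 'a char_pair \<Rightarrow> bool" where
  "supercharacter_theory G T \<longleftrightarrow>
     partition_on (Irr G) (fst T) \<and> partition_on (carrier G) (snd T) \<and>
     card (fst T) = card (snd T) \<and>
     (\<forall>X\<in>fst T. \<forall>K\<in>snd T. \<forall>g\<in>K. \<forall>h\<in>K. sigma_char G X g = sigma_char G X h)"

definition SCT :: "('a, 'm) monoid_scheme \<Rightarrow> 'a char_pair gorder" where
  "SCT G = \<lparr>carrier = {T. supercharacter_theory G T}, eq = (=),
            le = (\<lambda>T U. refines (Irr G) (fst T) (fst U))\<rparr>"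

definition coarse_theory :: "('a, 'm) monoid_scheme \<Rightarrow> 'a char_pair" where
  "coarse_theory G = ({{trivial_char G}, Irr G - {trivial_char G}},
                      {{\<one>\<^bsub>G\<^esub>}, carrier G - {\<one>\<^bsub>G\<^esub>}})"

definition ClPt ::
  "('a, 'm) monoid_scheme \<Rightarrow> ('a \<Rightarrow> complex) set set \<Rightarrow> 'a set set" where
  "ClPt G \<X> = carrier G // {(g, h). g \<in> carrier G \<and> h \<in> carrier G \<and>
     (\<forall>X\<in>\<X>. sigma_char G X g = sigma_char G X h)}"

definition IrPt ::
  "('a, 'm) monoid_scheme \<Rightarrow> 'a set set \<Rightarrow> ('a \<Rightarrow> complex) set set" where
  "IrPt G \<K> = Irr G // {(\<chi>, \<psi>). \<chi> \<in> Irr G \<and> \<psi> \<in> Irr G \<and>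
     (\<forall>K\<in>\<K>. lin_ext G \<chi> (hat K) / \<chi> \<one>\<^bsub>G\<^esub> = lin_ext G \<psi> (hat K) / \<psi> \<one>\<^bsub>G\<^esub>)}"

definition cl_part :: "('a, 'm) monoid_scheme \<Rightarrow> 'a set \<Rightarrow> nat \<Rightarrow> 'a set set" where
  "cl_part G S n = ((ClPt G \<circ> IrPt G) ^^ n) {S}"

definition ir_part :: "('a, 'm) monoid_scheme \<Rightarrow> 'a set \<Rightarrow> nat \<Rightarrow> ('a \<Rightarrow> complex) set set" where
  "ir_part G S n = IrPt G (cl_part G S n)"

text \<open>The alternating sequence is \<open>ir_part 0, cl_part 1, ir_part 1, cl_part 2, ir_part 2, \<dots>\<close>
  (without \<open>cl_part 0 = {S}\<close>). Its entries number \<open>m\<close> and \<open>m + 1\<close>, counted from \<open>0\<close>, are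
  \<open>ir_part ((m + 1) div 2)\<close> and \<open>cl_part (m div 2 + 1)\<close>, in this order if \<open>m\<close> is even and in the
  opposite order if \<open>m\<close> is odd.\<close>

definition consecutive_pair :: "('a, 'm) monoid_scheme \<Rightarrow> 'a set \<Rightarrow> nat \<Rightarrow> 'a char_pair" where
  "consecutive_pair G S m = (ir_part G S ((m + 1) div 2), cl_part G S (m div 2 + 1))"

definition stabilizes_at :: "('a, 'm) monoid_scheme \<Rightarrow> 'a set \<Rightarrow> nat \<Rightarrow> bool" where
  "stabilizes_at G S m \<longleftrightarrow>
     card (fst (consecutive_pair G S m)) = card (snd (consecutive_pair G S m)) \<and>
     (\<forall>j\<in>{1..m div 2 + 1}. S \<in> cl_part G S j)"

definition stabilizes :: "('a, 'm) monoid_scheme \<Rightarrow> 'a set \<Rightarrow> bool" where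
  "stabilizes G S \<longleftrightarrow> (\<exists>m. stabilizes_at G S m)"

definition theory_of :: "('a, 'm) monoid_scheme \<Rightarrow> 'a set \<Rightarrow> 'a char_pair" where
  "theory_of G S = consecutive_pair G S (LEAST m. stabilizes_at G S m)"

definition candidates :: "('a, 'm) monoid_scheme \<Rightarrow> 'a set set" where
  "candidates G = {S. S \<noteq> {} \<and> S \<subseteq> carrier G - {\<one>\<^bsub>G\<^esub>} \<and> G_invariant G S \<and>
     2 * card {C \<in> conj_classes G. C \<subseteq> S} \<le> card (conj_classes G - {{\<one>\<^bsub>G\<^esub>}})}"

definition step1 :: "('a, 'm) monoid_scheme \<Rightarrow> 'a char_pair set" where
  "step1 G = {theory_of G S | S. S \<in> candidates G \<and> stabilizes G S}"

definition step2 :: "('a, 'm) monoid_scheme \<Rightarrow> 'a char_pair set \<Rightarrow> 'a char_pair set" where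
  "step2 G \<S> = \<S> \<union> {T. \<exists>A\<subseteq>\<S>. finite A \<and> 2 \<le> card A \<and> greatest (SCT G) T (Lower (SCT G) A)}"

definition step3 :: "('a, 'm) monoid_scheme \<Rightarrow> 'a char_pair set \<Rightarrow> 'a char_pair set" where
  "step3 G \<S> = \<S> \<union> {coarse_theory G}"

end

theory Submission
  imports Defs "Jordan_Normal_Form.Schur_Decomposition"
begin

text \<open>
  Character theory reduces the theorem to counting. If \<open>K\<close> is a partition of \<open>G\<close> and \<open>X\<close> a partition of
  \<open>Irr G\<close> such that the characters \<open>sigma_char G Y\<close>, \<open>Y \<in> X\<close>, are constant on the blocks of \<open>K\<close>, then
  \<open>card X \<le> card K\<close>, because these characters are linearly independent; in the case of equality their
  complex conjugates span all functions constant on the blocks of \<open>K\<close> (\<open>card_le_if_sigma_const\<close>,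
  \<open>sigma_span\<close>). Dually, if the blocks of \<open>K\<close> are unions of conjugacy classes and the central
  characters \<open>\<chi>(K)/\<chi>(1)\<close> are constant on the blocks of \<open>X\<close>, then \<open>card K \<le> card X\<close>, and equality forces
  the \<open>sigma_char G Y\<close> to be constant on the blocks of \<open>K\<close> (\<open>card_le_if_hat_const\<close>,
  \<open>sigma_const_if_hat_const\<close>). Both statements rest on Fourier inversion for class functions, hence on
  the orthogonality relations and on the completeness of the irreducible characters.

  Consequently the numbers of blocks in the alternating sequence never decrease and must become
  stationary, and two consecutive partitions of equal size form a supercharacter theory. By
  induction every supercharacter theory with superclass \<open>S\<close> is finer than all members of the sequence
  (\<open>sct_refines_sequence\<close>). As \<open>S\<close> is also a union of blocks of every partition of \<open>G\<close> in
  the sequence (\<open>hat_const_on_cl_part\<close>), a superclass \<open>S\<close> never gets lost: it is squeezed between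
  the two. So the algorithm finds the coarsest theory with superclass \<open>S\<close> whenever there is one.

  A theory \<open>T\<close> is the meet of the coarsest theories of its superclasses. The superclass \<open>{1}\<close> belongs to
  every theory, and at most one superclass contains more than half of the nontrivial classes;
  being the complement of all the others, it can be omitted from the meet (\<open>sct_is_meet\<close>). If no
  superclass is left for the meet, then \<open>T\<close> is the coarse theory.

  Completeness (\<open>Irr_complete\<close>) is obtained without decomposing the regular representation. If
  a class function \<open>f\<close> acts as zero in all irreducible representations, then it has no nonzero eigenvalue in
  the regular representation, since the eigenspace would contain an irreducible
  subrepresentation. Hence its trace there vanishes, which is a multiple of \<open>f(1)\<close>; applied to the
  convolution of \<open>f\<close> with its adjoint, this gives \<open>f = 0\<close>.
\<close>

section \<open>Linear systems\<close>

text \<open>Induction on the number of equations: an unknown with nonzero coefficient in the new equation is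
  eliminated from all others.\<close>

lemma underdetermined_system:
  fixes M :: "'b \<Rightarrow> 'c \<Rightarrow> 'f::field"
  assumes "finite B" "finite A" "card B < card A"
  shows "\<exists>c. (\<exists>a\<in>A. c a \<noteq> 0) \<and> (\<forall>b\<in>B. (\<Sum>a\<in>A. c a * M a b) = 0)"
  using assms
proof (induction B arbitrary: A M rule: finite_induct)
  case empty
  then obtain a where "a \<in> A"
    by fastforce
  then show ?case
    by (intro exI[of _ "\<lambda>_. 1"]) auto
next
  case (insert b B)
  show ?case
  proof (cases "\<forall>a\<in>A. M a b = 0")
    case True
    from insert.IH[of A M] insert.prems insert.hyps show ?thesis
      using True by auto
  next
    case False
    then obtain p where p: "p \<in> A" "M p b \<noteq> 0"
      by blast
    define A' where "A' = A - {p}"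
    have A': "finite A'" "card B < card A'" "A = insert p A'" "p \<notin> A'"
      using insert.prems insert.hyps p by (auto simp: A'_def card_Diff_singleton)
    obtain c where c: "\<exists>a\<in>A'. c a \<noteq> 0"
      "\<forall>b'\<in>B. (\<Sum>a\<in>A'. c a * (M a b' - M a b / M p b * M p b')) = 0"
      using insert.IH[OF A'(1,2), of "\<lambda>a b'. M a b' - M a b / M p b * M p b'"] by blast
    define s where "s = (\<Sum>a\<in>A'. c a * M a b)"
    define c' where "c' = c(p := - s / M p b)"
    have sum: "(\<Sum>a\<in>A. c' a * M a b') = (\<Sum>a\<in>A'. c a * M a b') - s / M p b * M p b'" for b'
    proof -
      have "(\<Sum>a\<in>A'. c' a * M a b') = (\<Sum>a\<in>A'. c a * M a b')"
        using A'(4) by (intro sum.cong) (auto simp: c'_def)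
      then show ?thesis
        using A' by (simp add: c'_def)
    qed
    have "(\<Sum>a\<in>A. c' a * M a b') = 0" if "b' \<in> B" for b'
    proof -
      have "(\<Sum>a\<in>A'. c a * (M a b' - M a b / M p b * M p b'))
          = (\<Sum>a\<in>A'. c a * M a b' - c a * M a b * (M p b' / M p b))"
        by (intro sum.cong) (auto simp: algebra_simps)
      also have "\<dots> = (\<Sum>a\<in>A'. c a * M a b') - s / M p b * M p b'"
        by (simp only: sum_subtractf s_def sum_distrib_right[symmetric]) simp
      finally show ?thesis
        using c(2) that sum by simp
    qed
    moreover have "(\<Sum>a\<in>A. c' a * M a b) = 0"
      unfolding sum using p by (simp add: s_def)
    moreover have "\<exists>a\<in>A. c' a \<noteq> 0"
      using c(1) A'(3,4) by (auto simp: c'_def)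
    ultimately show ?thesis
      by (intro exI[of _ c']) auto
  qed
qed

lemma independent_rows_card_le:
  fixes M :: "'b \<Rightarrow> 'c \<Rightarrow> 'f::field"
  assumes "finite A" "finite B"
    and "\<And>c. \<forall>b\<in>B. (\<Sum>a\<in>A. c a * M a b) = 0 \<Longrightarrow> \<forall>a\<in>A. c a = 0"
  shows "card A \<le> card B"
  using underdetermined_system[OF assms(2,1), of M] assms(3) by (meson not_le)

text \<open>Adjoining the right-hand side as one more row leaves more rows than columns; in a relation
  between them the new row has a nonzero coefficient, because the old rows are independent.\<close>

lemma independent_rows_solvable:
  fixes M :: "'b \<Rightarrow> 'c \<Rightarrow> 'f::field"
  assumes A: "finite A" and B: "finite B" and le: "card B \<le> card A"
    and indep: "\<And>c. \<forall>b\<in>B. (\<Sum>a\<in>A. c a * M a b) = 0 \<Longrightarrow> \<forall>a\<in>A. c a = 0"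
  shows "\<exists>c. \<forall>b\<in>B. (\<Sum>a\<in>A. c a * M a b) = d b"
proof -
  define M' where "M' = (\<lambda>x b. case x of None \<Rightarrow> d b | Some a \<Rightarrow> M a b)"
  have card: "card B < card (insert None (Some ` A))"
    using A le by (simp add: card_image)
  obtain c where c: "\<exists>x\<in>insert None (Some ` A). c x \<noteq> 0"
    "\<forall>b\<in>B. (\<Sum>x\<in>insert None (Some ` A). c x * M' x b) = 0"
    using underdetermined_system[OF B _ card, of M'] A by blast
  have eq: "c None * d b + (\<Sum>a\<in>A. c (Some a) * M a b) = 0" if "b \<in> B" for b
    using c(2) that A by (simp add: M'_def sum.reindex)
  have nz: "c None \<noteq> 0"
  proof
    assume "c None = 0"
    with eq indep[of "\<lambda>a. c (Some a)"] c(1) show False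
      by auto
  qed
  have "(\<Sum>a\<in>A. (- c (Some a) / c None) * M a b) = d b" if "b \<in> B" for b
  proof -
    have "(\<Sum>a\<in>A. (- c (Some a) / c None) * M a b) = - (\<Sum>a\<in>A. c (Some a) * M a b) / c None"
      by (simp add: sum_negf[symmetric] sum_divide_distrib)
    also have "\<dots> = d b"
      using eq[OF that] nz by (simp add: field_simps add_eq_0_iff)
    finally show ?thesis .
  qed
  then show ?thesis
    by (intro exI[of _ "\<lambda>a. - c (Some a) / c None"]) blast
qed

section \<open>Matrices\<close>

lemma mult_mat_vec_index:
  "A \<in> carrier_mat n k \<Longrightarrow> v \<in> carrier_vec k \<Longrightarrow> i < n \<Longrightarrow>
    (A *\<^sub>v v) $ i = (\<Sum>j<k. A $$ (i, j) * v $ j)"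
  by (auto simp: scalar_prod_def lessThan_atLeast0)

lemma mult_mat_index:
  "A \<in> carrier_mat n k \<Longrightarrow> B \<in> carrier_mat k m \<Longrightarrow> i < n \<Longrightarrow> j < m \<Longrightarrow>
    (A * B) $$ (i, j) = (\<Sum>l<k. A $$ (i, l) * B $$ (l, j))"
  by (auto simp: scalar_prod_def lessThan_atLeast0)

definition inj_mat :: "complex mat \<Rightarrow> bool" where
  "inj_mat B \<longleftrightarrow> (\<forall>v\<in>carrier_vec (dim_col B). B *\<^sub>v v = 0\<^sub>v (dim_row B) \<longrightarrow> v = 0\<^sub>v (dim_col B))"

lemma inj_mat_independent:
  assumes B: "B \<in> carrier_mat n k" and inj: "inj_mat B"
    and c: "\<forall>i\<in>{..<n}. (\<Sum>j<k. c j * B $$ (i, j)) = 0"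
  shows "\<forall>j\<in>{..<k}. c j = 0"
proof -
  have "B *\<^sub>v vec k c = 0\<^sub>v n"
    using c B by (intro eq_vecI) (auto simp: mult_mat_vec_index[OF B] mult.commute simp del: index_mult_mat_vec)
  then have "vec k c = 0\<^sub>v k"
    using inj B unfolding inj_mat_def by auto
  then show ?thesis
    by (metis index_vec index_zero_vec(1) lessThan_iff)
qed

lemma inj_mat_dim_le:
  assumes "B \<in> carrier_mat n k" and "inj_mat B"
  shows "k \<le> n"
  using independent_rows_card_le[of "{..<k}" "{..<n}" "\<lambda>j i. B $$ (i, j)"]
    inj_mat_independent[OF assms] by simp

lemma inj_mat_surj:
  assumes B: "B \<in> carrier_mat n n" and inj: "inj_mat B" and w: "w \<in> carrier_vec n"
  shows "\<exists>v\<in>carrier_vec n. B *\<^sub>v v = w"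
proof -
  obtain c where c: "\<forall>i\<in>{..<n}. (\<Sum>j<n. c j * B $$ (i, j)) = w $ i"
    using independent_rows_solvable[of "{..<n}" "{..<n}" "\<lambda>j i. B $$ (i, j)" "\<lambda>i. w $ i"]
      inj_mat_independent[OF B inj] by auto
  have "B *\<^sub>v vec n c = w"
    using c B w
    by (intro eq_vecI) (auto simp: mult_mat_vec_index[OF B] mult.commute simp del: index_mult_mat_vec)
  then show ?thesis
    by (intro bexI[of _ "vec n c"]) auto
qed

text \<open>Preimages of the unit vectors form a right inverse \<open>C\<close>, and \<open>B (C B) = B\<close> makes it a left inverse
  because \<open>B\<close> is injective.\<close>

lemma bij_mat_inverse:
  assumes B: "B \<in> carrier_mat n k" and inj: "inj_mat B"
    and surj: "\<And>w. w \<in> carrier_vec n \<Longrightarrow> \<exists>v\<in>carrier_vec k. B *\<^sub>v v = w"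
  obtains C where "C \<in> carrier_mat k n" "B * C = 1\<^sub>m n" "C * B = 1\<^sub>m k"
proof -
  obtain f where f: "\<And>j. j < n \<Longrightarrow> f j \<in> carrier_vec k \<and> B *\<^sub>v f j = unit_vec n j"
    using surj[OF unit_vec_carrier] by metis
  define C where "C = mat k n (\<lambda>(i, j). f j $ i)"
  have C: "C \<in> carrier_mat k n"
    by (simp add: C_def)
  have colC: "col C j = f j" if "j < n" for j
    using f[OF that] that by (intro eq_vecI) (auto simp: C_def)
  have BC: "B * C = 1\<^sub>m n"
  proof (rule mat_col_eqI)
    fix j assume "j < dim_col (1\<^sub>m n)"
    then have j: "j < n" by simp
    have "col (B * C) j = B *\<^sub>v f j"
      using B C j colC by (metis col_mult2)
    then show "col (B * C) j = col (1\<^sub>m n) j"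
      using f j by simp
  qed (use B C in auto)
  have "C * B = 1\<^sub>m k"
  proof (rule mat_col_eqI)
    fix j assume "j < dim_col (1\<^sub>m k)"
    then have j: "j < k" by simp
    define v where "v = col (C * B) j - unit_vec k j"
    have cv: "col (C * B) j \<in> carrier_vec k"
      using B C j by (intro col_carrier_vec) auto
    then have v: "v \<in> carrier_vec k"
      by (simp add: v_def)
    have "B *\<^sub>v v = B *\<^sub>v col (C * B) j - B *\<^sub>v unit_vec k j"
      unfolding v_def using B cv by (intro mult_minus_distrib_mat_vec) auto
    also have "B *\<^sub>v col (C * B) j = B *\<^sub>v (C *\<^sub>v col B j)"
      using B C j by (metis col_mult2)
    also have "\<dots> = (B * C) *\<^sub>v col B j"
      using B C j by (intro assoc_mult_mat_vec[symmetric]) auto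
    also have "\<dots> = col B j"
      unfolding BC using B by (intro one_mult_mat_vec) auto
    also have "B *\<^sub>v unit_vec k j = col B j"
      using B j by (intro eq_vecI) (auto simp: scalar_prod_right_unit)
    finally have "B *\<^sub>v v = 0\<^sub>v n"
      using B j by (auto intro!: eq_vecI)
    then have "v = 0\<^sub>v k"
      using inj B v unfolding inj_mat_def by auto
    then have "col (C * B) j = unit_vec k j"
      using cv C unfolding v_def by (auto simp: vec_eq_iff)
    then show "col (C * B) j = col (1\<^sub>m k) j"
      using j by simp
  qed (use B C in auto)
  with that C BC show thesis by blast
qed

lemma inj_mat_cancel:
  assumes B: "B \<in> carrier_mat n k" and inj: "inj_mat B"
    and X: "X \<in> carrier_mat k m" and Y: "Y \<in> carrier_mat k m" and eq: "B * X = B * Y"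
  shows "X = Y"
proof (rule eq_matI)
  fix i j assume "i < dim_row Y" "j < dim_col Y"
  then have i: "i < k" and j: "j < m"
    using Y by auto
  have "\<forall>l\<in>{..<k}. X $$ (l, j) - Y $$ (l, j) = 0"
  proof (rule inj_mat_independent[OF B inj], intro ballI)
    fix p assume "p \<in> {..<n}"
    then have p: "p < n" by simp
    have "(\<Sum>l<k. (X $$ (l, j) - Y $$ (l, j)) * B $$ (p, l)) = (B * X) $$ (p, j) - (B * Y) $$ (p, j)"
      unfolding mult_mat_index[OF B X p j] mult_mat_index[OF B Y p j]
      by (simp add: sum_subtractf[symmetric] algebra_simps)
    then show "(\<Sum>l<k. (X $$ (l, j) - Y $$ (l, j)) * B $$ (p, l)) = 0"
      using eq by simp
  qed
  then show "X $$ (i, j) = Y $$ (i, j)"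
    using i by simp
qed (use X Y in auto)

lemma factor_through_range:
  assumes C: "C \<in> carrier_mat n k" and A: "A \<in> carrier_mat n m"
    and sub: "\<And>j. j < m \<Longrightarrow> col A j \<in> (\<lambda>v. C *\<^sub>v v) ` carrier_vec k"
  shows "\<exists>R\<in>carrier_mat k m. A = C * R"
proof -
  have "\<forall>j. \<exists>v. j < m \<longrightarrow> v \<in> carrier_vec k \<and> col A j = C *\<^sub>v v"
    using sub by blast
  then obtain f where f: "\<And>j. j < m \<Longrightarrow> f j \<in> carrier_vec k" "\<And>j. j < m \<Longrightarrow> col A j = C *\<^sub>v f j"
    by metis
  define R where "R = mat k m (\<lambda>(i, j). f j $ i)"
  have R: "R \<in> carrier_mat k m"
    by (simp add: R_def)
  have "A = C * R"
  proof (rule mat_col_eqI)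
    fix j assume "j < dim_col (C * R)"
    then have j: "j < m"
      using R by simp
    have "col R j = f j"
      using f(1)[OF j] j by (intro eq_vecI) (auto simp: R_def)
    then show "col A j = col (C * R) j"
      using f(2)[OF j] col_mult2[OF C R j] by simp
  qed (use A C R in auto)
  then show ?thesis
    using R by blast
qed

lemma subspace_vec_iff:
  "VectorSpace.subspace class_ring W (module_vec TYPE(complex) n) \<longleftrightarrow>
     W \<subseteq> carrier_vec n \<and> 0\<^sub>v n \<in> W \<and> (\<forall>v\<in>W. \<forall>w\<in>W. v + w \<in> W) \<and> (\<forall>c. \<forall>v\<in>W. c \<cdot>\<^sub>v v \<in> W)"
proof -
  interpret V: vec_space "TYPE(complex)" n .
  have "vectorspace class_ring (module_vec TYPE(complex) n)" "Module.module class_ring (module_vec TYPE(complex) n)"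
    using V.vectorspace_axioms V.module_axioms by auto
  then show ?thesis
    by (auto simp: VectorSpace.subspace_def submodule_def module_vec_simps)
qed

text \<open>A matrix with columns in the subspace, injective, and with as many columns as possible, must
  span it: a vector outside its range could be appended as a further column.\<close>

lemma subspace_eq_range:
  assumes W: "VectorSpace.subspace class_ring W (module_vec TYPE(complex) n)"
  obtains k B where "B \<in> carrier_mat n k" "inj_mat B" "W = (\<lambda>v. B *\<^sub>v v) ` carrier_vec k"
proof -
  note W' = W[unfolded subspace_vec_iff]
  define P where "P k \<longleftrightarrow> (\<exists>B\<in>carrier_mat n k. inj_mat B \<and> (\<forall>v\<in>carrier_vec k. B *\<^sub>v v \<in> W))" for k
  have "P 0"
    unfolding P_def
  proof (intro bexI conjI ballI)
    show "inj_mat (0\<^sub>m n 0)"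
      by (auto simp: inj_mat_def)
    fix v :: "complex vec"
    assume "v \<in> carrier_vec 0"
    then have "0\<^sub>m n 0 *\<^sub>v v = 0\<^sub>v n"
      by (intro eq_vecI) (auto simp: scalar_prod_def)
    then show "0\<^sub>m n 0 *\<^sub>v v \<in> W"
      using W' by simp
  qed auto
  moreover have "k \<le> n" if "P k" for k
    using that inj_mat_dim_le unfolding P_def by blast
  ultimately have "P (Greatest P)" and max: "\<not> P (Suc (Greatest P))"
    using GreatestI_nat[of P 0 n] Greatest_le_nat[of P "Suc (Greatest P)" n] by auto
  define k where "k = Greatest P"
  obtain B where B: "B \<in> carrier_mat n k" "inj_mat B" "\<forall>v\<in>carrier_vec k. B *\<^sub>v v \<in> W"
    using \<open>P (Greatest P)\<close> unfolding P_def k_def by blast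
  have "w \<in> (\<lambda>v. B *\<^sub>v v) ` carrier_vec k" if w: "w \<in> W" for w
  proof (rule ccontr)
    assume notin: "w \<notin> (\<lambda>v. B *\<^sub>v v) ` carrier_vec k"
    have wn: "w \<in> carrier_vec n"
      using w W' by auto
    define B' where "B' = mat n (Suc k) (\<lambda>(i, j). if j < k then B $$ (i, j) else w $ i)"
    have B': "B' \<in> carrier_mat n (Suc k)"
      by (simp add: B'_def)
    have split: "B' *\<^sub>v v = B *\<^sub>v vec k (\<lambda>i. v $ i) + v $ k \<cdot>\<^sub>v w" if v: "v \<in> carrier_vec (Suc k)" for v
    proof (rule eq_vecI)
      fix i assume "i < dim_vec (B *\<^sub>v vec k (\<lambda>i. v $ i) + v $ k \<cdot>\<^sub>v w)"
      then have i: "i < n"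
        using wn by simp
      have "(B' *\<^sub>v v) $ i = (\<Sum>j<Suc k. B' $$ (i, j) * v $ j)"
        by (rule mult_mat_vec_index[OF B' v i])
      also have "\<dots> = (\<Sum>j<k. B $$ (i, j) * v $ j) + w $ i * v $ k"
        using i by (simp add: B'_def)
      finally show "(B' *\<^sub>v v) $ i = (B *\<^sub>v vec k (\<lambda>i. v $ i) + v $ k \<cdot>\<^sub>v w) $ i"
        using i wn B(1) by (simp add: mult_mat_vec_index[OF B(1)] mult.commute del: index_mult_mat_vec)
    qed (use wn B B' in auto)
    have "inj_mat B'"
      unfolding inj_mat_def
    proof (intro ballI impI)
      fix v assume v: "v \<in> carrier_vec (dim_col B')" and "B' *\<^sub>v v = 0\<^sub>v (dim_row B')"
      let ?u = "vec k (\<lambda>i. v $ i)"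
      have v': "v \<in> carrier_vec (Suc k)"
        using v B' by simp
      have eq: "B *\<^sub>v ?u + v $ k \<cdot>\<^sub>v w = 0\<^sub>v n"
        using split[OF v'] \<open>B' *\<^sub>v v = _\<close> B' by simp
      have vk: "v $ k = 0"
      proof (rule ccontr)
        assume nz: "v $ k \<noteq> 0"
        have "B *\<^sub>v ((- 1 / v $ k) \<cdot>\<^sub>v ?u) = (- 1 / v $ k) \<cdot>\<^sub>v (B *\<^sub>v ?u)"
          using B(1) by (intro mult_mat_vec) auto
        also have "\<dots> = w"
        proof (rule eq_vecI)
          fix i assume i: "i < dim_vec w"
          have "(B *\<^sub>v ?u) $ i + v $ k * w $ i = 0"
            using arg_cong[OF eq, of "\<lambda>x. x $ i"] i wn B(1) by (simp del: index_mult_mat_vec)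
          then have "(B *\<^sub>v ?u) $ i = - (v $ k * w $ i)"
            by (simp add: eq_neg_iff_add_eq_0)
          then show "((- 1 / v $ k) \<cdot>\<^sub>v (B *\<^sub>v ?u)) $ i = w $ i"
            using i wn B(1) nz by (simp del: index_mult_mat_vec)
        qed (use wn B in auto)
        finally show False
          using notin by (metis image_eqI smult_carrier_vec vec_carrier)
      qed
      then have "B *\<^sub>v ?u = 0\<^sub>v n"
        using eq wn B(1) by (auto simp: vec_eq_iff simp del: index_mult_mat_vec)
      then have "?u = 0\<^sub>v k"
        using B unfolding inj_mat_def by auto
      then have "v $ i = 0" if "i < k" for i
        using that by (metis index_vec index_zero_vec(1))
      then show "v = 0\<^sub>v (dim_col B')"
        using vk v' B' by (intro eq_vecI) (auto simp: less_Suc_eq)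
    qed
    moreover have "\<forall>v\<in>carrier_vec (Suc k). B' *\<^sub>v v \<in> W"
      using split B(3) W' w by simp
    ultimately show False
      using B' max unfolding P_def k_def by blast
  qed
  then show thesis
    using that B by blast
qed

lemma mat_trace_carrier: "A \<in> carrier_mat n m \<Longrightarrow> mat_trace A = (\<Sum>i<n. A $$ (i, i))"
  by (auto simp: mat_trace_def)

lemma mat_trace_mult_commute:
  assumes "A \<in> carrier_mat n m" "B \<in> carrier_mat m n"
  shows "mat_trace (A * B) = mat_trace (B * A)"
proof -
  have "mat_trace (A * B) = (\<Sum>i<n. \<Sum>l<m. A $$ (i, l) * B $$ (l, i))"
    using assms by (simp add: mat_trace_carrier[of _ n n] mult_mat_index[OF assms] del: index_mult_mat)
  also have "\<dots> = (\<Sum>l<m. \<Sum>i<n. B $$ (l, i) * A $$ (i, l))"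
    by (subst sum.swap) (simp add: mult.commute)
  also have "\<dots> = mat_trace (B * A)"
    using assms by (simp add: mat_trace_carrier[of _ m m] mult_mat_index[OF assms(2,1)] del: index_mult_mat)
  finally show ?thesis .
qed

lemma mat_trace_one [simp]: "mat_trace (1\<^sub>m n) = of_nat n"
  by (simp add: mat_trace_def)

lemma mat_trace_smult: "A \<in> carrier_mat n n \<Longrightarrow> mat_trace (c \<cdot>\<^sub>m A) = c * mat_trace A"
  by (auto simp: mat_trace_def sum_distrib_left)

text \<open>The dimensions are arguments because they are not determined by the summands when \<open>S\<close> is empty.\<close>

definition mat_sum :: "nat \<Rightarrow> nat \<Rightarrow> ('b \<Rightarrow> complex mat) \<Rightarrow> 'b set \<Rightarrow> complex mat" where
  "mat_sum n m F S = mat n m (\<lambda>ij. \<Sum>x\<in>S. F x $$ ij)"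

lemma mat_sum_carrier [simp]: "mat_sum n m F S \<in> carrier_mat n m"
  by (simp add: mat_sum_def)

lemma mat_sum_index: "i < n \<Longrightarrow> j < m \<Longrightarrow> mat_sum n m F S $$ (i, j) = (\<Sum>x\<in>S. F x $$ (i, j))"
  by (simp add: mat_sum_def)

lemma mat_sum_cong: "(\<And>x. x \<in> S \<Longrightarrow> F x = H x) \<Longrightarrow> mat_sum n m F S = mat_sum n m H S"
  by (simp add: mat_sum_def)

lemma mat_sum_reindex: "bij_betw h S T \<Longrightarrow> mat_sum n m (\<lambda>x. F (h x)) S = mat_sum n m F T"
  unfolding mat_sum_def by (intro arg_cong[of _ _ "mat n m"] ext sum.reindex_bij_betw)

lemma mult_mat_sum:
  assumes A: "A \<in> carrier_mat k n" and F: "\<And>x. x \<in> S \<Longrightarrow> F x \<in> carrier_mat n m"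
  shows "A * mat_sum n m F S = mat_sum k m (\<lambda>x. A * F x) S"
proof (rule eq_matI)
  fix i j assume "i < dim_row (mat_sum k m (\<lambda>x. A * F x) S)" "j < dim_col (mat_sum k m (\<lambda>x. A * F x) S)"
  then have ij: "i < k" "j < m"
    by (auto simp: mat_sum_def)
  have "(A * mat_sum n m F S) $$ (i, j) = (\<Sum>l<n. A $$ (i, l) * (\<Sum>x\<in>S. F x $$ (l, j)))"
    using ij by (simp add: mult_mat_index[OF A mat_sum_carrier] mat_sum_index del: index_mult_mat)
  also have "\<dots> = (\<Sum>x\<in>S. \<Sum>l<n. A $$ (i, l) * F x $$ (l, j))"
    by (subst sum.swap) (simp add: sum_distrib_left)
  also have "\<dots> = mat_sum k m (\<lambda>x. A * F x) S $$ (i, j)"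
    using ij by (simp add: mat_sum_index mult_mat_index[OF A F] del: index_mult_mat)
  finally show "(A * mat_sum n m F S) $$ (i, j) = mat_sum k m (\<lambda>x. A * F x) S $$ (i, j)" .
qed (use A in \<open>auto simp: mat_sum_def\<close>)

lemma mat_sum_mult:
  assumes A: "A \<in> carrier_mat m k" and F: "\<And>x. x \<in> S \<Longrightarrow> F x \<in> carrier_mat n m"
  shows "mat_sum n m F S * A = mat_sum n k (\<lambda>x. F x * A) S"
proof (rule eq_matI)
  fix i j assume "i < dim_row (mat_sum n k (\<lambda>x. F x * A) S)" "j < dim_col (mat_sum n k (\<lambda>x. F x * A) S)"
  then have ij: "i < n" "j < k"
    by (auto simp: mat_sum_def)
  have "(mat_sum n m F S * A) $$ (i, j) = (\<Sum>l<m. (\<Sum>x\<in>S. F x $$ (i, l)) * A $$ (l, j))"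
    using ij by (simp add: mult_mat_index[OF mat_sum_carrier A] mat_sum_index del: index_mult_mat)
  also have "\<dots> = (\<Sum>x\<in>S. \<Sum>l<m. F x $$ (i, l) * A $$ (l, j))"
    by (subst sum.swap) (simp add: sum_distrib_right)
  also have "\<dots> = mat_sum n k (\<lambda>x. F x * A) S $$ (i, j)"
    using ij by (simp add: mat_sum_index mult_mat_index[OF F A] del: index_mult_mat)
  finally show "(mat_sum n m F S * A) $$ (i, j) = mat_sum n k (\<lambda>x. F x * A) S $$ (i, j)" .
qed (use A in \<open>auto simp: mat_sum_def\<close>)

lemma mat_trace_mat_sum:
  assumes "\<And>x. x \<in> S \<Longrightarrow> F x \<in> carrier_mat n n"
  shows "mat_trace (mat_sum n n F S) = (\<Sum>x\<in>S. mat_trace (F x))"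
proof -
  have "mat_trace (mat_sum n n F S) = (\<Sum>i<n. \<Sum>x\<in>S. F x $$ (i, i))"
    by (simp add: mat_trace_carrier[of _ n n] mat_sum_index)
  also have "\<dots> = (\<Sum>x\<in>S. mat_trace (F x))"
    by (subst sum.swap) (simp add: mat_trace_carrier[OF assms])
  finally show ?thesis .
qed

lemma exists_eigenvalue:
  fixes A :: "complex mat"
  assumes A: "A \<in> carrier_mat n n" and n: "0 < n"
  shows "\<exists>c. eigenvalue A c"
proof -
  obtain as where as: "char_poly A = (\<Prod>a\<leftarrow>as. [:- a, 1:])" "length as = n"
    using char_poly_factorized[OF A] by blast
  then obtain a as' where "as = a # as'"
    using n by (cases as) auto
  then have "poly (char_poly A) a = 0"
    by (simp add: as(1))
  then show ?thesis
    using eigenvalue_root_char_poly[OF A] by blast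
qed

text \<open>The trace is the sum of the diagonal entries of a triangular matrix similar to \<open>A\<close>, and these
  are eigenvalues.\<close>

lemma mat_trace_eq_0_if_eigenvalues_0:
  fixes A :: "complex mat"
  assumes A: "A \<in> carrier_mat n n" and ev: "\<And>c. eigenvalue A c \<Longrightarrow> c = 0"
  shows "mat_trace A = 0"
proof -
  obtain as where as: "char_poly A = (\<Prod>a\<leftarrow>as. [:- a, 1:])"
    using char_poly_factorized[OF A] by blast
  define T where "T = schur_upper_triangular A as"
  have T: "T \<in> carrier_mat n n" "upper_triangular T" "similar_mat A T"
    using schur_upper_triangular[OF A as] unfolding T_def by auto
  obtain m P Q where PQ: "{A, T, P, Q} \<subseteq> carrier_mat m m" "Q * P = 1\<^sub>m m" "A = P * T * Q"
    using similar_matD[OF T(3)] by blast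
  have cp: "char_poly A = (\<Prod>a\<leftarrow>diag_mat T. [:- a, 1:])"
    using char_poly_similar[OF T(3)] char_poly_upper_triangular[OF T(1,2)] by simp
  have "T $$ (i, i) = 0" if "i < n" for i
  proof -
    have "T $$ (i, i) \<in> set (diag_mat T)"
      using that T(1) by (auto simp: diag_mat_def)
    then have "poly (char_poly A) (T $$ (i, i)) = 0"
      unfolding cp by (auto simp: poly_prod_list prod_list_zero_iff image_iff)
    then show ?thesis
      using ev eigenvalue_root_char_poly[OF A] by blast
  qed
  then have "mat_trace T = 0"
    using T(1) by (simp add: mat_trace_carrier)
  moreover have "mat_trace A = mat_trace (Q * (P * T))"
    unfolding PQ(3) using PQ(1) by (intro mat_trace_mult_commute[of _ m m]) auto
  moreover have "Q * (P * T) = T"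
    using PQ(1,2) by (metis assoc_mult_mat insert_subset left_mult_one_mat)
  ultimately show ?thesis
    by simp
qed

section \<open>Matrix representations and Schur's lemma\<close>

lemma subspace_kernel:
  assumes M: "M \<in> carrier_mat m n"
  shows "VectorSpace.subspace class_ring {v \<in> carrier_vec n. M *\<^sub>v v = 0\<^sub>v m} (module_vec TYPE(complex) n)"
  unfolding subspace_vec_iff
proof (intro conjI ballI allI)
  show "0\<^sub>v n \<in> {v \<in> carrier_vec n. M *\<^sub>v v = 0\<^sub>v m}"
    using M by (auto intro!: eq_vecI)
next
  fix v w assume vw: "v \<in> {v \<in> carrier_vec n. M *\<^sub>v v = 0\<^sub>v m}" "w \<in> {v \<in> carrier_vec n. M *\<^sub>v v = 0\<^sub>v m}"
  then have "M *\<^sub>v (v + w) = M *\<^sub>v v + M *\<^sub>v w"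
    using M by (intro mult_add_distrib_mat_vec) auto
  then show "v + w \<in> {v \<in> carrier_vec n. M *\<^sub>v v = 0\<^sub>v m}"
    using vw by auto
next
  fix c v assume v: "v \<in> {v \<in> carrier_vec n. M *\<^sub>v v = 0\<^sub>v m}"
  then have "M *\<^sub>v (c \<cdot>\<^sub>v v) = c \<cdot>\<^sub>v (M *\<^sub>v v)"
    using M by (intro mult_mat_vec) auto
  then show "c \<cdot>\<^sub>v v \<in> {v \<in> carrier_vec n. M *\<^sub>v v = 0\<^sub>v m}"
    using v by auto
qed auto

lemma subspace_image:
  assumes M: "M \<in> carrier_mat m n" and W: "VectorSpace.subspace class_ring W (module_vec TYPE(complex) n)"
  shows "VectorSpace.subspace class_ring ((\<lambda>v. M *\<^sub>v v) ` W) (module_vec TYPE(complex) m)"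
  unfolding subspace_vec_iff
proof (intro conjI ballI allI)
  note W' = W[unfolded subspace_vec_iff]
  then have sub: "W \<subseteq> carrier_vec n"
    by blast
  show "(\<lambda>v. M *\<^sub>v v) ` W \<subseteq> carrier_vec m"
    using M sub by auto
  have "0\<^sub>v m = M *\<^sub>v 0\<^sub>v n"
    using M by (auto intro!: eq_vecI)
  then show "0\<^sub>v m \<in> (\<lambda>v. M *\<^sub>v v) ` W"
    using W' by blast
  show "v + w \<in> (\<lambda>v. M *\<^sub>v v) ` W" if vw: "v \<in> (\<lambda>v. M *\<^sub>v v) ` W" "w \<in> (\<lambda>v. M *\<^sub>v v) ` W" for v w
  proof -
    obtain v' w' where "v' \<in> W" "w' \<in> W" "v = M *\<^sub>v v'" "w = M *\<^sub>v w'"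
      using vw by blast
    moreover have "M *\<^sub>v (v' + w') = M *\<^sub>v v' + M *\<^sub>v w'"
      using M sub calculation by (intro mult_add_distrib_mat_vec) auto
    ultimately show ?thesis
      using W' by (metis image_eqI)
  qed
  show "c \<cdot>\<^sub>v v \<in> (\<lambda>v. M *\<^sub>v v) ` W" if v: "v \<in> (\<lambda>v. M *\<^sub>v v) ` W" for c v
  proof -
    obtain v' where "v' \<in> W" "v = M *\<^sub>v v'"
      using v by blast
    moreover have "M *\<^sub>v (c \<cdot>\<^sub>v v') = c \<cdot>\<^sub>v (M *\<^sub>v v')"
      using M sub calculation by (intro mult_mat_vec) auto
    ultimately show ?thesis
      using W' by (metis image_eqI)
  qed
qed

lemma subspace_full: "VectorSpace.subspace class_ring (carrier_vec n) (module_vec TYPE(complex) n)"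
  by (auto simp: subspace_vec_iff)

locale fin_group = group G for G (structure) +
  assumes fin [simp]: "finite (carrier G)"
begin

definition mat_rep :: "nat \<Rightarrow> ('a \<Rightarrow> complex mat) \<Rightarrow> bool" where
  "mat_rep n \<rho> \<longleftrightarrow> (\<forall>g\<in>carrier G. \<rho> g \<in> carrier_mat n n) \<and> \<rho> \<one> = 1\<^sub>m n \<and>
     (\<forall>g\<in>carrier G. \<forall>h\<in>carrier G. \<rho> (g \<otimes> h) = \<rho> g * \<rho> h)"

definition invariant_subspace :: "nat \<Rightarrow> ('a \<Rightarrow> complex mat) \<Rightarrow> complex vec set \<Rightarrow> bool" where
  "invariant_subspace n \<rho> W \<longleftrightarrow> VectorSpace.subspace class_ring W (module_vec TYPE(complex) n) \<and>
     (\<forall>g\<in>carrier G. \<forall>w\<in>W. \<rho> g *\<^sub>v w \<in> W)"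

lemma mat_repD:
  assumes "mat_rep n \<rho>"
  shows "g \<in> carrier G \<Longrightarrow> \<rho> g \<in> carrier_mat n n" "\<rho> \<one> = 1\<^sub>m n"
    "g \<in> carrier G \<Longrightarrow> h \<in> carrier G \<Longrightarrow> \<rho> (g \<otimes> h) = \<rho> g * \<rho> h"
    "g \<in> carrier G \<Longrightarrow> \<rho> g * \<rho> (inv g) = 1\<^sub>m n"
    "g \<in> carrier G \<Longrightarrow> \<rho> (inv g) * \<rho> g = 1\<^sub>m n"
  using assms unfolding mat_rep_def by (auto simp: inv_closed) (metis inv_closed r_inv, metis inv_closed l_inv)

lemma hom_GL_iff: "\<rho> \<in> hom G (GL n) \<longleftrightarrow> mat_rep n \<rho>"
proof
  assume "\<rho> \<in> hom G (GL n)"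
  then have U: "\<And>g. g \<in> carrier G \<Longrightarrow> \<rho> g \<in> Units (ring_mat TYPE(complex) n ())"
    and mult: "\<And>g h. g \<in> carrier G \<Longrightarrow> h \<in> carrier G \<Longrightarrow> \<rho> (g \<otimes> h) = \<rho> g * \<rho> h"
    by (auto simp: hom_def units_of_def ring_mat_simps)
  have carr: "\<And>g. g \<in> carrier G \<Longrightarrow> \<rho> g \<in> carrier_mat n n"
    using U by (auto simp: Units_def ring_mat_simps)
  obtain x where x: "x \<in> carrier_mat n n" "x * \<rho> \<one> = 1\<^sub>m n"
    using U[OF one_closed] by (auto simp: Units_def ring_mat_simps)
  have "\<rho> \<one> = x * \<rho> \<one> * \<rho> \<one>"
    using carr[OF one_closed] by (simp add: x)
  also have "\<dots> = x * (\<rho> \<one> * \<rho> \<one>)"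
    using carr[OF one_closed] x by (intro assoc_mult_mat) auto
  also have "\<dots> = 1\<^sub>m n"
    using mult[of \<one> \<one>] x by simp
  finally show "mat_rep n \<rho>"
    using carr mult by (auto simp: mat_rep_def)
next
  assume rep: "mat_rep n \<rho>"
  note R = mat_repD[OF rep]
  have "\<rho> g \<in> Units (ring_mat TYPE(complex) n ())" if g: "g \<in> carrier G" for g
    using R(1)[OF g] R(1)[OF inv_closed[OF g]] R(4,5)[OF g] by (auto simp: Units_def ring_mat_simps)
  then show "\<rho> \<in> hom G (GL n)"
    using R(3) by (auto simp: hom_def units_of_def ring_mat_simps)
qed

lemma irreducible_rep_iff:
  "irreducible_rep G n \<rho> \<longleftrightarrow> mat_rep n \<rho> \<and> 0 < n \<and>
     (\<forall>W. invariant_subspace n \<rho> W \<longrightarrow> W = {0\<^sub>v n} \<or> W = carrier_vec n)"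
  by (simp add: irreducible_rep_def hom_GL_iff invariant_subspace_def)

text \<open>Kernel and range of an intertwining matrix are invariant, so irreducibility leaves only the
  zero matrix and the bijective ones.\<close>

lemma schur_zero_or_invertible:
  assumes \<rho>: "irreducible_rep G n \<rho>" and \<tau>: "irreducible_rep G m \<tau>"
    and M: "M \<in> carrier_mat m n"
    and comm: "\<And>g. g \<in> carrier G \<Longrightarrow> \<tau> g * M = M * \<rho> g"
  shows "M = 0\<^sub>m m n \<or> (\<exists>N\<in>carrier_mat n m. M * N = 1\<^sub>m m \<and> N * M = 1\<^sub>m n)"
proof -
  have rep\<rho>: "mat_rep n \<rho>" and rep\<tau>: "mat_rep m \<tau>" and n: "0 < n"
    using \<rho> \<tau> by (auto simp: irreducible_rep_iff)
  note R = mat_repD[OF rep\<rho>] and T = mat_repD[OF rep\<tau>]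
  have swap: "\<tau> g *\<^sub>v (M *\<^sub>v v) = M *\<^sub>v (\<rho> g *\<^sub>v v)" if "g \<in> carrier G" "v \<in> carrier_vec n" for g v
    using comm[OF that(1)] R(1)[OF that(1)] T(1)[OF that(1)] M that(2)
    by (metis assoc_mult_mat_vec)
  let ?K = "{v \<in> carrier_vec n. M *\<^sub>v v = 0\<^sub>v m}"
  let ?I = "(\<lambda>v. M *\<^sub>v v) ` carrier_vec n"
  have "invariant_subspace n \<rho> ?K"
    unfolding invariant_subspace_def
  proof (intro conjI subspace_kernel[OF M] ballI)
    fix g w assume g: "g \<in> carrier G" and w: "w \<in> ?K"
    have "M *\<^sub>v (\<rho> g *\<^sub>v w) = \<tau> g *\<^sub>v 0\<^sub>v m"
      using swap[OF g, of w] w by auto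
    also have "\<dots> = 0\<^sub>v m"
      using T(1)[OF g] by (auto intro!: eq_vecI)
    finally show "\<rho> g *\<^sub>v w \<in> ?K"
      using w R(1)[OF g] by auto
  qed
  moreover have "invariant_subspace m \<tau> ?I"
    unfolding invariant_subspace_def
  proof (intro conjI subspace_image[OF M subspace_full] ballI)
    fix g w assume g: "g \<in> carrier G" and w: "w \<in> ?I"
    then obtain v where v: "v \<in> carrier_vec n" "w = M *\<^sub>v v"
      by blast
    moreover have "\<rho> g *\<^sub>v v \<in> carrier_vec n"
      using R(1)[OF g] v by auto
    ultimately show "\<tau> g *\<^sub>v w \<in> ?I"
      using swap[OF g v(1)] by blast
  qed
  ultimately have KI: "?K = {0\<^sub>v n} \<or> ?K = carrier_vec n" "?I = {0\<^sub>v m} \<or> ?I = carrier_vec m"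
    using \<rho> \<tau> unfolding irreducible_rep_iff by blast+
  have zero: "M = 0\<^sub>m m n" if "\<And>v. v \<in> carrier_vec n \<Longrightarrow> M *\<^sub>v v = 0\<^sub>v m"
  proof (rule mat_col_eqI)
    fix j assume "j < dim_col (0\<^sub>m m n)"
    then have j: "j < n" by simp
    have "col M j = M *\<^sub>v unit_vec n j"
      using M j by (intro eq_vecI) (auto simp: scalar_prod_right_unit)
    then show "col M j = col (0\<^sub>m m n) j"
      using that j by (simp add: col_def) (auto intro!: eq_vecI)
  qed (use M in auto)
  show ?thesis
  proof (cases "?K = carrier_vec n \<or> ?I = {0\<^sub>v m}")
    case True
    then have "M = 0\<^sub>m m n"
      by (intro zero) blast
    then show ?thesis ..
  next
    case False
    then have K: "?K = {0\<^sub>v n}" and I: "?I = carrier_vec m"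
      using KI by auto
    have "inj_mat M"
      using K M unfolding inj_mat_def by auto
    moreover have "\<exists>v\<in>carrier_vec n. M *\<^sub>v v = w" if "w \<in> carrier_vec m" for w
      using that unfolding I[symmetric] by auto
    ultimately obtain N where "N \<in> carrier_mat n m" "M * N = 1\<^sub>m m" "N * M = 1\<^sub>m n"
      using bij_mat_inverse[OF M] by blast
    then show ?thesis
      by blast
  qed
qed

text \<open>Subtracting an eigenvalue makes the commuting matrix singular, hence zero.\<close>

lemma schur_scalar:
  assumes \<rho>: "irreducible_rep G n \<rho>" and M: "M \<in> carrier_mat n n"
    and comm: "\<And>g. g \<in> carrier G \<Longrightarrow> \<rho> g * M = M * \<rho> g"
  shows "\<exists>c. M = c \<cdot>\<^sub>m 1\<^sub>m n"
proof -
  have rep: "mat_rep n \<rho>" and n: "0 < n"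
    using \<rho> by (auto simp: irreducible_rep_iff)
  note R = mat_repD[OF rep]
  obtain c v where v: "v \<in> carrier_vec n" "v \<noteq> 0\<^sub>v n" "M *\<^sub>v v = c \<cdot>\<^sub>v v"
    using exists_eigenvalue[OF M n] M unfolding eigenvalue_def eigenvector_def by auto
  define N where "N = M - c \<cdot>\<^sub>m 1\<^sub>m n"
  have N: "N \<in> carrier_mat n n"
    using M by (auto simp: N_def)
  have "\<rho> g * N = N * \<rho> g" if g: "g \<in> carrier G" for g
  proof -
    have "\<rho> g * N = \<rho> g * M - \<rho> g * (c \<cdot>\<^sub>m 1\<^sub>m n)"
      unfolding N_def using R(1)[OF g] M by (intro mult_minus_distrib_mat) auto
    also have "\<rho> g * (c \<cdot>\<^sub>m 1\<^sub>m n) = c \<cdot>\<^sub>m 1\<^sub>m n * \<rho> g"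
      using R(1)[OF g] mult_smult_assoc_mat[of "1\<^sub>m n" n n "\<rho> g" n c] mult_smult_distrib[of "\<rho> g" n n "1\<^sub>m n" n c] by simp
    also have "\<rho> g * M - c \<cdot>\<^sub>m 1\<^sub>m n * \<rho> g = N * \<rho> g"
      unfolding N_def comm[OF g] using R(1)[OF g] M by (intro minus_mult_distrib_mat[symmetric]) auto
    finally show ?thesis .
  qed
  then consider "N = 0\<^sub>m n n" | N' where "N' \<in> carrier_mat n n" "N' * N = 1\<^sub>m n"
    using schur_zero_or_invertible[OF \<rho> \<rho> N] by blast
  then show ?thesis
  proof cases
    case 1
    have "M = c \<cdot>\<^sub>m 1\<^sub>m n"
    proof (rule eq_matI)
      fix i j assume "i < dim_row (c \<cdot>\<^sub>m 1\<^sub>m n)" "j < dim_col (c \<cdot>\<^sub>m 1\<^sub>m n)"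
      then show "M $$ (i, j) = (c \<cdot>\<^sub>m 1\<^sub>m n) $$ (i, j)"
        using arg_cong[OF 1, of "\<lambda>A. A $$ (i, j)"] M by (simp add: N_def)
    qed (use M in auto)
    then show ?thesis ..
  next
    case 2
    have "N *\<^sub>v v = M *\<^sub>v v - c \<cdot>\<^sub>m 1\<^sub>m n *\<^sub>v v"
      unfolding N_def using M v by (intro minus_mult_distrib_mat_vec) auto
    also have "\<dots> = 0\<^sub>v n"
      unfolding v(3) using v(1) by (intro eq_vecI) auto
    finally have Nv: "N *\<^sub>v v = 0\<^sub>v n" .
    have "v = N' *\<^sub>v (N *\<^sub>v v)"
      using 2 N v(1) by (metis assoc_mult_mat_vec one_mult_mat_vec)
    also have "\<dots> = 0\<^sub>v n"
      unfolding Nv using 2 by (auto intro!: eq_vecI)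
    finally show ?thesis
      using v(2) by blast
  qed
qed

section \<open>Orthogonality of characters\<close>

lemma trace_eq_if_intertwined:
  assumes "irreducible_rep G n \<rho>" "irreducible_rep G m \<tau>" "M \<in> carrier_mat m n" "M \<noteq> 0\<^sub>m m n"
    "\<And>g. g \<in> carrier G \<Longrightarrow> \<tau> g * M = M * \<rho> g" and g: "g \<in> carrier G"
  shows "mat_trace (\<tau> g) = mat_trace (\<rho> g)"
proof -
  have R: "\<rho> g \<in> carrier_mat n n" and T: "\<tau> g \<in> carrier_mat m m"
    using assms mat_repD(1)[OF _ g] by (auto simp: irreducible_rep_iff)
  obtain N where N: "N \<in> carrier_mat n m" "M * N = 1\<^sub>m m" "N * M = 1\<^sub>m n"
    using schur_zero_or_invertible[OF assms(1-3,5)] assms(4) by blast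
  have "\<tau> g = \<tau> g * (M * N)"
    using N T by simp
  also have "\<dots> = M * \<rho> g * N"
    unfolding assms(5)[OF g, symmetric] by (rule assoc_mult_mat[symmetric]) (use T N assms(3) in auto)
  finally have "mat_trace (\<tau> g) = mat_trace (N * (M * \<rho> g))"
    using mat_trace_mult_commute[of "M * \<rho> g" m n N] N assms(3) R by simp
  also have "N * (M * \<rho> g) = \<rho> g"
    by (subst assoc_mult_mat[symmetric, of N n m M n]) (use N R assms(3) in auto)
  finally show ?thesis .
qed

text \<open>Averaging over the group turns an arbitrary matrix into one that intertwines \<open>\<rho>\<close> and \<open>\<tau>\<close>
  (\<open>intertwiner_comm\<close>); the factor \<open>1/|G|\<close> is omitted.\<close>

definition intertwiner :: "nat \<Rightarrow> nat \<Rightarrow> ('a \<Rightarrow> complex mat) \<Rightarrow> ('a \<Rightarrow> complex mat) \<Rightarrow> complex mat \<Rightarrow> complex mat" where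
  "intertwiner m n \<tau> \<rho> A = mat_sum m n (\<lambda>g. \<tau> g * A * \<rho> (inv g)) (carrier G)"

lemma bij_betw_mult_left: "h \<in> carrier G \<Longrightarrow> bij_betw (\<lambda>g. h \<otimes> g) (carrier G) (carrier G)"
  by (rule bij_betw_byWitness[where f' = "\<lambda>g. inv h \<otimes> g"]) (auto simp: m_assoc[symmetric])

lemma bij_betw_mult_right: "h \<in> carrier G \<Longrightarrow> bij_betw (\<lambda>g. g \<otimes> h) (carrier G) (carrier G)"
  by (rule bij_betw_byWitness[where f' = "\<lambda>g. g \<otimes> inv h"]) (auto simp: m_assoc)

lemma intertwiner_carrier [simp]: "intertwiner m n \<tau> \<rho> A \<in> carrier_mat m n"
  by (simp add: intertwiner_def)

lemma intertwiner_comm: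
  assumes \<rho>: "mat_rep n \<rho>" and \<tau>: "mat_rep m \<tau>" and A: "A \<in> carrier_mat m n" and h: "h \<in> carrier G"
  shows "\<tau> h * intertwiner m n \<tau> \<rho> A = intertwiner m n \<tau> \<rho> A * \<rho> h"
proof -
  note R = mat_repD[OF \<rho>] and T = mat_repD[OF \<tau>]
  have carr: "\<tau> g * A * \<rho> (inv g) \<in> carrier_mat m n" if "g \<in> carrier G" for g
    using R(1)[of "inv g"] T(1)[of g] A that by auto
  have eq: "\<tau> h * (\<tau> g * A * \<rho> (inv g)) = \<tau> (h \<otimes> g) * A * \<rho> (inv (h \<otimes> g)) * \<rho> h" if g: "g \<in> carrier G" for g
  proof -
    have inv: "\<rho> (inv (h \<otimes> g)) * \<rho> h = \<rho> (inv g)"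
      using R(3)[of "inv (h \<otimes> g)" h] g h by (simp add: inv_mult_group m_assoc)
    have c: "\<tau> h \<in> carrier_mat m m" "\<tau> g \<in> carrier_mat m m" "\<rho> (inv g) \<in> carrier_mat n n" "\<rho> h \<in> carrier_mat n n"
      "\<rho> (inv (h \<otimes> g)) \<in> carrier_mat n n"
      using g h R(1) T(1) by auto
    have "\<tau> (h \<otimes> g) * A = \<tau> h * (\<tau> g * A)"
      unfolding T(3)[OF h g] using c A by (intro assoc_mult_mat) auto
    then have "\<tau> h * (\<tau> g * A * \<rho> (inv g)) = \<tau> (h \<otimes> g) * A * \<rho> (inv g)"
      using assoc_mult_mat[of "\<tau> h" m m "\<tau> g * A" n "\<rho> (inv g)" n] c A by simp
    also have "\<dots> = \<tau> (h \<otimes> g) * A * \<rho> (inv (h \<otimes> g)) * \<rho> h"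
      unfolding inv[symmetric] using c A T(3)[OF h g] by (intro assoc_mult_mat[symmetric]) auto
    finally show ?thesis .
  qed
  have "\<tau> h * intertwiner m n \<tau> \<rho> A = mat_sum m n (\<lambda>g. \<tau> h * (\<tau> g * A * \<rho> (inv g))) (carrier G)"
    unfolding intertwiner_def using T(1)[OF h] carr by (rule mult_mat_sum)
  also have "\<dots> = mat_sum m n (\<lambda>g. \<tau> (h \<otimes> g) * A * \<rho> (inv (h \<otimes> g)) * \<rho> h) (carrier G)"
    using eq by (rule mat_sum_cong)
  also have "\<dots> = mat_sum m n (\<lambda>g. \<tau> g * A * \<rho> (inv g) * \<rho> h) (carrier G)"
    using mat_sum_reindex[OF bij_betw_mult_left[OF h]] .
  also have "\<dots> = intertwiner m n \<tau> \<rho> A * \<rho> h"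
    unfolding intertwiner_def using R(1)[OF h] carr by (rule mat_sum_mult[symmetric])
  finally show ?thesis .
qed

definition mat_unit :: "nat \<Rightarrow> nat \<Rightarrow> nat \<Rightarrow> nat \<Rightarrow> complex mat" where
  "mat_unit m n i k = mat m n (\<lambda>(a, b). if a = i \<and> b = k then 1 else 0)"

lemma mat_unit_carrier [simp]: "mat_unit m n i k \<in> carrier_mat m n"
  by (simp add: mat_unit_def)

lemma mult_mat_unit_mult_index:
  assumes A: "A \<in> carrier_mat m m" and B: "B \<in> carrier_mat n n" and ik: "i < m" "k < n"
  shows "(A * mat_unit m n i k * B) $$ (i, k) = A $$ (i, i) * B $$ (k, k)"
proof -
  have AE: "(A * mat_unit m n i k) $$ (i, l) = (if l = k then A $$ (i, i) else 0)" if "l < n" for l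
  proof -
    have "(A * mat_unit m n i k) $$ (i, l) = (\<Sum>p<m. A $$ (i, p) * mat_unit m n i k $$ (p, l))"
      using ik that by (rule_tac mult_mat_index[OF A mat_unit_carrier])
    also have "\<dots> = (\<Sum>p<m. if p = i then (if l = k then A $$ (i, i) else 0) else 0)"
      using that by (intro sum.cong) (auto simp: mat_unit_def)
    finally show ?thesis
      using ik by simp
  qed
  have "(A * mat_unit m n i k * B) $$ (i, k) = (\<Sum>l<n. (A * mat_unit m n i k) $$ (i, l) * B $$ (l, k))"
    using A B ik by (intro mult_mat_index[of _ m n _ n]) auto
  also have "\<dots> = (\<Sum>l<n. if l = k then A $$ (i, i) * B $$ (k, k) else 0)"
    using AE by (intro sum.cong) auto
  finally show ?thesis
    using ik by simp
qed

text \<open>The two traces are sums over diagonal entries, and for each pair of diagonal entries the sum over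
  the group is one entry of an averaged intertwining matrix, to which Schur's lemma applies.\<close>

lemma trace_sum_eq_intertwiner:
  assumes \<rho>: "mat_rep n \<rho>" and \<tau>: "mat_rep m \<tau>"
  shows "(\<Sum>g\<in>carrier G. mat_trace (\<tau> g) * mat_trace (\<rho> (inv g))) =
    (\<Sum>i<m. \<Sum>k<n. intertwiner m n \<tau> \<rho> (mat_unit m n i k) $$ (i, k))"
proof -
  note R = mat_repD[OF \<rho>] and T = mat_repD[OF \<tau>]
  have "(\<Sum>g\<in>carrier G. mat_trace (\<tau> g) * mat_trace (\<rho> (inv g))) =
      (\<Sum>g\<in>carrier G. \<Sum>i<m. \<Sum>k<n. \<tau> g $$ (i, i) * \<rho> (inv g) $$ (k, k))"
    by (intro sum.cong refl) (simp add: mat_trace_carrier[OF R(1)] mat_trace_carrier[OF T(1)] sum_product)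
  also have "\<dots> = (\<Sum>i<m. \<Sum>g\<in>carrier G. \<Sum>k<n. \<tau> g $$ (i, i) * \<rho> (inv g) $$ (k, k))"
    by (rule sum.swap)
  also have "\<dots> = (\<Sum>i<m. \<Sum>k<n. \<Sum>g\<in>carrier G. \<tau> g $$ (i, i) * \<rho> (inv g) $$ (k, k))"
    by (intro sum.cong refl sum.swap)
  also have "\<dots> = (\<Sum>i<m. \<Sum>k<n. intertwiner m n \<tau> \<rho> (mat_unit m n i k) $$ (i, k))"
    by (intro sum.cong refl) (simp add: intertwiner_def mat_sum_index mult_mat_unit_mult_index[OF T(1) R(1)] cong: sum.cong)
  finally show ?thesis .
qed

lemma trace_orthogonal_diff:
  assumes \<rho>: "irreducible_rep G n \<rho>" and \<tau>: "irreducible_rep G m \<tau>"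
    and diff: "\<exists>g\<in>carrier G. mat_trace (\<tau> g) \<noteq> mat_trace (\<rho> g)"
  shows "(\<Sum>g\<in>carrier G. mat_trace (\<tau> g) * mat_trace (\<rho> (inv g))) = 0"
proof -
  have rep: "mat_rep n \<rho>" "mat_rep m \<tau>"
    using \<rho> \<tau> by (auto simp: irreducible_rep_iff)
  have "intertwiner m n \<tau> \<rho> A = 0\<^sub>m m n" if "A \<in> carrier_mat m n" for A
  proof (rule ccontr)
    assume "intertwiner m n \<tau> \<rho> A \<noteq> 0\<^sub>m m n"
    from trace_eq_if_intertwined[OF \<rho> \<tau> intertwiner_carrier this intertwiner_comm[OF rep that]] diff
    show False
      by blast
  qed
  then show ?thesis
    unfolding trace_sum_eq_intertwiner[OF rep] by simp
qed

text \<open>By Schur's lemma the averaged matrix units are scalar, and their traces give the scalars: the sum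
  over the group multiplies the trace by \<open>|G|\<close>.\<close>

lemma trace_orthogonal_same:
  assumes \<rho>: "irreducible_rep G n \<rho>"
  shows "(\<Sum>g\<in>carrier G. mat_trace (\<rho> g) * mat_trace (\<rho> (inv g))) = of_nat (card (carrier G))"
proof -
  have rep: "mat_rep n \<rho>" and n: "0 < n"
    using \<rho> by (auto simp: irreducible_rep_iff)
  note R = mat_repD[OF rep]
  have "intertwiner n n \<rho> \<rho> (mat_unit n n i k) $$ (i, k) =
      (if i = k then of_nat (card (carrier G)) / of_nat n else 0)" if ik: "i < n" "k < n" for i k
  proof -
    let ?I = "intertwiner n n \<rho> \<rho> (mat_unit n n i k)"
    obtain c where c: "?I = c \<cdot>\<^sub>m 1\<^sub>m n"
      using schur_scalar[OF \<rho> intertwiner_carrier[of n n \<rho> \<rho> "mat_unit n n i k"]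
          intertwiner_comm[OF rep rep mat_unit_carrier]] by blast
    have E: "mat_unit n n i k \<in> carrier_mat n n"
      by simp
    have "mat_trace ?I = (\<Sum>g\<in>carrier G. mat_trace (\<rho> g * mat_unit n n i k * \<rho> (inv g)))"
      unfolding intertwiner_def using R(1) E by (intro mat_trace_mat_sum mult_carrier_mat[of _ n n] mat_unit_carrier R(1) inv_closed)
    also have "\<dots> = (\<Sum>g\<in>carrier G. mat_trace (mat_unit n n i k))"
    proof (intro sum.cong refl)
      fix g assume g: "g \<in> carrier G"
      note c = R(1)[OF g] R(1)[OF inv_closed[OF g]]
      have "mat_trace (\<rho> g * mat_unit n n i k * \<rho> (inv g)) = mat_trace (\<rho> g * (mat_unit n n i k * \<rho> (inv g)))"
        using assoc_mult_mat[OF c(1) E c(2)] by simp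
      also have "\<dots> = mat_trace (mat_unit n n i k * \<rho> (inv g) * \<rho> g)"
        using c(1) mult_carrier_mat[OF E c(2)] by (rule mat_trace_mult_commute)
      also have "mat_unit n n i k * \<rho> (inv g) * \<rho> g = mat_unit n n i k"
        using assoc_mult_mat[OF E c(2,1)] R(5)[OF g] right_mult_one_mat[OF E] by simp
      finally show "mat_trace (\<rho> g * mat_unit n n i k * \<rho> (inv g)) = mat_trace (mat_unit n n i k)" .
    qed
    also have "mat_trace (mat_unit n n i k) = (\<Sum>a<n. if a = i then (if i = k then 1 else 0) else 0)"
      unfolding mat_trace_carrier[OF E] by (intro sum.cong) (auto simp: mat_unit_def)
    finally have "c * of_nat n = (if i = k then of_nat (card (carrier G)) else 0)"
      using ik mat_trace_smult[OF one_carrier_mat, of c n] unfolding c by (simp split: if_splits)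
    then have "c = (if i = k then of_nat (card (carrier G)) / of_nat n else 0)"
      using n by (auto simp: field_simps)
    then show ?thesis
      using c ik n by auto
  qed
  then have "(\<Sum>i<n. \<Sum>k<n. intertwiner n n \<rho> \<rho> (mat_unit n n i k) $$ (i, k)) =
      (\<Sum>i<n. \<Sum>k<n. if i = k then of_nat (card (carrier G)) / of_nat n else 0)"
    by (intro sum.cong refl) simp
  then show ?thesis
    unfolding trace_sum_eq_intertwiner[OF rep rep] using n by simp
qed

definition conj_transpose :: "complex mat \<Rightarrow> complex mat" where
  "conj_transpose A = mat (dim_col A) (dim_row A) (\<lambda>(i, j). cnj (A $$ (j, i)))"

lemma conj_transpose_carrier [simp]: "A \<in> carrier_mat n m \<Longrightarrow> conj_transpose A \<in> carrier_mat m n"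
  by (auto simp: conj_transpose_def)

lemma conj_transpose_mult:
  assumes A: "A \<in> carrier_mat n k" and B: "B \<in> carrier_mat k m"
  shows "conj_transpose (A * B) = conj_transpose B * conj_transpose A"
proof (rule eq_matI)
  fix i j assume "i < dim_row (conj_transpose B * conj_transpose A)" "j < dim_col (conj_transpose B * conj_transpose A)"
  then have ij: "i < m" "j < n"
    using A B by (auto simp: conj_transpose_def)
  have "conj_transpose (A * B) $$ (i, j) = cnj ((A * B) $$ (j, i))"
    using ij A B unfolding conj_transpose_def by (subst index_mat) auto
  also have "\<dots> = (\<Sum>l<k. conj_transpose B $$ (i, l) * conj_transpose A $$ (l, j))"
    using ij A B by (simp add: mult_mat_index[OF A B] conj_transpose_def mult.commute del: index_mult_mat)
  also have "\<dots> = (conj_transpose B * conj_transpose A) $$ (i, j)"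
    using ij by (simp add: mult_mat_index[OF conj_transpose_carrier[OF B] conj_transpose_carrier[OF A]] del: index_mult_mat)
  finally show "conj_transpose (A * B) $$ (i, j) = (conj_transpose B * conj_transpose A) $$ (i, j)" .
qed (use A B in \<open>auto simp: conj_transpose_def\<close>)

lemma mat_trace_conj_transpose: "A \<in> carrier_mat n n \<Longrightarrow> mat_trace (conj_transpose A) = cnj (mat_trace A)"
  by (auto simp: mat_trace_def conj_transpose_def)

text \<open>The averaged form \<open>P = (\<Sum>g. \<rho>(g)\<^sup>* \<rho>(g))\<close> is invariant, that is \<open>P \<rho>(h) = \<rho>(inv h)\<^sup>* P\<close>, and
  positive definite, hence invertible; so \<open>\<rho>(h)\<close> is similar to \<open>\<rho>(inv h)\<^sup>*\<close>.\<close>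

lemma trace_inv:
  assumes \<rho>: "mat_rep n \<rho>" and h: "h \<in> carrier G"
  shows "mat_trace (\<rho> (inv h)) = cnj (mat_trace (\<rho> h))"
proof -
  note R = mat_repD[OF \<rho>]
  define P where "P = mat_sum n n (\<lambda>g. conj_transpose (\<rho> g) * \<rho> g) (carrier G)"
  have P: "P \<in> carrier_mat n n"
    by (simp add: P_def)
  have carr: "conj_transpose (\<rho> g) * \<rho> g \<in> carrier_mat n n" if "g \<in> carrier G" for g
    using R(1)[OF that] by (meson conj_transpose_carrier mult_carrier_mat)
  have "inj_mat P"
    unfolding inj_mat_def
  proof (intro ballI impI)
    fix v assume "v \<in> carrier_vec (dim_col P)" and "P *\<^sub>v v = 0\<^sub>v (dim_row P)"
    then have v: "v \<in> carrier_vec n" and Pv: "P *\<^sub>v v = 0\<^sub>v n"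
      using P by auto
    \<comment> \<open>the squared norms of the vectors \<open>\<rho>(g) v\<close> add up to \<open>v\<^sup>* P v = 0\<close>\<close>
    define q where "q g = (\<Sum>l<n. (cmod ((\<rho> g *\<^sub>v v) $ l))\<^sup>2)" for g
    have q: "complex_of_real (q g) = (\<Sum>i<n. \<Sum>j<n. cnj (v $ i) * (conj_transpose (\<rho> g) * \<rho> g) $$ (i, j) * v $ j)"
      if g: "g \<in> carrier G" for g
    proof -
      have "complex_of_real (q g) = (\<Sum>l<n. cnj ((\<rho> g *\<^sub>v v) $ l) * (\<rho> g *\<^sub>v v) $ l)"
        unfolding q_def of_real_sum by (intro sum.cong refl) (simp only: complex_norm_square mult.commute)
      also have "\<dots> = (\<Sum>l<n. \<Sum>i<n. \<Sum>j<n. cnj (v $ i) * (cnj (\<rho> g $$ (l, i)) * \<rho> g $$ (l, j)) * v $ j)"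
        
      proof (intro sum.cong refl)
        fix l assume l: "l \<in> {..<n}"
        have "(\<rho> g *\<^sub>v v) $ l = (\<Sum>j<n. \<rho> g $$ (l, j) * v $ j)"
          using l by (intro mult_mat_vec_index[OF R(1)[OF g] v]) simp
        then show "cnj ((\<rho> g *\<^sub>v v) $ l) * (\<rho> g *\<^sub>v v) $ l =
            (\<Sum>i<n. \<Sum>j<n. cnj (v $ i) * (cnj (\<rho> g $$ (l, i)) * \<rho> g $$ (l, j)) * v $ j)"
          by (simp only: cnj_sum sum_product) (intro sum.cong refl, simp)
      qed
      also have "\<dots> = (\<Sum>i<n. \<Sum>l<n. \<Sum>j<n. cnj (v $ i) * (cnj (\<rho> g $$ (l, i)) * \<rho> g $$ (l, j)) * v $ j)"
        by (rule sum.swap)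
      also have "\<dots> = (\<Sum>i<n. \<Sum>j<n. \<Sum>l<n. cnj (v $ i) * (cnj (\<rho> g $$ (l, i)) * \<rho> g $$ (l, j)) * v $ j)"
        by (intro sum.cong refl sum.swap)
      also have "\<dots> = (\<Sum>i<n. \<Sum>j<n. cnj (v $ i) * (conj_transpose (\<rho> g) * \<rho> g) $$ (i, j) * v $ j)"
      proof (intro sum.cong refl)
        fix i j assume ij: "i \<in> {..<n}" "j \<in> {..<n}"
        have "(conj_transpose (\<rho> g) * \<rho> g) $$ (i, j) = (\<Sum>l<n. cnj (\<rho> g $$ (l, i)) * \<rho> g $$ (l, j))"
          using ij R(1)[OF g] mult_mat_index[OF conj_transpose_carrier[OF R(1)[OF g]] R(1)[OF g], of i j]
          by (simp add: conj_transpose_def del: index_mult_mat)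
        then show "(\<Sum>l<n. cnj (v $ i) * (cnj (\<rho> g $$ (l, i)) * \<rho> g $$ (l, j)) * v $ j) =
            cnj (v $ i) * (conj_transpose (\<rho> g) * \<rho> g) $$ (i, j) * v $ j"
          by (simp only: sum_distrib_left sum_distrib_right)
      qed
      finally show ?thesis .
    qed
    have "complex_of_real (\<Sum>g\<in>carrier G. q g) =
        (\<Sum>g\<in>carrier G. \<Sum>i<n. \<Sum>j<n. cnj (v $ i) * (conj_transpose (\<rho> g) * \<rho> g) $$ (i, j) * v $ j)"
      unfolding of_real_sum by (intro sum.cong refl q)
    also have "\<dots> = (\<Sum>i<n. \<Sum>g\<in>carrier G. \<Sum>j<n. cnj (v $ i) * (conj_transpose (\<rho> g) * \<rho> g) $$ (i, j) * v $ j)"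
      by (rule sum.swap)
    also have "\<dots> = (\<Sum>i<n. \<Sum>j<n. \<Sum>g\<in>carrier G. cnj (v $ i) * (conj_transpose (\<rho> g) * \<rho> g) $$ (i, j) * v $ j)"
      by (intro sum.cong refl sum.swap)
    also have "\<dots> = (\<Sum>i<n. \<Sum>j<n. cnj (v $ i) * (P $$ (i, j) * v $ j))"
      by (intro sum.cong refl)
        (simp add: P_def mat_sum_index sum_distrib_left sum_distrib_right mult.assoc del: index_mult_mat)
    also have "\<dots> = (\<Sum>i<n. cnj (v $ i) * (P *\<^sub>v v) $ i)"
      by (intro sum.cong refl)
        (simp add: mult_mat_vec_index[OF P v] sum_distrib_left del: index_mult_mat_vec)
    also have "\<dots> = 0"
      unfolding Pv by simp
    finally have "(\<Sum>g\<in>carrier G. q g) = 0"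
      by (simp only: of_real_eq_0_iff)
    then have "q \<one> = 0"
      by (subst (asm) sum_nonneg_eq_0_iff) (auto simp: q_def sum_nonneg)
    then have "\<forall>l<n. v $ l = 0"
      unfolding q_def using R(2) v by (subst (asm) sum_nonneg_eq_0_iff) auto
    then show "v = 0\<^sub>v (dim_col P)"
      using v P by (intro eq_vecI) auto
  qed
  then obtain Q where Q: "Q \<in> carrier_mat n n" "P * Q = 1\<^sub>m n" "Q * P = 1\<^sub>m n"
    using bij_mat_inverse[OF P _ inj_mat_surj[OF P]] by blast
  let ?D = "conj_transpose (\<rho> (inv h))"
  have h': "inv h \<in> carrier G" and Rh: "\<rho> h \<in> carrier_mat n n" and D: "?D \<in> carrier_mat n n"
    using h R(1) by auto
  have eq: "?D * (conj_transpose (\<rho> g) * \<rho> g) = conj_transpose (\<rho> (g \<otimes> inv h)) * \<rho> (g \<otimes> inv h) * \<rho> h"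
    if g: "g \<in> carrier G" for g
  proof -
    note c = R(1)[OF g] conj_transpose_carrier[OF R(1)[OF g]]
    have "\<rho> (g \<otimes> inv h) * \<rho> h = \<rho> g"
      using R(3)[of "g \<otimes> inv h" h] g h by (simp add: m_assoc)
    moreover have "conj_transpose (\<rho> (g \<otimes> inv h)) = ?D * conj_transpose (\<rho> g)"
      unfolding R(3)[OF g h'] using R(1)[OF g] R(1)[OF h'] by (rule conj_transpose_mult)
    ultimately have "?D * (conj_transpose (\<rho> g) * \<rho> g) = conj_transpose (\<rho> (g \<otimes> inv h)) * (\<rho> (g \<otimes> inv h) * \<rho> h)"
      using assoc_mult_mat[OF D c(2) c(1)] by simp
    then show ?thesis
      using assoc_mult_mat[of "conj_transpose (\<rho> (g \<otimes> inv h))" n n "\<rho> (g \<otimes> inv h)" n "\<rho> h" n]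
        Rh R(1)[of "g \<otimes> inv h"] g h' by (metis m_closed conj_transpose_carrier)
  qed
  have "?D * P = mat_sum n n (\<lambda>g. ?D * (conj_transpose (\<rho> g) * \<rho> g)) (carrier G)"
    unfolding P_def using D carr by (rule mult_mat_sum)
  also have "\<dots> = mat_sum n n (\<lambda>g. conj_transpose (\<rho> (g \<otimes> inv h)) * \<rho> (g \<otimes> inv h) * \<rho> h) (carrier G)"
    using eq by (rule mat_sum_cong)
  also have "\<dots> = mat_sum n n (\<lambda>g. conj_transpose (\<rho> g) * \<rho> g * \<rho> h) (carrier G)"
    using mat_sum_reindex[OF bij_betw_mult_right[OF h']] .
  also have "\<dots> = P * \<rho> h"
    unfolding P_def using Rh carr by (rule mat_sum_mult[symmetric])
  finally have DP: "?D * P = P * \<rho> h" .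
  have "mat_trace (\<rho> h) = mat_trace (Q * (P * \<rho> h))"
    using Q P Rh assoc_mult_mat[of Q n n P n "\<rho> h" n] by simp
  also have "\<dots> = mat_trace (?D * P * Q)"
    unfolding DP[symmetric] using Q P D by (intro mat_trace_mult_commute[of _ n n]) auto
  also have "?D * P * Q = ?D"
    using Q P D assoc_mult_mat[of ?D n n P n Q n] by simp
  also have "mat_trace ?D = cnj (mat_trace (\<rho> (inv h)))"
    using R(1)[OF h'] by (rule mat_trace_conj_transpose)
  finally show ?thesis
    by simp
qed

section \<open>Irreducible characters\<close>

lemma IrrE:
  assumes "\<chi> \<in> Irr G"
  obtains n \<rho> where "irreducible_rep G n \<rho>" "\<And>g. g \<in> carrier G \<Longrightarrow> \<chi> g = mat_trace (\<rho> g)"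
    "\<chi> = (\<lambda>g\<in>carrier G. mat_trace (\<rho> g))"
  using assms by (auto simp: Irr_def)

lemma Irr_eqI:
  assumes "\<chi> \<in> Irr G" "\<psi> \<in> Irr G" "\<And>g. g \<in> carrier G \<Longrightarrow> \<chi> g = \<psi> g"
  shows "\<chi> = \<psi>"
  using assms by (auto simp: Irr_def intro!: ext)

lemma Irr_degree:
  assumes "\<chi> \<in> Irr G"
  shows "\<chi> \<one> \<noteq> 0"
  using assms by (elim IrrE) (auto simp: irreducible_rep_iff mat_rep_def)

lemma Irr_inv: "\<chi> \<in> Irr G \<Longrightarrow> g \<in> carrier G \<Longrightarrow> \<chi> (inv g) = cnj (\<chi> g)"
  by (elim IrrE) (auto simp: irreducible_rep_iff trace_inv)

lemma Irr_orthogonal: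
  assumes \<chi>: "\<chi> \<in> Irr G" and \<psi>: "\<psi> \<in> Irr G"
  shows "(\<Sum>g\<in>carrier G. \<chi> g * cnj (\<psi> g)) = (if \<chi> = \<psi> then of_nat (card (carrier G)) else 0)"
proof -
  have eq: "(\<Sum>g\<in>carrier G. \<chi> g * cnj (\<psi> g)) = (\<Sum>g\<in>carrier G. \<chi> g * \<psi> (inv g))"
    using \<psi> by (intro sum.cong refl) (simp add: Irr_inv)
  obtain n \<rho> where \<rho>: "irreducible_rep G n \<rho>" "\<And>g. g \<in> carrier G \<Longrightarrow> \<psi> g = mat_trace (\<rho> g)"
    using \<psi> by (elim IrrE) blast
  obtain m \<tau> where \<tau>: "irreducible_rep G m \<tau>" "\<And>g. g \<in> carrier G \<Longrightarrow> \<chi> g = mat_trace (\<tau> g)"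
    using \<chi> by (elim IrrE) blast
  show ?thesis
  proof (cases "\<chi> = \<psi>")
    case True
    then show ?thesis
      unfolding eq using trace_orthogonal_same[OF \<rho>(1)] \<rho>(2) by (simp cong: sum.cong)
  next
    case False
    then have "\<exists>g\<in>carrier G. mat_trace (\<tau> g) \<noteq> mat_trace (\<rho> g)"
      using Irr_eqI[OF \<chi> \<psi>] \<rho>(2) \<tau>(2) by force
    then show ?thesis
      unfolding eq using trace_orthogonal_diff[OF \<rho>(1) \<tau>(1)] \<rho>(2) \<tau>(2) False by (simp cong: sum.cong)
  qed
qed

lemma Irr_independent:
  assumes F: "F \<subseteq> Irr G" "finite F" and zero: "\<forall>g\<in>carrier G. (\<Sum>\<chi>\<in>F. c \<chi> * \<chi> g) = 0"
  shows "\<forall>\<chi>\<in>F. c \<chi> = 0"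
proof
  fix \<psi> assume \<psi>: "\<psi> \<in> F"
  have "0 = (\<Sum>g\<in>carrier G. (\<Sum>\<chi>\<in>F. c \<chi> * \<chi> g) * cnj (\<psi> g))"
    using zero by simp
  also have "\<dots> = (\<Sum>\<chi>\<in>F. c \<chi> * (\<Sum>g\<in>carrier G. \<chi> g * cnj (\<psi> g)))"
    unfolding sum_distrib_left sum_distrib_right by (subst sum.swap) (simp add: mult.assoc)
  also have "\<dots> = (\<Sum>\<chi>\<in>F. if \<chi> = \<psi> then c \<chi> * of_nat (card (carrier G)) else 0)"
    using F \<psi> by (intro sum.cong refl) (simp add: Irr_orthogonal subsetD)
  also have "\<dots> = c \<psi> * of_nat (card (carrier G))"
    using F \<psi> by simp
  finally show "c \<psi> = 0"
    using fin one_closed by auto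
qed

text \<open>Distinct irreducible characters are linearly independent functions on \<open>G\<close>, so there are at
  most \<open>|G|\<close> of them.\<close>

lemma finite_Irr [simp]: "finite (Irr G)"
proof (rule conjunct1[OF finite_if_finite_subsets_card_bdd])
  show "card F \<le> card (carrier G)" if "F \<subseteq> Irr G" "finite F" for F
    using independent_rows_card_le[of F "carrier G" "\<lambda>\<chi> g. \<chi> g"] Irr_independent[OF that] that by simp
qed

lemma trivial_char_Irr: "trivial_char G \<in> Irr G"
proof -
  have "mat_rep 1 (\<lambda>_. 1\<^sub>m 1)"
    by (simp add: mat_rep_def)
  moreover have "W = {0\<^sub>v 1} \<or> W = carrier_vec 1" if "invariant_subspace 1 (\<lambda>_. 1\<^sub>m 1) W" for W
  proof (cases "W \<subseteq> {0\<^sub>v 1}")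
    case True
    then show ?thesis
      using that by (auto simp: invariant_subspace_def subspace_vec_iff)
  next
    case False
    then obtain w where w: "w \<in> W" "w \<noteq> 0\<^sub>v 1"
      by blast
    have sub: "W \<subseteq> carrier_vec 1" "\<And>c v. v \<in> W \<Longrightarrow> c \<cdot>\<^sub>v v \<in> W"
      using that by (auto simp: invariant_subspace_def subspace_vec_iff)
    have nz: "w $ 0 \<noteq> 0"
    proof
      assume "w $ 0 = 0"
      then have "w = 0\<^sub>v 1"
        using sub(1) w(1) by (intro eq_vecI) auto
      with w show False by simp
    qed
    have "u \<in> W" if "u \<in> carrier_vec 1" for u
    proof -
      have "(u $ 0 / w $ 0) \<cdot>\<^sub>v w = u"
        using sub(1) w(1) nz that by (intro eq_vecI) auto
      then show ?thesis
        using sub(2)[OF w(1)] by metis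
    qed
    then show ?thesis
      using sub(1) by blast
  qed
  ultimately have "irreducible_rep G 1 (\<lambda>_. 1\<^sub>m 1)"
    by (auto simp: irreducible_rep_iff)
  then show ?thesis
    unfolding Irr_def trivial_char_def by (auto intro!: exI[of _ 1] exI[of _ "\<lambda>_. 1\<^sub>m 1"])
qed

definition class_function :: "('a \<Rightarrow> complex) \<Rightarrow> bool" where
  "class_function f \<longleftrightarrow> (\<forall>g\<in>carrier G. \<forall>h\<in>carrier G. f (g \<otimes> h \<otimes> inv g) = f h)"

lemma Irr_class_function: "\<chi> \<in> Irr G \<Longrightarrow> class_function \<chi>"
proof (elim IrrE)
  fix n \<rho> assume \<rho>: "irreducible_rep G n \<rho>" and \<chi>: "\<And>g. g \<in> carrier G \<Longrightarrow> \<chi> g = mat_trace (\<rho> g)"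
  then have "mat_rep n \<rho>"
    by (simp add: irreducible_rep_iff)
  note R = mat_repD[OF this]
  have "mat_trace (\<rho> (g \<otimes> h \<otimes> inv g)) = mat_trace (\<rho> h)" if gh: "g \<in> carrier G" "h \<in> carrier G" for g h
  proof -
    note c = R(1)[OF gh(1)] R(1)[OF gh(2)] R(1)[OF inv_closed[OF gh(1)]]
    have "mat_trace (\<rho> (g \<otimes> h \<otimes> inv g)) = mat_trace (\<rho> (g \<otimes> h) * \<rho> (inv g))"
      using R(3) gh by simp
    also have "\<dots> = mat_trace (\<rho> (inv g) * \<rho> (g \<otimes> h))"
      using R(1) gh by (intro mat_trace_mult_commute[of _ n n]) auto
    also have "\<rho> (inv g) * \<rho> (g \<otimes> h) = \<rho> h"
      using R(3)[of "inv g" "g \<otimes> h"] gh by (simp add: m_assoc[symmetric])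
    finally show ?thesis .
  qed
  then show "class_function \<chi>"
    using \<chi> by (simp add: class_function_def)
qed

section \<open>Completeness of the irreducible characters\<close>

text \<open>The group algebra element with coefficients \<open>f\<close>, acting in the representation \<open>\<rho>\<close>.\<close>

definition alg_act :: "nat \<Rightarrow> ('a \<Rightarrow> complex mat) \<Rightarrow> ('a \<Rightarrow> complex) \<Rightarrow> complex mat" where
  "alg_act n \<rho> f = mat_sum n n (\<lambda>g. f g \<cdot>\<^sub>m \<rho> g) (carrier G)"

lemma alg_act_carrier [simp]: "alg_act n \<rho> f \<in> carrier_mat n n"
  by (simp add: alg_act_def)

lemma bij_betw_conj: "h \<in> carrier G \<Longrightarrow> bij_betw (\<lambda>g. h \<otimes> g \<otimes> inv h) (carrier G) (carrier G)"
  using bij_betw_trans[OF bij_betw_mult_left bij_betw_mult_right, of h "inv h"] by (simp add: o_def)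

lemma mult_alg_act:
  assumes \<rho>: "mat_rep n \<rho>" and h: "h \<in> carrier G"
  shows "\<rho> h * alg_act n \<rho> f = mat_sum n n (\<lambda>g. f g \<cdot>\<^sub>m \<rho> (h \<otimes> g)) (carrier G)"
proof -
  note R = mat_repD[OF \<rho>]
  have "\<rho> h * alg_act n \<rho> f = mat_sum n n (\<lambda>g. \<rho> h * (f g \<cdot>\<^sub>m \<rho> g)) (carrier G)"
    unfolding alg_act_def using R(1) h by (intro mult_mat_sum) auto
  also have "\<dots> = mat_sum n n (\<lambda>g. f g \<cdot>\<^sub>m \<rho> (h \<otimes> g)) (carrier G)"
    using h by (intro mat_sum_cong) (simp add: R(3) mult_smult_distrib[OF R(1) R(1)])
  finally show ?thesis .
qed

lemma alg_act_comm:
  assumes \<rho>: "mat_rep n \<rho>" and f: "class_function f" and h: "h \<in> carrier G"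
  shows "\<rho> h * alg_act n \<rho> f = alg_act n \<rho> f * \<rho> h"
proof -
  note R = mat_repD[OF \<rho>]
  have "alg_act n \<rho> f * \<rho> h = mat_sum n n (\<lambda>g. (f g \<cdot>\<^sub>m \<rho> g) * \<rho> h) (carrier G)"
    unfolding alg_act_def using R(1) h by (intro mat_sum_mult) auto
  also have "\<dots> = mat_sum n n (\<lambda>g. f g \<cdot>\<^sub>m \<rho> (g \<otimes> h)) (carrier G)"
    using h by (intro mat_sum_cong) (simp add: R(3) mult_smult_assoc_mat[OF R(1) R(1)])
  also have "\<dots> = mat_sum n n (\<lambda>g. f (h \<otimes> g \<otimes> inv h) \<cdot>\<^sub>m \<rho> (h \<otimes> g \<otimes> inv h \<otimes> h)) (carrier G)"
    by (rule mat_sum_reindex[OF bij_betw_conj[OF h], symmetric])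
  also have "\<dots> = mat_sum n n (\<lambda>g. f g \<cdot>\<^sub>m \<rho> (h \<otimes> g)) (carrier G)"
    using f h by (intro mat_sum_cong) (simp add: class_function_def m_assoc)
  also have "\<dots> = \<rho> h * alg_act n \<rho> f"
    by (rule mult_alg_act[OF \<rho> h, symmetric])
  finally show ?thesis ..
qed

text \<open>By Schur's lemma \<open>f\<close> acts as a scalar, which is zero because its trace is.\<close>

lemma alg_act_irreducible_eq_0:
  assumes \<rho>: "irreducible_rep G n \<rho>" and f: "class_function f"
    and orth: "\<And>\<chi>. \<chi> \<in> Irr G \<Longrightarrow> (\<Sum>g\<in>carrier G. f g * \<chi> g) = 0"
  shows "alg_act n \<rho> f = 0\<^sub>m n n"
proof -
  have rep: "mat_rep n \<rho>" and n: "0 < n"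
    using \<rho> by (auto simp: irreducible_rep_iff)
  obtain c where c: "alg_act n \<rho> f = c \<cdot>\<^sub>m 1\<^sub>m n"
    using schur_scalar[OF \<rho> alg_act_carrier alg_act_comm[OF rep f]] by blast
  have "(\<lambda>g\<in>carrier G. mat_trace (\<rho> g)) \<in> Irr G"
    using \<rho> by (auto simp: Irr_def)
  then have "0 = (\<Sum>g\<in>carrier G. f g * mat_trace (\<rho> g))"
    using orth by fastforce
  also have "\<dots> = (\<Sum>g\<in>carrier G. mat_trace (f g \<cdot>\<^sub>m \<rho> g))"
    by (intro sum.cong refl) (simp add: mat_trace_smult[OF mat_repD(1)[OF rep]])
  also have "\<dots> = mat_trace (alg_act n \<rho> f)"
    unfolding alg_act_def using mat_repD(1)[OF rep] by (intro mat_trace_mat_sum[symmetric]) auto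
  also have "\<dots> = c * of_nat n"
    unfolding c by (simp add: mat_trace_smult[OF one_carrier_mat])
  finally show ?thesis
    using n c by (auto intro!: eq_matI)
qed

text \<open>On an eigenspace of \<open>alg_act N L f\<close>, which is invariant because \<open>f\<close> is a class function, choose a
  nonzero invariant subspace of minimal dimension, in the form of the range of an injective matrix \<open>B\<close>.
  It carries an irreducible representation, in which \<open>f\<close> acts both as the eigenvalue and as zero.\<close>

lemma alg_act_eigenvalue_eq_0:
  assumes L: "mat_rep N L" and f: "class_function f"
    and zero: "\<And>n \<rho>. irreducible_rep G n \<rho> \<Longrightarrow> alg_act n \<rho> f = 0\<^sub>m n n"
    and ev: "eigenvalue (alg_act N L f) c"
  shows "c = 0"
proof -
  note LD = mat_repD[OF L]
  define F where "F = alg_act N L f"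
  have F: "F \<in> carrier_mat N N"
    by (simp add: F_def)
  \<comment> \<open>the eigenspace contains an invariant subspace of dimension \<open>k\<close>\<close>
  define P where "P k \<longleftrightarrow> 0 < k \<and> (\<exists>B\<in>carrier_mat N k. inj_mat B \<and> F * B = c \<cdot>\<^sub>m B \<and>
    (\<forall>g\<in>carrier G. \<exists>R\<in>carrier_mat k k. L g * B = B * R))" for k
  have "\<exists>k. P k"
  proof -
    define D where "D = F - c \<cdot>\<^sub>m 1\<^sub>m N"
    have D: "D \<in> carrier_mat N N"
      using F by (auto simp: D_def)
    let ?W = "{v \<in> carrier_vec N. D *\<^sub>v v = 0\<^sub>v N}"
    have W: "v \<in> ?W \<longleftrightarrow> F *\<^sub>v v = c \<cdot>\<^sub>v v" if v: "v \<in> carrier_vec N" for v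
    proof -
      have "D *\<^sub>v v = F *\<^sub>v v - c \<cdot>\<^sub>m 1\<^sub>m N *\<^sub>v v"
        unfolding D_def using F v by (intro minus_mult_distrib_mat_vec) auto
      also have "c \<cdot>\<^sub>m 1\<^sub>m N *\<^sub>v v = c \<cdot>\<^sub>v v"
        using v by (intro eq_vecI) auto
      finally have "D *\<^sub>v v = F *\<^sub>v v - c \<cdot>\<^sub>v v" .
      then show ?thesis
        using F v by (auto simp: vec_eq_iff simp del: index_mult_mat_vec)
    qed
    obtain k B where B: "B \<in> carrier_mat N k" "inj_mat B" "?W = (\<lambda>v. B *\<^sub>v v) ` carrier_vec k"
      by (rule subspace_eq_range[OF subspace_kernel[OF D]])
    have "k \<noteq> 0"
    proof
      assume k: "k = 0"
      obtain v where v: "v \<in> carrier_vec N" "v \<noteq> 0\<^sub>v N" "F *\<^sub>v v = c \<cdot>\<^sub>v v"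
        using ev F unfolding eigenvalue_def eigenvector_def F_def[symmetric] by auto
      then obtain u where u: "u \<in> carrier_vec 0" "v = B *\<^sub>v u"
        using W B(3) k by blast
      then have "v = 0\<^sub>v N"
        using B(1) k by (intro eq_vecI) (auto simp: scalar_prod_def)
      with v show False by simp
    qed
    have colW: "col B j \<in> ?W" if "j < k" for j
    proof -
      have "col B j = B *\<^sub>v unit_vec k j"
        using that B(1) by (intro eq_vecI) (auto simp: scalar_prod_right_unit)
      then show ?thesis
        unfolding B(3) by auto
    qed
    have "F * B = c \<cdot>\<^sub>m B"
    proof (rule mat_col_eqI)
      fix j assume "j < dim_col (c \<cdot>\<^sub>m B)"
      then have j: "j < k"
        using B by simp
      have "col (F * B) j = F *\<^sub>v col B j"
        using col_mult2[OF F B(1) j] .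
      also have "\<dots> = c \<cdot>\<^sub>v col B j"
        using colW[OF j] W[of "col B j"] B(1) by simp
      also have "\<dots> = col (c \<cdot>\<^sub>m B) j"
        using B(1) j by (intro eq_vecI) auto
      finally show "col (F * B) j = col (c \<cdot>\<^sub>m B) j" .
    qed (use F B in auto)
    moreover have "\<exists>R\<in>carrier_mat k k. L g * B = B * R" if g: "g \<in> carrier G" for g
    proof (rule factor_through_range[OF B(1)])
      show "L g * B \<in> carrier_mat N k"
        using LD(1)[OF g] B(1) by simp
      fix j assume j: "j < k"
      have Lc: "L g *\<^sub>v col B j \<in> carrier_vec N" and cB: "col B j \<in> carrier_vec N"
        using LD(1)[OF g] B(1) by auto
      have "F *\<^sub>v (L g *\<^sub>v col B j) = F * L g *\<^sub>v col B j"
        using assoc_mult_mat_vec[OF F LD(1)[OF g] cB] ..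
      also have "\<dots> = L g * F *\<^sub>v col B j"
        unfolding F_def alg_act_comm[OF L f g] ..
      also have "\<dots> = L g *\<^sub>v (F *\<^sub>v col B j)"
        by (rule assoc_mult_mat_vec[OF LD(1)[OF g] F cB])
      also have "F *\<^sub>v col B j = c \<cdot>\<^sub>v col B j"
        using colW[OF j] W[OF cB] by simp
      also have "L g *\<^sub>v (c \<cdot>\<^sub>v col B j) = c \<cdot>\<^sub>v (L g *\<^sub>v col B j)"
        by (rule mult_mat_vec[OF LD(1)[OF g] cB])
      finally have "L g *\<^sub>v col B j \<in> ?W"
        using W[OF Lc] by simp
      then show "col (L g * B) j \<in> (\<lambda>v. B *\<^sub>v v) ` carrier_vec k"
        unfolding col_mult2[OF LD(1)[OF g] B(1) j] B(3) .
    qed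
    ultimately show ?thesis
      using \<open>k \<noteq> 0\<close> B unfolding P_def by blast
  qed
  define k where "k = (LEAST k. P k)"
  have Pk: "P k" and min: "\<And>j. P j \<Longrightarrow> k \<le> j"
    unfolding k_def using \<open>\<exists>k. P k\<close> by (auto intro: LeastI_ex Least_le)
  obtain B where k: "0 < k" and B: "B \<in> carrier_mat N k" and inj: "inj_mat B" and FB: "F * B = c \<cdot>\<^sub>m B"
    and LB: "\<forall>g\<in>carrier G. \<exists>R\<in>carrier_mat k k. L g * B = B * R"
    using Pk unfolding P_def by blast
  obtain \<rho> where \<rho>: "\<And>g. g \<in> carrier G \<Longrightarrow> \<rho> g \<in> carrier_mat k k"
      "\<And>g. g \<in> carrier G \<Longrightarrow> L g * B = B * \<rho> g"
    using bchoice[OF LB[unfolded Bex_def]] by blast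
  have rep: "mat_rep k \<rho>"
    unfolding mat_rep_def
  proof (intro conjI ballI)
    show "\<rho> \<one> = 1\<^sub>m k"
      using \<rho>(2)[of \<one>] LD(2) B by (intro inj_mat_cancel[OF B inj \<rho>(1)]) auto
    fix g h assume g: "g \<in> carrier G" and h: "h \<in> carrier G"
    have "B * \<rho> (g \<otimes> h) = L (g \<otimes> h) * B"
      using \<rho>(2) g h by simp
    also have "\<dots> = L g * (L h * B)"
      unfolding LD(3)[OF g h] by (rule assoc_mult_mat[OF LD(1)[OF g] LD(1)[OF h] B])
    also have "\<dots> = L g * B * \<rho> h"
      unfolding \<rho>(2)[OF h] by (rule assoc_mult_mat[OF LD(1)[OF g] B \<rho>(1)[OF h], symmetric])
    also have "\<dots> = B * (\<rho> g * \<rho> h)"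
      unfolding \<rho>(2)[OF g] by (rule assoc_mult_mat[OF B \<rho>(1)[OF g] \<rho>(1)[OF h]])
    finally show "\<rho> (g \<otimes> h) = \<rho> g * \<rho> h"
      by (rule inj_mat_cancel[OF B inj \<rho>(1)[OF m_closed[OF g h]] mult_carrier_mat[OF \<rho>(1)[OF g] \<rho>(1)[OF h]]])
  qed (rule \<rho>(1))
  have "W = {0\<^sub>v k} \<or> W = carrier_vec k" if inv: "invariant_subspace k \<rho> W" for W
  proof -
    have W: "VectorSpace.subspace class_ring W (module_vec TYPE(complex) k)"
      "\<And>g w. g \<in> carrier G \<Longrightarrow> w \<in> W \<Longrightarrow> \<rho> g *\<^sub>v w \<in> W"
      using inv by (auto simp: invariant_subspace_def)
    obtain j C where C: "C \<in> carrier_mat k j" "inj_mat C" "W = (\<lambda>v. C *\<^sub>v v) ` carrier_vec j"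
      by (rule subspace_eq_range[OF W(1)])
    have BC: "B * C \<in> carrier_mat N j"
      using B C by simp
    show ?thesis
    proof (cases "j = 0")
      case True
      have "w = 0\<^sub>v k" if "w \<in> W" for w
        using that C(1) True unfolding C(3) by (auto intro!: eq_vecI simp: scalar_prod_def)
      moreover have "0\<^sub>v k \<in> W"
        using W(1) by (simp add: subspace_vec_iff)
      ultimately show ?thesis
        by blast
    next
      case False
      have "inj_mat (B * C)"
        unfolding inj_mat_def
      proof (intro ballI impI)
        fix v assume "v \<in> carrier_vec (dim_col (B * C))" and "B * C *\<^sub>v v = 0\<^sub>v (dim_row (B * C))"
        then have v: "v \<in> carrier_vec j" and "B *\<^sub>v (C *\<^sub>v v) = 0\<^sub>v N"
          using B C by (auto simp: assoc_mult_mat_vec[OF B C(1)])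
        moreover have "C *\<^sub>v v \<in> carrier_vec k"
          using C v by auto
        ultimately have "C *\<^sub>v v = 0\<^sub>v k"
          using inj B unfolding inj_mat_def by auto
        then show "v = 0\<^sub>v (dim_col (B * C))"
          using C v unfolding inj_mat_def by auto
      qed
      moreover have "F * (B * C) = c \<cdot>\<^sub>m (B * C)"
        using assoc_mult_mat[OF F B C(1)] FB mult_smult_assoc_mat[OF B C(1)] by simp
      moreover have "\<exists>R\<in>carrier_mat j j. L g * (B * C) = B * C * R" if g: "g \<in> carrier G" for g
      proof -
        have "\<exists>R\<in>carrier_mat j j. \<rho> g * C = C * R"
        proof (rule factor_through_range[OF C(1)])
          show "\<rho> g * C \<in> carrier_mat k j"
            using \<rho>(1)[OF g] C by simp
          fix i assume i: "i < j"
          have "col C i = C *\<^sub>v unit_vec j i"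
            using i C(1) by (intro eq_vecI) (auto simp: scalar_prod_right_unit)
          then have "col C i \<in> W"
            unfolding C(3) by auto
          then show "col (\<rho> g * C) i \<in> (\<lambda>v. C *\<^sub>v v) ` carrier_vec j"
            using W(2)[OF g] unfolding col_mult2[OF \<rho>(1)[OF g] C(1) i] C(3) by blast
        qed
        then obtain R where R: "R \<in> carrier_mat j j" "\<rho> g * C = C * R"
          by blast
        have "L g * (B * C) = L g * B * C"
          by (rule assoc_mult_mat[OF LD(1)[OF g] B C(1), symmetric])
        also have "\<dots> = B * (\<rho> g * C)"
          unfolding \<rho>(2)[OF g] by (rule assoc_mult_mat[OF B \<rho>(1)[OF g] C(1)])
        also have "\<dots> = B * C * R"
          unfolding R(2) by (rule assoc_mult_mat[OF B C(1) R(1), symmetric])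
        finally show ?thesis
          using R(1) by blast
      qed
      ultimately have "P j"
        using False BC unfolding P_def by blast
      then have "j = k"
        using min inj_mat_dim_le[OF C(1,2)] by fastforce
      then have "W = carrier_vec k"
        using C inj_mat_surj[of C k] by fastforce
      then show ?thesis ..
    qed
  qed
  then have "irreducible_rep G k \<rho>"
    using rep k by (simp add: irreducible_rep_iff)
  then have act0: "alg_act k \<rho> f = 0\<^sub>m k k"
    by (rule zero)
  have "F * B = mat_sum N k (\<lambda>g. (f g \<cdot>\<^sub>m L g) * B) (carrier G)"
    unfolding F_def alg_act_def using LD(1) B by (intro mat_sum_mult) auto
  also have "\<dots> = mat_sum N k (\<lambda>g. B * (f g \<cdot>\<^sub>m \<rho> g)) (carrier G)"
  proof (rule mat_sum_cong)
    fix g assume g: "g \<in> carrier G"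
    show "(f g \<cdot>\<^sub>m L g) * B = B * (f g \<cdot>\<^sub>m \<rho> g)"
      using mult_smult_assoc_mat[OF LD(1)[OF g] B] \<rho>(2)[OF g] mult_smult_distrib[OF B \<rho>(1)[OF g]] by simp
  qed
  also have "\<dots> = B * alg_act k \<rho> f"
    unfolding alg_act_def using \<rho>(1) B by (intro mult_mat_sum[symmetric]) auto
  also have "\<dots> = 0\<^sub>m N k"
    unfolding act0 using B by simp
  finally have cB: "c \<cdot>\<^sub>m B = 0\<^sub>m N k"
    using FB by simp
  show ?thesis
  proof (rule ccontr)
    assume c: "c \<noteq> 0"
    have "B $$ (i, j) = 0" if "i < N" "j < k" for i j
      using arg_cong[OF cB, of "\<lambda>A. A $$ (i, j)"] that B c by simp
    then have "B *\<^sub>v unit_vec k 0 = 0\<^sub>v N"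
      using B k by (intro eq_vecI) (auto simp: scalar_prod_right_unit)
    then have "(unit_vec k 0 :: complex vec) = 0\<^sub>v k"
      using inj B unfolding inj_mat_def by auto
    then have "(unit_vec k 0 :: complex vec) $ 0 = 0\<^sub>v k $ 0"
      by simp
    then show False
      using k by simp
  qed
qed

text \<open>In the regular representation only the identity has nonzero trace, so the trace of \<open>f\<close> there
  is a multiple of its value at the identity.\<close>

lemma class_function_killed_at_one:
  assumes f: "class_function f"
    and zero: "\<And>n \<rho>. irreducible_rep G n \<rho> \<Longrightarrow> alg_act n \<rho> f = 0\<^sub>m n n"
  shows "f \<one> = 0"
proof -
  define N where "N = card (carrier G)"
  obtain e where e: "bij_betw e {..<N} (carrier G)"
    using ex_bij_betw_nat_finite[OF fin] unfolding N_def lessThan_atLeast0 by blast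
  have eG: "e i \<in> carrier G" if "i < N" for i
    using bij_betwE[OF e] that by simp
  have einj: "e i = e j \<longleftrightarrow> i = j" if "i < N" "j < N" for i j
    using e that by (auto simp: bij_betw_def inj_on_def)
  \<comment> \<open>the regular representation in the basis \<open>e\<close>\<close>
  define L where "L g = mat N N (\<lambda>(i, j). if e i = g \<otimes> e j then 1 else 0 :: complex)" for g
  have "mat_rep N L"
    unfolding mat_rep_def
  proof (intro conjI ballI)
    show "L g \<in> carrier_mat N N" for g
      by (simp add: L_def)
    show "L \<one> = 1\<^sub>m N"
      using eG einj by (intro eq_matI) (auto simp: L_def)
    fix g h assume g: "g \<in> carrier G" and h: "h \<in> carrier G"
    show "L (g \<otimes> h) = L g * L h"
    proof (rule eq_matI)
      fix i j assume "i < dim_row (L g * L h)" "j < dim_col (L g * L h)"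
      then have ij: "i < N" "j < N"
        by (auto simp: L_def)
      obtain p where p: "p < N" "e p = h \<otimes> e j"
        using e eG[OF ij(2)] h by (metis bij_betw_imp_surj_on imageE lessThan_iff m_closed)
      have "(L g * L h) $$ (i, j) = (\<Sum>l<N. L g $$ (i, l) * L h $$ (l, j))"
        using ij by (intro mult_mat_index[of _ N N _ N]) (auto simp: L_def)
      also have "\<dots> = (\<Sum>l<N. if l = p then L g $$ (i, l) else 0)"
      proof (intro sum.cong refl)
        fix l assume "l \<in> {..<N}"
        then show "L g $$ (i, l) * L h $$ (l, j) = (if l = p then L g $$ (i, l) else 0)"
          using einj[of l p] ij p(1) unfolding p(2) by (simp add: L_def)
      qed
      also have "\<dots> = L (g \<otimes> h) $$ (i, j)"
        using ij p g h eG[OF ij(2)] by (simp add: L_def m_assoc)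
      finally show "L (g \<otimes> h) $$ (i, j) = (L g * L h) $$ (i, j)" ..
    qed (auto simp: L_def)
  qed
  note L = this and LD = mat_repD[OF this]
  have trL: "mat_trace (L g) = (if g = \<one> then of_nat N else 0)" if g: "g \<in> carrier G" for g
  proof -
    have "e i = g \<otimes> e i \<longleftrightarrow> g = \<one>" if "i < N" for i
      using g eG[OF that] by simp
    then have "mat_trace (L g) = (\<Sum>i<N. if g = \<one> then 1 else 0)"
      unfolding mat_trace_carrier[OF LD(1)[OF g]] by (intro sum.cong) (auto simp: L_def)
    then show ?thesis by simp
  qed
  have "0 = mat_trace (alg_act N L f)"
    using mat_trace_eq_0_if_eigenvalues_0[OF alg_act_carrier] alg_act_eigenvalue_eq_0[OF L f zero] by metis
  also have "\<dots> = (\<Sum>g\<in>carrier G. mat_trace (f g \<cdot>\<^sub>m L g))"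
    unfolding alg_act_def using LD(1) by (intro mat_trace_mat_sum) auto
  also have "\<dots> = (\<Sum>g\<in>carrier G. if g = \<one> then f g * of_nat N else 0)"
    by (intro sum.cong refl) (simp add: mat_trace_smult[OF LD(1)] trL)
  also have "\<dots> = f \<one> * of_nat N"
    by simp
  finally show ?thesis
    using one_closed fin by (auto simp: N_def)
qed

definition convolution :: "('a \<Rightarrow> complex) \<Rightarrow> ('a \<Rightarrow> complex) \<Rightarrow> 'a \<Rightarrow> complex" where
  "convolution f k x = (\<Sum>y\<in>carrier G. f y * k (inv y \<otimes> x))"

lemma alg_act_convolution:
  assumes \<rho>: "mat_rep n \<rho>"
  shows "alg_act n \<rho> (convolution f k) = alg_act n \<rho> f * alg_act n \<rho> k"
proof -
  note R = mat_repD[OF \<rho>]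
  have shift: "\<rho> y * alg_act n \<rho> k = mat_sum n n (\<lambda>x. k (inv y \<otimes> x) \<cdot>\<^sub>m \<rho> x) (carrier G)" if y: "y \<in> carrier G" for y
  proof -
    have "mat_sum n n (\<lambda>x. k (inv y \<otimes> x) \<cdot>\<^sub>m \<rho> x) (carrier G) =
        mat_sum n n (\<lambda>x. k (inv y \<otimes> (y \<otimes> x)) \<cdot>\<^sub>m \<rho> (y \<otimes> x)) (carrier G)"
      by (rule mat_sum_reindex[OF bij_betw_mult_left[OF y], symmetric])
    also have "\<dots> = mat_sum n n (\<lambda>x. k x \<cdot>\<^sub>m \<rho> (y \<otimes> x)) (carrier G)"
      using y by (intro mat_sum_cong) (simp add: m_assoc[symmetric])
    finally show ?thesis
      using mult_alg_act[OF \<rho> y] by simp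
  qed
  have "alg_act n \<rho> f * alg_act n \<rho> k = mat_sum n n (\<lambda>y. (f y \<cdot>\<^sub>m \<rho> y) * alg_act n \<rho> k) (carrier G)"
    unfolding alg_act_def[of n \<rho> f] using R(1) by (intro mat_sum_mult) auto
  also have "\<dots> = mat_sum n n (\<lambda>y. f y \<cdot>\<^sub>m mat_sum n n (\<lambda>x. k (inv y \<otimes> x) \<cdot>\<^sub>m \<rho> x) (carrier G)) (carrier G)"
    by (intro mat_sum_cong) (simp add: mult_smult_assoc_mat[OF R(1) alg_act_carrier] shift)
  also have "\<dots> = alg_act n \<rho> (convolution f k)"
  proof (rule eq_matI)
    fix i j assume "i < dim_row (alg_act n \<rho> (convolution f k))" "j < dim_col (alg_act n \<rho> (convolution f k))"
    then have ij: "i < n" "j < n"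
      by (auto simp: alg_act_def mat_sum_def)
    have "mat_sum n n (\<lambda>y. f y \<cdot>\<^sub>m mat_sum n n (\<lambda>x. k (inv y \<otimes> x) \<cdot>\<^sub>m \<rho> x) (carrier G)) (carrier G) $$ (i, j) =
        (\<Sum>y\<in>carrier G. f y * (\<Sum>x\<in>carrier G. k (inv y \<otimes> x) * \<rho> x $$ (i, j)))"
    proof -
      have "(k z \<cdot>\<^sub>m \<rho> x) $$ (i, j) = k z * \<rho> x $$ (i, j)" if "x \<in> carrier G" for x z
        using R(1)[OF that] ij by simp
      then show ?thesis
        using ij by (simp add: mat_sum_def)
    qed
    also have "\<dots> = (\<Sum>x\<in>carrier G. convolution f k x * \<rho> x $$ (i, j))"
      unfolding convolution_def sum_distrib_left sum_distrib_right by (subst sum.swap) (simp add: mult.assoc)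
    also have "\<dots> = alg_act n \<rho> (convolution f k) $$ (i, j)"
    proof -
      have "(c \<cdot>\<^sub>m \<rho> x) $$ (i, j) = c * \<rho> x $$ (i, j)" if "x \<in> carrier G" for x c
        using R(1)[OF that] ij by simp
      then show ?thesis
        using ij by (simp add: alg_act_def mat_sum_def)
    qed
    finally show "mat_sum n n (\<lambda>y. f y \<cdot>\<^sub>m mat_sum n n (\<lambda>x. k (inv y \<otimes> x) \<cdot>\<^sub>m \<rho> x) (carrier G)) (carrier G) $$ (i, j) =
      alg_act n \<rho> (convolution f k) $$ (i, j)" .
  qed (auto simp: alg_act_def mat_sum_def)
  finally show ?thesis ..
qed

lemma convolution_class_function:
  assumes f: "class_function f" and k: "class_function k"
  shows "class_function (convolution f k)"
  unfolding class_function_def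
proof (intro ballI)
  fix g x assume g: "g \<in> carrier G" and x: "x \<in> carrier G"
  have "convolution f k (g \<otimes> x \<otimes> inv g) =
      (\<Sum>y\<in>carrier G. f (g \<otimes> y \<otimes> inv g) * k (inv (g \<otimes> y \<otimes> inv g) \<otimes> (g \<otimes> x \<otimes> inv g)))"
    unfolding convolution_def
    by (rule sum.reindex_bij_betw[OF bij_betw_conj[OF g], symmetric])
  also have "\<dots> = (\<Sum>y\<in>carrier G. f y * k (inv y \<otimes> x))"
  proof (intro sum.cong refl)
    fix y assume y: "y \<in> carrier G"
    have "inv g \<otimes> (g \<otimes> (x \<otimes> inv g)) = x \<otimes> inv g"
      using g x by (simp add: m_assoc[symmetric])
    then have "inv (g \<otimes> y \<otimes> inv g) \<otimes> (g \<otimes> x \<otimes> inv g) = g \<otimes> inv y \<otimes> x \<otimes> inv g"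
      using g x y by (simp add: inv_mult_group m_assoc)
    also have "\<dots> = g \<otimes> (inv y \<otimes> x) \<otimes> inv g"
      using g x y by (simp add: m_assoc)
    finally show "f (g \<otimes> y \<otimes> inv g) * k (inv (g \<otimes> y \<otimes> inv g) \<otimes> (g \<otimes> x \<otimes> inv g)) = f y * k (inv y \<otimes> x)"
      using f k g x y by (simp add: class_function_def)
  qed
  finally show "convolution f k (g \<otimes> x \<otimes> inv g) = convolution f k x"
    by (simp add: convolution_def)
qed

text \<open>The convolution of \<open>f\<close> with its adjoint is still killed by all irreducible representations,
  and its value at the identity is the squared norm of \<open>f\<close>.\<close>

lemma Irr_complete:
  assumes f: "class_function f"
    and orth: "\<And>\<chi>. \<chi> \<in> Irr G \<Longrightarrow> (\<Sum>g\<in>carrier G. f g * \<chi> g) = 0" and x: "x \<in> carrier G"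
  shows "f x = 0"
proof -
  define k where "k y = cnj (f (inv y))" for y
  have "k (g \<otimes> h \<otimes> inv g) = k h" if "g \<in> carrier G" "h \<in> carrier G" for g h
  proof -
    have "inv (g \<otimes> h \<otimes> inv g) = g \<otimes> inv h \<otimes> inv g"
      using that by (simp add: inv_mult_group m_assoc)
    then show ?thesis
      using f that by (simp add: k_def class_function_def)
  qed
  then have "class_function k"
    by (simp add: class_function_def)
  then have "class_function (convolution f k)"
    by (rule convolution_class_function[OF f])
  moreover have "alg_act n \<rho> (convolution f k) = 0\<^sub>m n n" if \<rho>: "irreducible_rep G n \<rho>" for n \<rho>
    using alg_act_convolution[of n \<rho> f k] \<rho> alg_act_irreducible_eq_0[OF \<rho> f orth]
    by (simp add: irreducible_rep_iff left_mult_zero_mat[OF alg_act_carrier])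
  ultimately have "convolution f k \<one> = 0"
    by (rule class_function_killed_at_one)
  moreover have "convolution f k \<one> = complex_of_real (\<Sum>y\<in>carrier G. (cmod (f y))\<^sup>2)"
    unfolding convolution_def of_real_sum
    by (intro sum.cong refl) (simp add: k_def complex_norm_square del: of_real_power)
  ultimately have "(\<Sum>y\<in>carrier G. (cmod (f y))\<^sup>2) = 0"
    by (simp only: of_real_eq_0_iff)
  then show ?thesis
    using x by (subst (asm) sum_nonneg_eq_0_iff) auto
qed

end

section \<open>Partitions\<close>

definition const_on :: "'b set set \<Rightarrow> ('b \<Rightarrow> 'c) \<Rightarrow> bool" where
  "const_on P f \<longleftrightarrow> (\<forall>B\<in>P. \<forall>x\<in>B. \<forall>y\<in>B. f x = f y)"

definition block_of :: "'b set set \<Rightarrow> 'b \<Rightarrow> 'b set" where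
  "block_of P x = (THE B. B \<in> P \<and> x \<in> B)"

lemma block_of_eq:
  assumes "partition_on A P" "B \<in> P" "x \<in> B"
  shows "block_of P x = B"
  unfolding block_of_def
  using assms by (intro the_equality) (auto dest: partition_onD2 disjointD)

lemma block_of_mem:
  assumes P: "partition_on A P" and x: "x \<in> A"
  shows "block_of P x \<in> P" "x \<in> block_of P x"
proof -
  obtain B where "B \<in> P" "x \<in> B"
    using partition_onD1[OF P] x by blast
  then show "block_of P x \<in> P" "x \<in> block_of P x"
    using block_of_eq[OF P] by auto
qed

lemma partition_block_subset: "partition_on A P \<Longrightarrow> B \<in> P \<Longrightarrow> B \<subseteq> A"
  by (auto dest: partition_onD1)

lemma partition_block_nonempty: "partition_on A P \<Longrightarrow> B \<in> P \<Longrightarrow> \<exists>x. x \<in> B"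
  by (metis partition_onD3 all_not_in_conv)

lemma sum_over_blocks:
  fixes f :: "'b \<Rightarrow> 'c::comm_monoid_add"
  assumes P: "partition_on A P" and A: "finite A"
  shows "(\<Sum>B\<in>P. \<Sum>x\<in>B. f x) = (\<Sum>x\<in>A. f x)"
proof -
  have "\<forall>B\<in>P. finite B"
    using A partition_block_subset[OF P] finite_subset by blast
  then have "sum f (\<Union>P) = (sum \<circ> sum) f P"
    using partition_onD2[OF P] by (intro sum.Union_disjoint) (auto dest: disjointD)
  then show ?thesis
    by (simp add: partition_onD1[OF P, symmetric])
qed

lemma sum_over_blocks_coeff:
  fixes c :: "'b set \<Rightarrow> 'c::comm_ring_1"
  assumes P: "partition_on A P" and A: "finite A"
  shows "(\<Sum>B\<in>P. c B * (\<Sum>x\<in>B. f x)) = (\<Sum>x\<in>A. c (block_of P x) * f x)"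
proof -
  have "(\<Sum>B\<in>P. c B * (\<Sum>x\<in>B. f x)) = (\<Sum>B\<in>P. \<Sum>x\<in>B. c (block_of P x) * f x)"
    unfolding sum_distrib_left by (intro sum.cong refl) (simp add: block_of_eq[OF P])
  then show ?thesis
    by (simp add: sum_over_blocks[OF P A])
qed

lemma card_partition_le:
  assumes P: "partition_on A P" and A: "finite A"
  shows "card P \<le> card A"
proof -
  have "P \<subseteq> block_of P ` A"
  proof
    fix B assume B: "B \<in> P"
    then obtain x where "x \<in> B"
      using partition_block_nonempty[OF P] by blast
    then show "B \<in> block_of P ` A"
      using block_of_eq[OF P B] partition_block_subset[OF P B] by blast
  qed
  then show ?thesis
    using surj_card_le[OF A] by blast
qed

lemma const_on_some:
  assumes P: "partition_on A P" and f: "const_on P f" and x: "x \<in> A"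
  shows "f (SOME y. y \<in> block_of P x) = f x"
proof -
  have "(SOME y. y \<in> block_of P x) \<in> block_of P x"
    using someI[of "\<lambda>y. y \<in> block_of P x" x] block_of_mem(2)[OF P x] by simp
  then show ?thesis
    using f block_of_mem[OF P x] unfolding const_on_def by blast
qed

lemma hat_const_onD: "const_on P (hat S) \<Longrightarrow> B \<in> P \<Longrightarrow> x \<in> B \<Longrightarrow> x \<in> S \<Longrightarrow> B \<subseteq> S"
  unfolding const_on_def hat_def by (metis subsetI zero_neq_one)

lemma hat_const_on_block: "partition_on A P \<Longrightarrow> S \<in> P \<Longrightarrow> const_on P (hat S)"
  unfolding const_on_def hat_def by (metis block_of_eq)

lemma const_on_refines: "refines A P Q \<Longrightarrow> const_on Q f \<Longrightarrow> const_on P f"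
  unfolding const_on_def refines_def by (meson subsetD)

lemma refines_if_hats_const:
  assumes P: "partition_on A P" and Q: "partition_on A Q" and hat: "\<And>B. B \<in> Q \<Longrightarrow> const_on P (hat B)"
  shows "refines A P Q"
  unfolding refines_def
proof (intro conjI ballI P Q)
  fix B assume B: "B \<in> P"
  then obtain x where x: "x \<in> B"
    using partition_block_nonempty[OF P] by blast
  then have "x \<in> A"
    using partition_block_subset[OF P B] by blast
  then show "\<exists>C\<in>Q. B \<subseteq> C"
    using block_of_mem[OF Q] hat_const_onD[OF hat B x] by blast
qed

text \<open>Both partition maps of the algorithm form the classes on which a family of functions is constant.\<close>

definition fibre_rel :: "'b set \<Rightarrow> 'k set \<Rightarrow> ('k \<Rightarrow> 'b \<Rightarrow> 'c) \<Rightarrow> ('b \<times> 'b) set" where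
  "fibre_rel A I \<phi> = {(x, y). x \<in> A \<and> y \<in> A \<and> (\<forall>k\<in>I. \<phi> k x = \<phi> k y)}"

lemma equiv_fibre_rel: "equiv A (fibre_rel A I \<phi>)"
  by (rule equivI) (auto simp: fibre_rel_def refl_on_def sym_def trans_def)

lemma fibre_partition: "partition_on A (A // fibre_rel A I \<phi>)"
  by (rule partition_on_quotient[OF equiv_fibre_rel])

lemma fibre_const_on: "k \<in> I \<Longrightarrow> const_on (A // fibre_rel A I \<phi>) (\<phi> k)"
  unfolding const_on_def quotient_def by (auto simp: fibre_rel_def)

lemma refines_fibre:
  assumes P: "partition_on A P" and const: "\<And>k. k \<in> I \<Longrightarrow> const_on P (\<phi> k)"
  shows "refines A P (A // fibre_rel A I \<phi>)"
  unfolding refines_def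
proof (intro conjI ballI P fibre_partition)
  fix B assume B: "B \<in> P"
  then obtain x where x: "x \<in> B"
    using partition_block_nonempty[OF P] by blast
  have "B \<subseteq> fibre_rel A I \<phi> `` {x}"
  proof
    fix y assume y: "y \<in> B"
    have "\<phi> k x = \<phi> k y" if "k \<in> I" for k
      using const[OF that] B x y unfolding const_on_def by blast
    then show "y \<in> fibre_rel A I \<phi> `` {x}"
      using partition_block_subset[OF P B] x y by (auto simp: fibre_rel_def)
  qed
  then show "\<exists>C\<in>A // fibre_rel A I \<phi>. B \<subseteq> C"
    using partition_block_subset[OF P B] x by (auto simp: quotient_def)
qed

context fin_group
begin

section \<open>Characters and partitions\<close>

text \<open>The central character of \<open>\<chi>\<close>, evaluated at the group algebra element with coefficients \<open>f\<close>. Using all of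
  \<open>f\<close> instead of sums \<open>hat K\<close> allows linear combinations.\<close>

abbreviation \<Omega> :: "('a \<Rightarrow> complex) \<Rightarrow> ('a \<Rightarrow> complex) \<Rightarrow> complex" where
  "\<Omega> f \<chi> \<equiv> lin_ext G \<chi> f / \<chi> \<one>"

lemma ClPt_fibre: "ClPt G \<X> = carrier G // fibre_rel (carrier G) \<X> (sigma_char G)"
  by (simp add: ClPt_def fibre_rel_def)

lemma IrPt_fibre: "IrPt G \<K> = Irr G // fibre_rel (Irr G) \<K> (\<lambda>K. \<Omega> (hat K))"
  by (simp add: IrPt_def fibre_rel_def)

lemma ClPt_partition: "partition_on (carrier G) (ClPt G \<X>)"
  unfolding ClPt_fibre by (rule fibre_partition)

lemma IrPt_partition: "partition_on (Irr G) (IrPt G \<K>)"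
  unfolding IrPt_fibre by (rule fibre_partition)

lemma Irr_degree_real: "\<chi> \<in> Irr G \<Longrightarrow> cnj (\<chi> \<one>) = \<chi> \<one>"
  using Irr_inv[of \<chi> \<one>] by simp

lemma carrier_nonempty [simp]: "carrier G \<noteq> {}"
  using one_closed by blast

text \<open>The difference of the two sides is a class function orthogonal to all irreducible
  characters.\<close>

lemma fourier_inversion:
  assumes f: "class_function f" and x: "x \<in> carrier G"
  shows "f x = (\<Sum>\<chi>\<in>Irr G. lin_ext G \<chi> f * cnj (\<chi> x)) / of_nat (card (carrier G))"
proof -
  let ?N = "of_nat (card (carrier G)) :: complex"
  define h where "h x = f x - (\<Sum>\<chi>\<in>Irr G. lin_ext G \<chi> f * cnj (\<chi> x)) / ?N" for x
  have "class_function h"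
    unfolding class_function_def
  proof (intro ballI)
    fix g y assume gy: "g \<in> carrier G" "y \<in> carrier G"
    have "\<chi> (g \<otimes> y \<otimes> inv g) = \<chi> y" if "\<chi> \<in> Irr G" for \<chi>
      using Irr_class_function[OF that] gy by (simp add: class_function_def)
    then have "(\<Sum>\<chi>\<in>Irr G. lin_ext G \<chi> f * cnj (\<chi> (g \<otimes> y \<otimes> inv g))) =
        (\<Sum>\<chi>\<in>Irr G. lin_ext G \<chi> f * cnj (\<chi> y))"
      by (intro sum.cong refl) simp
    then show "h (g \<otimes> y \<otimes> inv g) = h y"
      using f gy by (simp add: h_def class_function_def)
  qed
  moreover have "(\<Sum>g\<in>carrier G. h g * \<psi> g) = 0" if \<psi>: "\<psi> \<in> Irr G" for \<psi>
  proof -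
    have "(\<Sum>g\<in>carrier G. (\<Sum>\<chi>\<in>Irr G. lin_ext G \<chi> f * cnj (\<chi> g)) * \<psi> g) =
        (\<Sum>\<chi>\<in>Irr G. lin_ext G \<chi> f * (\<Sum>g\<in>carrier G. \<psi> g * cnj (\<chi> g)))"
      unfolding sum_distrib_left sum_distrib_right by (subst sum.swap) (simp add: mult_ac)
    also have "\<dots> = (\<Sum>\<chi>\<in>Irr G. if \<chi> = \<psi> then lin_ext G \<psi> f * ?N else 0)"
      using \<psi> by (intro sum.cong refl) (simp add: Irr_orthogonal)
    also have "\<dots> = lin_ext G \<psi> f * ?N"
      using \<psi> by simp
    finally have eq: "(\<Sum>g\<in>carrier G. (\<Sum>\<chi>\<in>Irr G. lin_ext G \<chi> f * cnj (\<chi> g)) * \<psi> g) = lin_ext G \<psi> f * ?N" .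
    have "(\<Sum>g\<in>carrier G. h g * \<psi> g) = (\<Sum>g\<in>carrier G. f g * \<psi> g -
        (\<Sum>\<chi>\<in>Irr G. lin_ext G \<chi> f * cnj (\<chi> g)) * \<psi> g / ?N)"
      by (intro sum.cong refl) (simp add: h_def left_diff_distrib)
    also have "\<dots> =
        lin_ext G \<psi> f - (\<Sum>g\<in>carrier G. (\<Sum>\<chi>\<in>Irr G. lin_ext G \<chi> f * cnj (\<chi> g)) * \<psi> g) / ?N"
      unfolding sum_subtractf sum_divide_distrib[symmetric] lin_ext_def[of G \<psi> f] ..
    finally have "(\<Sum>g\<in>carrier G. h g * \<psi> g) =
        lin_ext G \<psi> f - (\<Sum>g\<in>carrier G. (\<Sum>\<chi>\<in>Irr G. lin_ext G \<chi> f * cnj (\<chi> g)) * \<psi> g) / ?N" .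
    then show ?thesis
      unfolding eq by simp
  qed
  ultimately have "h x = 0"
    using Irr_complete x by blast
  then show ?thesis
    by (simp add: h_def)
qed

lemma cnj_sigma: "X \<subseteq> Irr G \<Longrightarrow> cnj (sigma_char G X g) = (\<Sum>\<chi>\<in>X. \<chi> \<one> * cnj (\<chi> g))"
  unfolding sigma_char_def cnj_sum by (intro sum.cong refl) (auto simp: Irr_degree_real)

lemma sigma_class_function: "X \<subseteq> Irr G \<Longrightarrow> class_function (sigma_char G X)"
  unfolding class_function_def sigma_char_def
  by (intro ballI sum.cong refl) (metis Irr_class_function class_function_def subsetD)

text \<open>If \<open>\<Omega> f\<close> is constant on the blocks of \<open>P\<close>, Fourier inversion only involves the sums
  \<open>sigma_char G X\<close> over the blocks.\<close>

lemma fourier_inversion_blocks: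
  assumes P: "partition_on (Irr G) P" and f: "class_function f" and const: "const_on P (\<Omega> f)"
  shows "\<exists>c. \<forall>g\<in>carrier G. f g = (\<Sum>X\<in>P. c X * cnj (sigma_char G X g))"
proof -
  define c where "c X = \<Omega> f (SOME \<chi>. \<chi> \<in> X) / of_nat (card (carrier G))" for X
  have "f g = (\<Sum>X\<in>P. c X * cnj (sigma_char G X g))" if g: "g \<in> carrier G" for g
  proof -
    have "(\<Sum>X\<in>P. c X * cnj (sigma_char G X g)) = (\<Sum>X\<in>P. c X * (\<Sum>\<chi>\<in>X. \<chi> \<one> * cnj (\<chi> g)))"
      using partition_block_subset[OF P] by (simp add: cnj_sigma)
    also have "\<dots> = (\<Sum>\<chi>\<in>Irr G. c (block_of P \<chi>) * (\<chi> \<one> * cnj (\<chi> g)))"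
      by (rule sum_over_blocks_coeff[OF P finite_Irr])
    also have "\<dots> = (\<Sum>\<chi>\<in>Irr G. lin_ext G \<chi> f * cnj (\<chi> g) / of_nat (card (carrier G)))"
    proof (intro sum.cong refl)
      fix \<chi> assume \<chi>: "\<chi> \<in> Irr G"
      show "c (block_of P \<chi>) * (\<chi> \<one> * cnj (\<chi> g)) = lin_ext G \<chi> f * cnj (\<chi> g) / of_nat (card (carrier G))"
        using Irr_degree[OF \<chi>] const_on_some[OF P const \<chi>] by (simp add: c_def)
    qed
    also have "\<dots> = f g"
      using fourier_inversion[OF f g] by (simp add: sum_divide_distrib)
    finally show ?thesis ..
  qed
  then show ?thesis
    by blast
qed

text \<open>A converse of \<open>fourier_inversion_blocks\<close>, by orthogonality: the coefficients are the values
  of the central characters, up to the factor \<open>|G|\<close>.\<close>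

lemma lin_ext_sigma_combination:
  assumes P: "partition_on (Irr G) P" and f: "\<And>g. g \<in> carrier G \<Longrightarrow> f g = (\<Sum>X\<in>P. c X * cnj (sigma_char G X g))"
    and X: "X \<in> P" "\<chi> \<in> X"
  shows "\<Omega> f \<chi> = c X * of_nat (card (carrier G))"
proof -
  have \<chi>: "\<chi> \<in> Irr G"
    using partition_block_subset[OF P X(1)] X(2) by blast
  have "lin_ext G \<chi> f = (\<Sum>g\<in>carrier G. (\<Sum>\<psi>\<in>Irr G. c (block_of P \<psi>) * (\<psi> \<one> * cnj (\<psi> g))) * \<chi> g)"
    unfolding lin_ext_def
  proof (intro sum.cong refl)
    fix g assume g: "g \<in> carrier G"
    have "f g = (\<Sum>X\<in>P. c X * (\<Sum>\<psi>\<in>X. \<psi> \<one> * cnj (\<psi> g)))"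
      using partition_block_subset[OF P] by (simp add: f[OF g] cnj_sigma)
    then show "f g * \<chi> g = (\<Sum>\<psi>\<in>Irr G. c (block_of P \<psi>) * (\<psi> \<one> * cnj (\<psi> g))) * \<chi> g"
      by (simp only: sum_over_blocks_coeff[OF P finite_Irr])
  qed
  also have "\<dots> = (\<Sum>\<psi>\<in>Irr G. c (block_of P \<psi>) * \<psi> \<one> * (\<Sum>g\<in>carrier G. \<chi> g * cnj (\<psi> g)))"
    unfolding sum_distrib_left sum_distrib_right by (subst sum.swap) (simp add: mult_ac)
  also have "\<dots> = (\<Sum>\<psi>\<in>Irr G. if \<psi> = \<chi> then c (block_of P \<chi>) * \<chi> \<one> * of_nat (card (carrier G)) else 0)"
    using \<chi> by (intro sum.cong refl) (simp add: Irr_orthogonal)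
  also have "\<dots> = c X * \<chi> \<one> * of_nat (card (carrier G))"
    using \<chi> block_of_eq[OF P X] by simp
  finally show ?thesis
    using Irr_degree[OF \<chi>] by simp
qed

lemma sigma_independent:
  assumes P: "partition_on (Irr G) P" and zero: "\<forall>g\<in>carrier G. (\<Sum>X\<in>P. c X * cnj (sigma_char G X g)) = 0"
  shows "\<forall>X\<in>P. c X = 0"
proof
  fix X assume X: "X \<in> P"
  then obtain \<chi> where "\<chi> \<in> X"
    using partition_block_nonempty[OF P] by blast
  then have "\<Omega> (\<lambda>_. 0) \<chi> = c X * of_nat (card (carrier G))"
    using zero X by (intro lin_ext_sigma_combination[OF P]) auto
  then show "c X = 0"
    by (simp add: lin_ext_def)
qed

lemma sigma_values_independent:
  assumes P: "partition_on (Irr G) P" and K: "partition_on (carrier G) K"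
    and const: "\<And>X. X \<in> P \<Longrightarrow> const_on K (sigma_char G X)"
    and zero: "\<forall>B\<in>K. (\<Sum>X\<in>P. c X * cnj (sigma_char G X (SOME g. g \<in> B))) = 0"
  shows "\<forall>X\<in>P. c X = 0"
proof (rule sigma_independent[OF P], intro ballI)
  fix g assume g: "g \<in> carrier G"
  have "(\<Sum>X\<in>P. c X * cnj (sigma_char G X g)) =
      (\<Sum>X\<in>P. c X * cnj (sigma_char G X (SOME h. h \<in> block_of K g)))"
    by (intro sum.cong refl) (simp add: const_on_some[OF K const g])
  then show "(\<Sum>X\<in>P. c X * cnj (sigma_char G X g)) = 0"
    using zero block_of_mem(1)[OF K g] by simp
qed

lemma card_le_if_sigma_const:
  assumes P: "partition_on (Irr G) P" and K: "partition_on (carrier G) K"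
    and const: "\<And>X. X \<in> P \<Longrightarrow> const_on K (sigma_char G X)"
  shows "card P \<le> card K"
proof (rule independent_rows_card_le)
  fix c assume zero: "\<forall>B\<in>K. (\<Sum>X\<in>P. c X * cnj (sigma_char G X (SOME g. g \<in> B))) = 0"
  show "\<forall>X\<in>P. c X = 0"
    by (rule sigma_values_independent[OF assms zero])
qed (use finite_elements[OF finite_Irr P] finite_elements[OF fin K] in simp_all)

text \<open>When the partitions have equally many blocks, the values of the \<open>sigma_char G X\<close> on the blocks of \<open>K\<close> form
  an invertible square matrix.\<close>

lemma sigma_span:
  assumes P: "partition_on (Irr G) P" and K: "partition_on (carrier G) K"
    and const: "\<And>X. X \<in> P \<Longrightarrow> const_on K (sigma_char G X)"
    and card: "card P = card K" and f: "const_on K f"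
  shows "\<exists>c. \<forall>g\<in>carrier G. f g = (\<Sum>X\<in>P. c X * cnj (sigma_char G X g))"
proof -
  have "\<exists>c. \<forall>B\<in>K. (\<Sum>X\<in>P. c X * cnj (sigma_char G X (SOME g. g \<in> B))) = f (SOME g. g \<in> B)"
  proof (rule independent_rows_solvable)
    fix c assume zero: "\<forall>B\<in>K. (\<Sum>X\<in>P. c X * cnj (sigma_char G X (SOME g. g \<in> B))) = 0"
    show "\<forall>X\<in>P. c X = 0"
      by (rule sigma_values_independent[OF P K const zero])
  qed (use finite_elements[OF finite_Irr P] finite_elements[OF fin K] card in simp_all)
  then obtain c where c: "\<forall>B\<in>K. (\<Sum>X\<in>P. c X * cnj (sigma_char G X (SOME g. g \<in> B))) = f (SOME g. g \<in> B)"
    by blast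
  have "f g = (\<Sum>X\<in>P. c X * cnj (sigma_char G X g))" if g: "g \<in> carrier G" for g
  proof -
    have "f g = f (SOME h. h \<in> block_of K g)"
      by (rule const_on_some[OF K f g, symmetric])
    also have "\<dots> = (\<Sum>X\<in>P. c X * cnj (sigma_char G X (SOME h. h \<in> block_of K g)))"
      using c block_of_mem(1)[OF K g] by simp
    also have "\<dots> = (\<Sum>X\<in>P. c X * cnj (sigma_char G X g))"
      by (intro sum.cong refl) (simp add: const_on_some[OF K const g])
    finally show ?thesis .
  qed
  then show ?thesis
    by blast
qed

lemma combination_of_hats:
  assumes K: "partition_on (carrier G) K" and g: "g \<in> carrier G"
  shows "(\<Sum>B\<in>K. c B * hat B g) = c (block_of K g)"
proof -
  have "(\<Sum>B\<in>K. c B * hat B g) = (\<Sum>B\<in>K. if B = block_of K g then c B else 0)"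
  proof (intro sum.cong refl)
    fix B assume B: "B \<in> K"
    have "g \<in> B \<longleftrightarrow> B = block_of K g"
      using block_of_eq[OF K B] block_of_mem(2)[OF K g] by blast
    then show "c B * hat B g = (if B = block_of K g then c B else 0)"
      by (simp add: hat_def)
  qed
  then show ?thesis
    using block_of_mem[OF K g] finite_elements[OF fin K] by simp
qed

lemma lin_ext_combination_of_hats:
  assumes K: "partition_on (carrier G) K"
  shows "\<Omega> (\<lambda>g. c (block_of K g)) \<chi> = (\<Sum>B\<in>K. c B * \<Omega> (hat B) \<chi>)"
proof -
  have "lin_ext G \<chi> (\<lambda>g. c (block_of K g)) = (\<Sum>g\<in>carrier G. (\<Sum>B\<in>K. c B * hat B g) * \<chi> g)"
    by (simp add: lin_ext_def combination_of_hats[OF K])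
  also have "\<dots> = (\<Sum>B\<in>K. c B * lin_ext G \<chi> (hat B))"
    unfolding lin_ext_def sum_distrib_left sum_distrib_right by (subst sum.swap) (simp add: mult_ac)
  finally show ?thesis
    by (simp add: sum_divide_distrib)
qed

lemma block_class_function:
  assumes K: "partition_on (carrier G) K" and inv: "\<And>B. B \<in> K \<Longrightarrow> class_function (hat B)"
  shows "class_function (\<lambda>g. c (block_of K g))"
  unfolding class_function_def
proof (intro ballI)
  fix g h assume gh: "g \<in> carrier G" "h \<in> carrier G"
  have "hat (block_of K h) (g \<otimes> h \<otimes> inv g) = hat (block_of K h) h"
    using inv[OF block_of_mem(1)[OF K gh(2)]] gh by (simp add: class_function_def)
  then have "g \<otimes> h \<otimes> inv g \<in> block_of K h"
    using block_of_mem(2)[OF K gh(2)] by (auto simp: hat_def split: if_splits)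
  then have "block_of K (g \<otimes> h \<otimes> inv g) = block_of K h"
    using block_of_eq[OF K block_of_mem(1)[OF K gh(2)]] by simp
  then show "c (block_of K (g \<otimes> h \<otimes> inv g)) = c (block_of K h)"
    by simp
qed

text \<open>The dual count: the sums over the blocks of \<open>K\<close> are independent central elements, each
  determined by its central character values, one for each block of \<open>P\<close>.\<close>

lemma hat_values_independent:
  assumes P: "partition_on (Irr G) P" and K: "partition_on (carrier G) K"
    and inv: "\<And>B. B \<in> K \<Longrightarrow> class_function (hat B)"
    and const: "\<And>B. B \<in> K \<Longrightarrow> const_on P (\<Omega> (hat B))"
    and zero: "\<forall>X\<in>P. (\<Sum>B\<in>K. c B * \<Omega> (hat B) (SOME \<chi>. \<chi> \<in> X)) = 0"
  shows "\<forall>B\<in>K. c B = 0"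
proof
  fix B assume B: "B \<in> K"
  obtain x where x: "x \<in> B"
    using partition_block_nonempty[OF K B] by blast
  then have xG: "x \<in> carrier G"
    using partition_block_subset[OF K B] by blast
  have "lin_ext G \<chi> (\<lambda>g. c (block_of K g)) = 0" if \<chi>: "\<chi> \<in> Irr G" for \<chi>
  proof -
    note b = block_of_mem[OF P \<chi>]
    have "\<Omega> (hat C) (SOME \<psi>. \<psi> \<in> block_of P \<chi>) = \<Omega> (hat C) \<chi>" if "C \<in> K" for C
      by (rule const_on_some[OF P const[OF that] \<chi>])
    then have "(\<Sum>C\<in>K. c C * \<Omega> (hat C) (SOME \<psi>. \<psi> \<in> block_of P \<chi>)) = \<Omega> (\<lambda>g. c (block_of K g)) \<chi>"
      by (simp add: lin_ext_combination_of_hats[OF K] cong: sum.cong)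
    then show ?thesis
      using zero b(1) Irr_degree[OF \<chi>] by simp
  qed
  then have "c (block_of K x) = 0"
    using Irr_complete[OF block_class_function[OF K inv], of c x] xG by (simp add: lin_ext_def)
  then show "c B = 0"
    using block_of_eq[OF K B x] by simp
qed

lemma card_le_if_hat_const:
  assumes P: "partition_on (Irr G) P" and K: "partition_on (carrier G) K"
    and inv: "\<And>B. B \<in> K \<Longrightarrow> class_function (hat B)"
    and const: "\<And>B. B \<in> K \<Longrightarrow> const_on P (\<Omega> (hat B))"
  shows "card K \<le> card P"
proof (rule independent_rows_card_le)
  fix c assume zero: "\<forall>X\<in>P. (\<Sum>B\<in>K. c B * \<Omega> (hat B) (SOME \<chi>. \<chi> \<in> X)) = 0"
  show "\<forall>B\<in>K. c B = 0"
    by (rule hat_values_independent[OF assms zero])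
qed (use finite_elements[OF finite_Irr P] finite_elements[OF fin K] in simp_all)

text \<open>Now the central character values form an invertible square matrix, so some combination of the
  block sums has central character \<open>1\<close> on the block \<open>X\<close> and \<open>0\<close> elsewhere. By Fourier
  inversion it is the conjugate of \<open>sigma_char G X\<close> divided by \<open>|G|\<close>, the central idempotent of the block.\<close>

lemma sigma_const_if_hat_const:
  assumes P: "partition_on (Irr G) P" and K: "partition_on (carrier G) K"
    and inv: "\<And>B. B \<in> K \<Longrightarrow> class_function (hat B)"
    and const: "\<And>B. B \<in> K \<Longrightarrow> const_on P (\<Omega> (hat B))"
    and card: "card P = card K" and X: "X \<in> P"
  shows "const_on K (sigma_char G X)"
proof -
  let ?N = "of_nat (card (carrier G)) :: complex"
  have "\<exists>c. \<forall>Y\<in>P. (\<Sum>B\<in>K. c B * \<Omega> (hat B) (SOME \<chi>. \<chi> \<in> Y)) = (if Y = X then 1 else 0)"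
  proof (rule independent_rows_solvable)
    fix c assume zero: "\<forall>Y\<in>P. (\<Sum>B\<in>K. c B * \<Omega> (hat B) (SOME \<chi>. \<chi> \<in> Y)) = 0"
    show "\<forall>B\<in>K. c B = 0"
      by (rule hat_values_independent[OF P K inv const zero])
  qed (use finite_elements[OF finite_Irr P] finite_elements[OF fin K] card in simp_all)
  then obtain c where c: "\<forall>Y\<in>P. (\<Sum>B\<in>K. c B * \<Omega> (hat B) (SOME \<chi>. \<chi> \<in> Y)) = (if Y = X then 1 else 0)"
    by blast
  let ?f = "\<lambda>g. c (block_of K g)"
  have \<Omega>: "\<Omega> ?f \<chi> = (if \<chi> \<in> X then 1 else 0)" if \<chi>: "\<chi> \<in> Irr G" for \<chi>
  proof -
    note b = block_of_mem[OF P \<chi>]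
    have "\<Omega> (hat C) (SOME \<psi>. \<psi> \<in> block_of P \<chi>) = \<Omega> (hat C) \<chi>" if "C \<in> K" for C
      by (rule const_on_some[OF P const[OF that] \<chi>])
    then have "\<Omega> ?f \<chi> = (\<Sum>C\<in>K. c C * \<Omega> (hat C) (SOME \<psi>. \<psi> \<in> block_of P \<chi>))"
      by (simp add: lin_ext_combination_of_hats[OF K] cong: sum.cong)
    also have "\<dots> = (if block_of P \<chi> = X then 1 else 0)"
      using c b(1) by simp
    also have "block_of P \<chi> = X \<longleftrightarrow> \<chi> \<in> X"
      using block_of_eq[OF P X] b(2) by auto
    finally show ?thesis .
  qed
  have eq: "?f g * ?N = cnj (sigma_char G X g)" if g: "g \<in> carrier G" for g
  proof -
    have XI: "X \<subseteq> Irr G"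
      using partition_block_subset[OF P X] .
    have "?f g * ?N = (\<Sum>\<chi>\<in>Irr G. lin_ext G \<chi> ?f * cnj (\<chi> g))"
      using fourier_inversion[OF block_class_function[OF K inv] g, of c] by (simp add: field_simps)
    also have "\<dots> = (\<Sum>\<chi>\<in>Irr G. if \<chi> \<in> X then \<chi> \<one> * cnj (\<chi> g) else 0)"
    proof (intro sum.cong refl)
      fix \<chi> assume \<chi>: "\<chi> \<in> Irr G"
      then have "lin_ext G \<chi> ?f = \<Omega> ?f \<chi> * \<chi> \<one>"
        using Irr_degree by simp
      then show "lin_ext G \<chi> ?f * cnj (\<chi> g) = (if \<chi> \<in> X then \<chi> \<one> * cnj (\<chi> g) else 0)"
        unfolding \<Omega>[OF \<chi>] by simp
    qed
    also have "\<dots> = cnj (sigma_char G X g)"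
      using XI by (simp add: cnj_sigma sum.If_cases Int_absorb1)
    finally show ?thesis .
  qed
  show ?thesis
    unfolding const_on_def
  proof (intro ballI)
    fix B g h assume B: "B \<in> K" and gh: "g \<in> B" "h \<in> B"
    then have "g \<in> carrier G" "h \<in> carrier G"
      using partition_block_subset[OF K] by blast+
    then show "sigma_char G X g = sigma_char G X h"
      using eq[of g] eq[of h] block_of_eq[OF K B] gh by (metis complex_cnj_cancel_iff)
  qed
qed

section \<open>Supercharacter theories\<close>

lemma supercharacter_theory_iff:
  "supercharacter_theory G (X, K) \<longleftrightarrow>
     partition_on (Irr G) X \<and> partition_on (carrier G) K \<and> card X = card K \<and>
     (\<forall>Y\<in>X. const_on K (sigma_char G Y))"
  by (simp add: supercharacter_theory_def const_on_def)

lemma sctD: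
  assumes "supercharacter_theory G T"
  shows "partition_on (Irr G) (fst T)" "partition_on (carrier G) (snd T)" "card (fst T) = card (snd T)"
    "X \<in> fst T \<Longrightarrow> const_on (snd T) (sigma_char G X)"
  using assms unfolding supercharacter_theory_def const_on_def by blast+

lemma sct_span:
  assumes T: "supercharacter_theory G T" and f: "const_on (snd T) f"
  shows "\<exists>c. \<forall>g\<in>carrier G. f g = (\<Sum>X\<in>fst T. c X * cnj (sigma_char G X g))"
  by (rule sigma_span[OF sctD(1,2)[OF T] sctD(4)[OF T] sctD(3)[OF T] f])

text \<open>Applied to \<open>hat K\<close> for a superclass \<open>K\<close>, this shows that superclasses are unions of conjugacy classes.\<close>

lemma sct_class_function:
  assumes T: "supercharacter_theory G T" and f: "const_on (snd T) f"
  shows "class_function f"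
proof -
  obtain c where c: "\<forall>g\<in>carrier G. f g = (\<Sum>X\<in>fst T. c X * cnj (sigma_char G X g))"
    using sct_span[OF T f] by blast
  have "sigma_char G X (g \<otimes> h \<otimes> inv g) = sigma_char G X h"
    if "X \<in> fst T" "g \<in> carrier G" "h \<in> carrier G" for X g h
    using sigma_class_function partition_block_subset[OF sctD(1)[OF T]] that by (simp add: class_function_def)
  then show ?thesis
    using c by (simp add: class_function_def)
qed

lemma sct_Omega_const:
  assumes T: "supercharacter_theory G T" and f: "const_on (snd T) f"
  shows "const_on (fst T) (\<Omega> f)"
proof -
  obtain c where c: "\<And>g. g \<in> carrier G \<Longrightarrow> f g = (\<Sum>X\<in>fst T. c X * cnj (sigma_char G X g))"
    using sct_span[OF T f] by blast
  show ?thesis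
    using lin_ext_sigma_combination[OF sctD(1)[OF T] c] unfolding const_on_def by simp
qed

lemma Omega_one:
  assumes "\<chi> \<in> Irr G"
  shows "\<Omega> (\<lambda>_. 1) \<chi> = (if \<chi> = trivial_char G then of_nat (card (carrier G)) else 0)"
proof -
  have "lin_ext G \<chi> (\<lambda>_. 1) = (\<Sum>g\<in>carrier G. \<chi> g * cnj (trivial_char G g))"
    by (simp add: lin_ext_def trivial_char_def)
  then show ?thesis
    using Irr_orthogonal[OF assms trivial_char_Irr] by (simp add: trivial_char_def)
qed

text \<open>The constant function \<open>1\<close> has a nonzero central character value only at the trivial
  character, so the trivial character shares its block with no other.\<close>

lemma sct_trivial_char:
  assumes T: "supercharacter_theory G T"
  shows "{trivial_char G} \<in> fst T"
proof -
  note b = block_of_mem[OF sctD(1)[OF T] trivial_char_Irr]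
  have "\<chi> = trivial_char G" if \<chi>: "\<chi> \<in> block_of (fst T) (trivial_char G)" for \<chi>
  proof (rule ccontr)
    assume ne: "\<chi> \<noteq> trivial_char G"
    have "\<chi> \<in> Irr G"
      using partition_block_subset[OF sctD(1)[OF T] b(1)] \<chi> by blast
    then have "\<Omega> (\<lambda>_. 1) \<chi> = 0"
      using Omega_one ne by simp
    moreover have "\<Omega> (\<lambda>_. 1) \<chi> = \<Omega> (\<lambda>_. 1) (trivial_char G)"
      using sct_Omega_const[OF T, of "\<lambda>_. 1"] b \<chi> unfolding const_on_def by blast
    ultimately show False
      using Omega_one[OF trivial_char_Irr] by simp
  qed
  then have "block_of (fst T) (trivial_char G) = {trivial_char G}"
    using b(2) by blast
  then show ?thesis
    using b(1) by simp
qed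

lemma conj_eq_one_iff: "g \<in> carrier G \<Longrightarrow> h \<in> carrier G \<Longrightarrow> g \<otimes> h \<otimes> inv g = \<one> \<longleftrightarrow> h = \<one>"
  by (metis inv_equality inv_inv inv_closed l_cancel_one m_closed r_inv r_one)

lemma sigma_Irr:
  assumes g: "g \<in> carrier G"
  shows "sigma_char G (Irr G) g = (if g = \<one> then of_nat (card (carrier G)) else 0)"
proof -
  have "class_function (hat {\<one>})"
    by (simp add: class_function_def hat_def conj_eq_one_iff)
  moreover have "lin_ext G \<chi> (hat {\<one>}) = \<chi> \<one>" for \<chi>
  proof -
    have "lin_ext G \<chi> (hat {\<one>}) = (\<Sum>g\<in>carrier G. if g = \<one> then \<chi> g else 0)"
      unfolding lin_ext_def by (intro sum.cong refl) (auto simp: hat_def)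
    then show ?thesis
      by simp
  qed
  ultimately have "hat {\<one>} g = cnj (sigma_char G (Irr G) g) / of_nat (card (carrier G))"
    using fourier_inversion[of "hat {\<one>}", OF _ g] by (simp add: cnj_sigma)
  then have "cnj (sigma_char G (Irr G) g) = (if g = \<one> then of_nat (card (carrier G)) else 0)"
    by (auto simp: hat_def split: if_splits)
  then have "cnj (cnj (sigma_char G (Irr G) g)) = (if g = \<one> then of_nat (card (carrier G)) else 0)"
    by simp
  then show ?thesis
    by simp
qed

text \<open>The sum of all \<open>sigma_char G X\<close> is the regular character, which separates the identity from all
  other elements.\<close>

lemma sct_one:
  assumes T: "supercharacter_theory G T"
  shows "{\<one>} \<in> snd T"
proof -
  note b = block_of_mem[OF sctD(2)[OF T] one_closed]
  have "x = \<one>" if x: "x \<in> block_of (snd T) \<one>" for x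
  proof -
    have xG: "x \<in> carrier G"
      using partition_block_subset[OF sctD(2)[OF T] b(1)] x by blast
    have "sigma_char G (Irr G) g = (\<Sum>X\<in>fst T. sigma_char G X g)" for g
      unfolding sigma_char_def by (rule sum_over_blocks[OF sctD(1)[OF T] finite_Irr, symmetric])
    moreover have "sigma_char G X x = sigma_char G X \<one>" if "X \<in> fst T" for X
      using sctD(4)[OF T that] b x unfolding const_on_def by blast
    ultimately have "sigma_char G (Irr G) x = sigma_char G (Irr G) \<one>"
      by (simp cong: sum.cong)
    then show ?thesis
      using sigma_Irr[OF xG] sigma_Irr[OF one_closed] by (simp split: if_splits)
  qed
  then have "block_of (snd T) \<one> = {\<one>}"
    using b(2) by blast
  then show ?thesis
    using b(1) by simp
qed

lemma sigma_const_coarser: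
  assumes T: "supercharacter_theory G T" and ref: "refines (Irr G) (fst T) P" and X: "X \<in> P"
  shows "const_on (snd T) (sigma_char G X)"
proof -
  have part: "partition_on X {Y \<in> fst T. Y \<subseteq> X}"
    using refines_obtains_subset[OF ref X] .
  have "partition_on (Irr G) P"
    using ref by (simp add: refines_def)
  then have "finite X"
    using X finite_subset[OF partition_block_subset finite_Irr] by simp
  then have sum: "sigma_char G X g = (\<Sum>Y\<in>{Y \<in> fst T. Y \<subseteq> X}. sigma_char G Y g)" for g
    unfolding sigma_char_def by (rule sum_over_blocks[OF part, symmetric])
  show ?thesis
    unfolding const_on_def sum
  proof (intro ballI sum.cong refl)
    fix B g h Y assume "B \<in> snd T" "g \<in> B" "h \<in> B" "Y \<in> {Y \<in> fst T. Y \<subseteq> X}"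
    then show "sigma_char G Y g = sigma_char G Y h"
      using sctD(4)[OF T, of Y] unfolding const_on_def by blast
  qed
qed

text \<open>The \<open>sigma_char\<close> of the coarser blocks are sums of those of the finer ones, and their conjugates span the indicators
  of the superclasses; this transfers refinement to the superclasses. In the other
  direction, the conjugate of \<open>sigma_char G X\<close> is constant on the superclasses of \<open>U\<close>, hence of \<open>T\<close>, and its central
  characters tell whether a character belongs to \<open>X\<close>.\<close>

lemma sct_refines_iff:
  assumes T: "supercharacter_theory G T" and U: "supercharacter_theory G U"
  shows "refines (Irr G) (fst T) (fst U) \<longleftrightarrow> refines (carrier G) (snd T) (snd U)"
proof
  assume ref: "refines (Irr G) (fst T) (fst U)"
  show "refines (carrier G) (snd T) (snd U)"
  proof (rule refines_if_hats_const[OF sctD(2)[OF T] sctD(2)[OF U]])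
    fix B assume B: "B \<in> snd U"
    obtain c where c: "\<And>g. g \<in> carrier G \<Longrightarrow> hat B g = (\<Sum>X\<in>fst U. c X * cnj (sigma_char G X g))"
      using sct_span[OF U hat_const_on_block[OF sctD(2)[OF U] B]] by blast
    show "const_on (snd T) (hat B)"
      unfolding const_on_def
    proof (intro ballI)
      fix C g h assume C: "C \<in> snd T" "g \<in> C" "h \<in> C"
      then have "g \<in> carrier G" "h \<in> carrier G"
        using partition_block_subset[OF sctD(2)[OF T]] by blast+
      moreover have "sigma_char G X g = sigma_char G X h" if "X \<in> fst U" for X
        using sigma_const_coarser[OF T ref that] C unfolding const_on_def by blast
      ultimately show "hat B g = hat B h"
        using c by (simp cong: sum.cong)
    qed
  qed
next
  assume ref: "refines (carrier G) (snd T) (snd U)"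
  show "refines (Irr G) (fst T) (fst U)"
  proof (rule refines_if_hats_const[OF sctD(1)[OF T] sctD(1)[OF U]])
    fix X assume X: "X \<in> fst U"
    let ?f = "\<lambda>g. cnj (sigma_char G X g)"
    have "const_on (snd U) ?f"
      using sctD(4)[OF U X] unfolding const_on_def by metis
    then have const: "const_on (fst T) (\<Omega> ?f)"
      by (intro sct_Omega_const[OF T] const_on_refines[OF ref])
    have val: "\<Omega> ?f \<chi> = (if \<chi> \<in> X then of_nat (card (carrier G)) else 0)" if \<chi>: "\<chi> \<in> Irr G" for \<chi>
    proof -
      note b = block_of_mem[OF sctD(1)[OF U] \<chi>]
      have "?f g = (\<Sum>Y\<in>fst U. (if Y = X then 1 else 0) * cnj (sigma_char G Y g))" for g
      proof -
        have "(\<Sum>Y\<in>fst U. (if Y = X then 1 else 0) * cnj (sigma_char G Y g)) =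
            (\<Sum>Y\<in>fst U. if Y = X then cnj (sigma_char G Y g) else 0)"
          by (intro sum.cong) auto
        then show ?thesis
          using X finite_elements[OF finite_Irr sctD(1)[OF U]] by simp
      qed
      then have "\<Omega> ?f \<chi> = (if block_of (fst U) \<chi> = X then 1 else 0) * of_nat (card (carrier G))"
        by (rule lin_ext_sigma_combination[OF sctD(1)[OF U] _ b])
      also have "block_of (fst U) \<chi> = X \<longleftrightarrow> \<chi> \<in> X"
        using block_of_eq[OF sctD(1)[OF U] X] b(2) by auto
      finally show ?thesis by simp
    qed
    show "const_on (fst T) (hat X)"
      unfolding const_on_def
    proof (intro ballI)
      fix Y \<chi> \<psi> assume Y: "Y \<in> fst T" and \<chi>: "\<chi> \<in> Y" and \<psi>: "\<psi> \<in> Y"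
      have "\<chi> \<in> Irr G" "\<psi> \<in> Irr G"
        using partition_block_subset[OF sctD(1)[OF T] Y] \<chi> \<psi> by blast+
      moreover have "\<Omega> ?f \<chi> = \<Omega> ?f \<psi>"
        using const Y \<chi> \<psi> unfolding const_on_def by blast
      ultimately have "\<chi> \<in> X \<longleftrightarrow> \<psi> \<in> X"
        using val[of \<chi>] val[of \<psi>] by (simp split: if_splits)
      then show "hat X \<chi> = hat X \<psi>"
        by (simp add: hat_def)
    qed
  qed
qed

lemma sct_antisym:
  assumes T: "supercharacter_theory G T" and U: "supercharacter_theory G U"
    and "refines (Irr G) (fst T) (fst U)" "refines (Irr G) (fst U) (fst T)"
  shows "T = U"
  using assms(3,4) sct_refines_iff[OF T U] sct_refines_iff[OF U T] by (auto intro!: prod_eqI dest: refines_asym)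

text \<open>The regular character vanishes off the identity, so omitting the trivial character leaves
  the value \<open>-1\<close> there.\<close>

lemma coarse_theory_sct:
  assumes nontriv: "carrier G \<noteq> {\<one>}"
  shows "supercharacter_theory G (coarse_theory G)"
proof -
  let ?t = "trivial_char G"
  obtain x where x: "x \<in> carrier G" "x \<noteq> \<one>"
    using nontriv one_closed by blast
  have I: "Irr G = insert ?t (Irr G - {?t})"
    using trivial_char_Irr by blast
  have sum: "sigma_char G (Irr G) g = 1 + sigma_char G (Irr G - {?t}) g" if "g \<in> carrier G" for g
    unfolding sigma_char_def using that
    by (subst I, subst sum.insert) (auto simp: trivial_char_def)
  have ne: "Irr G - {?t} \<noteq> {}"
  proof
    assume empty: "Irr G - {?t} = {}"
    have "sigma_char G (Irr G) x = 1"
      using sum[OF x(1)] unfolding empty by (simp add: sigma_char_def)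
    then show False
      using sigma_Irr[OF x(1)] x(2) by simp
  qed
  have "partition_on (Irr G) {{?t}, Irr G - {?t}}"
    using ne trivial_char_Irr by (auto intro!: partition_onI simp: disjnt_def)
  moreover have "partition_on (carrier G) {{\<one>}, carrier G - {\<one>}}"
    using x one_closed by (auto intro!: partition_onI simp: disjnt_def)
  moreover have "card {{?t}, Irr G - {?t}} = card {{\<one>}, carrier G - {\<one>}}"
  proof -
    have "{?t} \<noteq> Irr G - {?t}" "{\<one>} \<noteq> carrier G - {\<one>}"
      by auto
    then show ?thesis by simp
  qed
  moreover have "sigma_char G {?t} g = 1" if "g \<in> carrier G" for g
    using that by (simp add: sigma_char_def trivial_char_def)
  moreover have "sigma_char G (Irr G - {?t}) g = - 1" if "g \<in> carrier G - {\<one>}" for g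
    using sum[of g] sigma_Irr[of g] that by (simp add: add_eq_0_iff)
  ultimately show ?thesis
    unfolding coarse_theory_def supercharacter_theory_iff const_on_def by auto
qed

section \<open>Conjugacy classes\<close>

lemma conj_classes_eq:
  "conj_classes G = (\<lambda>x. (\<lambda>g. g \<otimes> x \<otimes> inv g) ` carrier G) ` carrier G"
  unfolding conj_classes_def orbits_def orbit_def by (auto simp: image_iff)

lemma conj_comp:
  "g \<in> carrier G \<Longrightarrow> h \<in> carrier G \<Longrightarrow> x \<in> carrier G \<Longrightarrow>
    g \<otimes> (h \<otimes> x \<otimes> inv h) \<otimes> inv g = (g \<otimes> h) \<otimes> x \<otimes> inv (g \<otimes> h)"
  by (simp add: inv_mult_group m_assoc)

lemma conj_inv_cancel:
  "g \<in> carrier G \<Longrightarrow> x \<in> carrier G \<Longrightarrow> inv g \<otimes> (g \<otimes> x \<otimes> inv g) \<otimes> inv (inv g) = x"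
  by (subst conj_comp) auto

lemma conj_class_closed:
  assumes C: "C \<in> conj_classes G" and x: "x \<in> C" and g: "g \<in> carrier G"
  shows "g \<otimes> x \<otimes> inv g \<in> C"
proof -
  obtain y where y: "y \<in> carrier G" "C = (\<lambda>g. g \<otimes> y \<otimes> inv g) ` carrier G"
    using C unfolding conj_classes_eq by blast
  obtain h where h: "h \<in> carrier G" "x = h \<otimes> y \<otimes> inv h"
    using x unfolding y(2) by blast
  have "g \<otimes> x \<otimes> inv g = (g \<otimes> h) \<otimes> y \<otimes> inv (g \<otimes> h)"
    unfolding h(2) by (rule conj_comp[OF g h(1) y(1)])
  then show ?thesis
    unfolding y(2) using m_closed[OF g h(1)] by (rule image_eqI)
qed

lemma conj_class_eq:
  assumes C: "C \<in> conj_classes G" and x: "x \<in> C"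
  shows "C = (\<lambda>g. g \<otimes> x \<otimes> inv g) ` carrier G"
proof
  obtain y where y: "y \<in> carrier G" "C = (\<lambda>g. g \<otimes> y \<otimes> inv g) ` carrier G"
    using C unfolding conj_classes_eq by blast
  obtain h where h: "h \<in> carrier G" "x = h \<otimes> y \<otimes> inv h"
    using x unfolding y(2) by blast
  have y': "y = inv h \<otimes> x \<otimes> inv (inv h)"
    unfolding h(2) using conj_inv_cancel[OF h(1) y(1)] by simp
  show "C \<subseteq> (\<lambda>g. g \<otimes> x \<otimes> inv g) ` carrier G"
  proof
    fix z assume "z \<in> C"
    then obtain g where g: "g \<in> carrier G" "z = g \<otimes> y \<otimes> inv g"
      unfolding y(2) by blast
    have xG: "x \<in> carrier G"
      using h y by simp
    have "z = (g \<otimes> inv h) \<otimes> x \<otimes> inv (g \<otimes> inv h)"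
      unfolding g(2) y' using conj_comp[OF g(1) inv_closed[OF h(1)] xG] .
    then show "z \<in> (\<lambda>g. g \<otimes> x \<otimes> inv g) ` carrier G"
      using g(1) h(1) by blast
  qed
  show "(\<lambda>g. g \<otimes> x \<otimes> inv g) ` carrier G \<subseteq> C"
    using conj_class_closed[OF C x] by blast
qed

lemma conj_classes_partition: "partition_on (carrier G) (conj_classes G)"
proof (rule partition_onI)
  show "\<Union>(conj_classes G) = carrier G"
  proof
    show "\<Union>(conj_classes G) \<subseteq> carrier G"
      unfolding conj_classes_eq by auto
    show "carrier G \<subseteq> \<Union>(conj_classes G)"
    proof
      fix x assume x: "x \<in> carrier G"
      then have "x = \<one> \<otimes> x \<otimes> inv \<one>"
        by simp
      then have "x \<in> (\<lambda>g. g \<otimes> x \<otimes> inv g) ` carrier G"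
        by blast
      then show "x \<in> \<Union>(conj_classes G)"
        unfolding conj_classes_eq using x by blast
    qed
  qed
  show "disjnt C D" if "C \<in> conj_classes G" "D \<in> conj_classes G" "C \<noteq> D" for C D
    using that conj_class_eq unfolding disjnt_def by blast
  show "{} \<notin> conj_classes G"
    using one_closed unfolding conj_classes_eq by blast
qed

lemma class_function_hatI:
  assumes "\<And>g h. g \<in> carrier G \<Longrightarrow> h \<in> S \<Longrightarrow> g \<otimes> h \<otimes> inv g \<in> S"
  shows "class_function (hat S)"
  unfolding class_function_def
proof (intro ballI)
  fix g h assume gh: "g \<in> carrier G" "h \<in> carrier G"
  have "g \<otimes> h \<otimes> inv g \<in> S \<longleftrightarrow> h \<in> S"
    using assms[of "inv g" "g \<otimes> h \<otimes> inv g"] assms[of g h] gh conj_inv_cancel[OF gh] by auto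
  then show "hat S (g \<otimes> h \<otimes> inv g) = hat S h"
    by (simp add: hat_def)
qed

lemma G_invariant_iff: "G_invariant G S \<longleftrightarrow> S \<subseteq> carrier G \<and> class_function (hat S)"
proof
  assume "G_invariant G S"
  then obtain \<C> where \<C>: "\<C> \<subseteq> conj_classes G" "S = \<Union>\<C>"
    by (auto simp: G_invariant_def)
  have "class_function (hat S)"
    using \<C> conj_class_closed by (intro class_function_hatI) blast
  then show "S \<subseteq> carrier G \<and> class_function (hat S)"
    using \<C> partition_onD1[OF conj_classes_partition] by blast
next
  assume S: "S \<subseteq> carrier G \<and> class_function (hat S)"
  have closed: "g \<otimes> x \<otimes> inv g \<in> S" if "g \<in> carrier G" "x \<in> S" for g x
  proof -
    have "hat S (g \<otimes> x \<otimes> inv g) = hat S x"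
      using S that by (auto simp: class_function_def)
    then show ?thesis
      using that by (simp add: hat_def split: if_splits)
  qed
  have S_eq: "S = \<Union>{C \<in> conj_classes G. C \<subseteq> S}"
  proof
    show "S \<subseteq> \<Union>{C \<in> conj_classes G. C \<subseteq> S}"
    proof
      fix x assume x: "x \<in> S"
      then obtain C where C: "C \<in> conj_classes G" "x \<in> C"
        using S partition_onD1[OF conj_classes_partition] by blast
      then have "C \<subseteq> S"
        using conj_class_eq[OF C] closed x by blast
      then show "x \<in> \<Union>{C \<in> conj_classes G. C \<subseteq> S}"
        using C by blast
    qed
  qed blast
  show "G_invariant G S"
    unfolding G_invariant_def by (intro exI conjI, rule Collect_subset, rule S_eq)
qed

lemma conj_classes_disjoint_count:
  assumes S: "S \<subseteq> carrier G - {\<one>}" and S': "S' \<subseteq> carrier G - {\<one>}" and disj: "S \<inter> S' = {}"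
  shows "card {C \<in> conj_classes G. C \<subseteq> S} + card {C \<in> conj_classes G. C \<subseteq> S'} \<le> card (conj_classes G - {{\<one>}})"
proof -
  have fin: "finite (conj_classes G)"
    by (rule finite_elements[OF fin conj_classes_partition])
  have ne: "C \<noteq> {}" if "C \<in> conj_classes G" for C
    using partition_onD3[OF conj_classes_partition] that by blast
  have "{C \<in> conj_classes G. C \<subseteq> S} \<inter> {C \<in> conj_classes G. C \<subseteq> S'} = {}"
    using disj ne by blast
  then have "card {C \<in> conj_classes G. C \<subseteq> S} + card {C \<in> conj_classes G. C \<subseteq> S'} =
      card ({C \<in> conj_classes G. C \<subseteq> S} \<union> {C \<in> conj_classes G. C \<subseteq> S'})"
    using fin by (intro card_Un_disjoint[symmetric]) auto
  also have "\<dots> \<le> card (conj_classes G - {{\<one>}})"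
    using fin S S' by (intro card_mono) auto
  finally show ?thesis .
qed

section \<open>The alternating sequence\<close>

lemma cl_part_0: "cl_part G S 0 = {S}"
  by (simp add: cl_part_def)

lemma cl_part_Suc: "cl_part G S (Suc n) = ClPt G (ir_part G S n)"
  by (simp add: cl_part_def ir_part_def)

lemma ir_part_partition: "partition_on (Irr G) (ir_part G S n)"
  unfolding ir_part_def by (rule IrPt_partition)

lemma cl_part_partition: "partition_on (carrier G) (cl_part G S (Suc n))"
  unfolding cl_part_Suc by (rule ClPt_partition)

lemma ir_part_const: "B \<in> cl_part G S n \<Longrightarrow> const_on (ir_part G S n) (\<Omega> (hat B))"
  unfolding ir_part_def IrPt_fibre by (rule fibre_const_on)

lemma cl_part_const: "X \<in> ir_part G S n \<Longrightarrow> const_on (cl_part G S (Suc n)) (sigma_char G X)"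
  unfolding cl_part_Suc ClPt_fibre by (rule fibre_const_on)

lemma ClPt_class_function:
  assumes \<X>: "\<And>X. X \<in> \<X> \<Longrightarrow> X \<subseteq> Irr G" and B: "B \<in> ClPt G \<X>"
  shows "class_function (hat B)"
proof (rule class_function_hatI)
  fix g h assume g: "g \<in> carrier G" and h: "h \<in> B"
  obtain x where x: "x \<in> carrier G" "B = fibre_rel (carrier G) \<X> (sigma_char G) `` {x}"
    using B unfolding ClPt_fibre quotient_def by blast
  have hG: "h \<in> carrier G"
    using h unfolding x(2) fibre_rel_def by blast
  have "sigma_char G X (g \<otimes> h \<otimes> inv g) = sigma_char G X h" if "X \<in> \<X>" for X
    using sigma_class_function[OF \<X>[OF that]] g hG by (simp add: class_function_def)
  then show "g \<otimes> h \<otimes> inv g \<in> B"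
    using h g hG unfolding x(2) fibre_rel_def by simp
qed

lemma cl_part_class_function:
  assumes S: "class_function (hat S)" and B: "B \<in> cl_part G S n"
  shows "class_function (hat B)"
proof (cases n)
  case 0
  then show ?thesis
    using B S by (simp add: cl_part_0)
next
  case (Suc m)
  show ?thesis
    by (rule ClPt_class_function[OF partition_block_subset[OF ir_part_partition] B[unfolded Suc cl_part_Suc]])
qed

text \<open>The central characters of \<open>B\<close> are constant on the blocks of \<open>ir_part G S n\<close>, so by Fourier inversion \<open>hat B\<close> is a combination of
  the characters whose common level sets are the blocks of the next partition.\<close>

lemma hat_const_on_next:
  assumes S: "class_function (hat S)" and B: "B \<in> cl_part G S n"
  shows "const_on (cl_part G S (Suc n)) (hat B)"
proof -
  obtain c where c: "\<forall>g\<in>carrier G. hat B g = (\<Sum>X\<in>ir_part G S n. c X * cnj (sigma_char G X g))"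
    using fourier_inversion_blocks[OF ir_part_partition cl_part_class_function[OF S B] ir_part_const[OF B]] by blast
  show ?thesis
    unfolding const_on_def
  proof (intro ballI)
    fix C g h assume C: "C \<in> cl_part G S (Suc n)" "g \<in> C" "h \<in> C"
    have "g \<in> carrier G" "h \<in> carrier G"
      using partition_block_subset[OF cl_part_partition C(1)] C by blast+
    moreover have "sigma_char G X g = sigma_char G X h" if "X \<in> ir_part G S n" for X
      using cl_part_const[OF that] C unfolding const_on_def by blast
    ultimately show "hat B g = hat B h"
      using c by (simp cong: sum.cong)
  qed
qed

lemma hat_const_on_cl_part:
  assumes S: "class_function (hat S)"
  shows "const_on (cl_part G S (Suc n)) (hat S)"
proof (induction n)
  case 0
  show ?case
    by (rule hat_const_on_next[OF S]) (simp add: cl_part_0)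
next
  case (Suc n)
  have "refines (carrier G) (cl_part G S (Suc (Suc n))) (cl_part G S (Suc n))"
    by (rule refines_if_hats_const[OF cl_part_partition cl_part_partition hat_const_on_next[OF S]])
  then show ?case
    by (rule const_on_refines[OF _ Suc])
qed

text \<open>Both partition maps preserve the property of being coarser than a given supercharacter theory.\<close>

lemma sct_refines_sequence:
  assumes T: "supercharacter_theory G T" and S: "const_on (snd T) (hat S)"
  shows "refines (Irr G) (fst T) (ir_part G S n)"
    and "refines (carrier G) (snd T) (cl_part G S (Suc n))"
proof -
  have ir: "refines (Irr G) (fst T) (ir_part G S n)"
    if "\<And>B. B \<in> cl_part G S n \<Longrightarrow> const_on (snd T) (hat B)" for n
    unfolding ir_part_def IrPt_fibre
    using sct_Omega_const[OF T that] by (rule refines_fibre[OF sctD(1)[OF T]])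
  have cl: "refines (carrier G) (snd T) (cl_part G S (Suc n))"
    if "refines (Irr G) (fst T) (ir_part G S n)" for n
    unfolding cl_part_Suc ClPt_fibre
    using sigma_const_coarser[OF T that] by (rule refines_fibre[OF sctD(2)[OF T]])
  have hat: "const_on (snd T) (hat B)" if "B \<in> cl_part G S n" for B n
    using that
  proof (induction n arbitrary: B)
    case 0
    then show ?case
      using S by (simp add: cl_part_0)
  next
    case (Suc n)
    show ?case
      by (rule const_on_refines[OF cl[OF ir[OF Suc.IH]] hat_const_on_block[OF cl_part_partition Suc.prems]])
  qed
  show "refines (Irr G) (fst T) (ir_part G S n)"
    by (rule ir[OF hat])
  then show "refines (carrier G) (snd T) (cl_part G S (Suc n))"
    by (rule cl)
qed

text \<open>\<open>S\<close> lies inside a block, because \<open>T\<close> is finer than the sequence, and is a union of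
  blocks.\<close>

lemma superclass_in_cl_part:
  assumes T: "supercharacter_theory G T" and S: "S \<in> snd T"
  shows "S \<in> cl_part G S (Suc n)"
proof -
  have hat: "const_on (snd T) (hat S)"
    by (rule hat_const_on_block[OF sctD(2)[OF T] S])
  obtain x where x: "x \<in> S"
    using partition_block_nonempty[OF sctD(2)[OF T] S] by blast
  obtain B where B: "B \<in> cl_part G S (Suc n)" "S \<subseteq> B"
    using sct_refines_sequence(2)[OF T hat] S unfolding refines_def by blast
  have "B \<subseteq> S"
    using hat_const_onD[OF hat_const_on_cl_part[OF sct_class_function[OF T hat]] B(1)] x B(2) by blast
  then show ?thesis
    using B by (metis subset_antisym)
qed

text \<open>The number of blocks of entry number \<open>m\<close> of the alternating sequence, which starts with a partition of \<open>Irr G\<close>.\<close>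

definition seq_card :: "'a set \<Rightarrow> nat \<Rightarrow> nat" where
  "seq_card S m = (if even m then card (ir_part G S (m div 2)) else card (cl_part G S (Suc (m div 2))))"

lemma seq_card_mono:
  assumes S: "class_function (hat S)"
  shows "seq_card S m \<le> seq_card S (Suc m)"
proof (cases "even m")
  case True
  then show ?thesis
    using card_le_if_sigma_const[OF ir_part_partition cl_part_partition cl_part_const]
    by (simp add: seq_card_def)
next
  case False
  then have "Suc m div 2 = Suc (m div 2)"
    by presburger
  then show ?thesis
    using False card_le_if_hat_const[OF ir_part_partition cl_part_partition cl_part_class_function[OF S] ir_part_const]
    by (simp add: seq_card_def)
qed

lemma seq_card_stationary:
  assumes S: "class_function (hat S)"
  shows "\<exists>m. seq_card S m = seq_card S (Suc m)"
proof (rule ccontr)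
  assume "\<nexists>m. seq_card S m = seq_card S (Suc m)"
  then have less: "seq_card S m < seq_card S (Suc m)" for m
    using seq_card_mono[OF S, of m] by (meson le_neq_implies_less)
  have ge: "m \<le> seq_card S m" for m
  proof (induction m)
    case (Suc m)
    then show ?case
      using less[of m] by linarith
  qed simp
  have bound: "seq_card S m \<le> card (Irr G) + card (carrier G)" for m
    using card_partition_le[OF ir_part_partition finite_Irr] card_partition_le[OF cl_part_partition fin]
    by (auto simp: seq_card_def trans_le_add1 trans_le_add2)
  show False
    using ge[of "Suc (card (Irr G) + card (carrier G))"] bound[of "Suc (card (Irr G) + card (carrier G))"]
    by linarith
qed

lemma consecutive_pair_cards:
  "card (fst (consecutive_pair G S m)) = card (snd (consecutive_pair G S m)) \<longleftrightarrow>
    seq_card S m = seq_card S (Suc m)"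
proof (cases "even m")
  case True
  then show ?thesis
    by (auto simp: consecutive_pair_def seq_card_def)
next
  case False
  then have "Suc m div 2 = Suc (m div 2)"
    by presburger
  then show ?thesis
    using False by (auto simp: consecutive_pair_def seq_card_def)
qed

lemma stabilizes_if_in_cl_part:
  assumes S: "class_function (hat S)" and mem: "\<And>n. S \<in> cl_part G S (Suc n)"
  shows "stabilizes G S"
proof -
  obtain m where "seq_card S m = seq_card S (Suc m)"
    using seq_card_stationary[OF S] by blast
  moreover have "S \<in> cl_part G S j" if "j \<in> {1..m div 2 + 1}" for j
    using mem[of "j - 1"] that by simp
  ultimately show ?thesis
    unfolding stabilizes_def stabilizes_at_def consecutive_pair_cards by blast
qed

text \<open>If the later of the two partitions is the one of \<open>G\<close>, then the characters \<open>sigma_char G X\<close> are constant on its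
  blocks by construction; otherwise this follows from the equality of the two cardinalities.\<close>

lemma stabilizes_at_theory:
  assumes S: "class_function (hat S)" and st: "stabilizes_at G S m"
  shows "supercharacter_theory G (consecutive_pair G S m)" "S \<in> snd (consecutive_pair G S m)"
proof -
  show "S \<in> snd (consecutive_pair G S m)"
    using st by (simp add: stabilizes_at_def consecutive_pair_def)
  have card: "card (fst (consecutive_pair G S m)) = card (snd (consecutive_pair G S m))"
    using st by (simp add: stabilizes_at_def)
  have "const_on (cl_part G S (Suc (m div 2))) (sigma_char G X)" if X: "X \<in> ir_part G S ((m + 1) div 2)" for X
  proof (cases "even m")
    case True
    then show ?thesis
      using X cl_part_const by simp
  next
    case False
    then have eq: "(m + 1) div 2 = Suc (m div 2)"
      by presburger
    have card': "card (ir_part G S (Suc (m div 2))) = card (cl_part G S (Suc (m div 2)))"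
      using card unfolding consecutive_pair_def eq by simp
    show ?thesis
      by (rule sigma_const_if_hat_const[OF ir_part_partition cl_part_partition cl_part_class_function[OF S] ir_part_const
            card' X[unfolded eq]])
  qed
  then show "supercharacter_theory G (consecutive_pair G S m)"
    using card cl_part_partition ir_part_partition unfolding consecutive_pair_def supercharacter_theory_iff by simp
qed

lemma theory_of_sct:
  assumes S: "class_function (hat S)" and st: "stabilizes G S"
  shows "supercharacter_theory G (theory_of G S)" "S \<in> snd (theory_of G S)"
proof -
  have "stabilizes_at G S (LEAST m. stabilizes_at G S m)"
    using st unfolding stabilizes_def by (rule LeastI_ex)
  then show "supercharacter_theory G (theory_of G S)" "S \<in> snd (theory_of G S)"
    unfolding theory_of_def using stabilizes_at_theory[OF S] by blast+
qed

lemma theory_of_coarsest: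
  assumes "supercharacter_theory G T" and "const_on (snd T) (hat S)"
  shows "refines (Irr G) (fst T) (fst (theory_of G S))"
  unfolding theory_of_def consecutive_pair_def using sct_refines_sequence(1)[OF assms] by simp

section \<open>The algorithm\<close>

lemma candidatesD:
  assumes "S \<in> candidates G"
  shows "S \<noteq> {}" "S \<subseteq> carrier G - {\<one>}" "class_function (hat S)"
  using assms by (auto simp: candidates_def G_invariant_iff)

lemma SCT_simps [simp]:
  "carrier (SCT G) = {T. supercharacter_theory G T}"
  "le (SCT G) T U \<longleftrightarrow> refines (Irr G) (fst T) (fst U)"
  by (simp_all add: SCT_def)

lemma superclass_candidate:
  assumes T: "supercharacter_theory G T" and S: "S \<in> snd T" "S \<noteq> {\<one>}"
    and small: "2 * card {C \<in> conj_classes G. C \<subseteq> S} \<le> card (conj_classes G - {{\<one>}})"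
  shows "S \<in> candidates G"
proof -
  have P: "partition_on (carrier G) (snd T)"
    by (rule sctD(2)[OF T])
  have "class_function (hat S)"
    by (rule sct_class_function[OF T hat_const_on_block[OF P S(1)]])
  moreover have "\<one> \<notin> S"
    using block_of_eq[OF P S(1)] block_of_eq[OF P sct_one[OF T]] S(2) by blast
  moreover have "S \<subseteq> carrier G" "S \<noteq> {}"
    using partition_block_subset[OF P S(1)] partition_block_nonempty[OF P S(1)] by auto
  ultimately show ?thesis
    using small by (auto simp: candidates_def G_invariant_iff)
qed

text \<open>Two disjoint sets cannot both contain more than half of the nontrivial classes.\<close>

lemma noncandidate_superclass_unique:
  assumes T: "supercharacter_theory G T" and S: "S \<in> snd T - {{\<one>}} - candidates G"
    and S': "S' \<in> snd T - {{\<one>}} - candidates G"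
  shows "S = S'"
proof (rule ccontr)
  assume ne: "S \<noteq> S'"
  have P: "partition_on (carrier G) (snd T)"
    by (rule sctD(2)[OF T])
  have sub: "B \<subseteq> carrier G - {\<one>}" if "B \<in> snd T - {{\<one>}}" for B
    using partition_block_subset[OF P, of B] block_of_eq[OF P, of B \<one>] block_of_eq[OF P sct_one[OF T], of \<one>] that
    by auto
  have "S \<inter> S' = {}"
    using partition_onD2[OF P] S S' ne by (auto dest: disjointD)
  then have "card {C \<in> conj_classes G. C \<subseteq> S} + card {C \<in> conj_classes G. C \<subseteq> S'} \<le> card (conj_classes G - {{\<one>}})"
    using conj_classes_disjoint_count[OF sub sub] S S' by blast
  moreover have "\<not> 2 * card {C \<in> conj_classes G. C \<subseteq> S} \<le> card (conj_classes G - {{\<one>}})"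
    using superclass_candidate[OF T, of S] S by blast
  moreover have "\<not> 2 * card {C \<in> conj_classes G. C \<subseteq> S'} \<le> card (conj_classes G - {{\<one>}})"
    using superclass_candidate[OF T, of S'] S' by blast
  ultimately show False
    by linarith
qed

lemma sct_two_superclasses:
  assumes T: "supercharacter_theory G T" and K: "snd T = {{\<one>}, R}" "R \<noteq> {\<one>}"
  shows "T = coarse_theory G"
proof -
  have P: "partition_on (carrier G) (snd T)" and X: "partition_on (Irr G) (fst T)"
    using sctD(1,2)[OF T] by auto
  have "\<one> \<notin> R"
    using block_of_eq[OF P, of R \<one>] block_of_eq[OF P, of "{\<one>}" \<one>] K by auto
  then have R: "R = carrier G - {\<one>}"
    using partition_onD1[OF P] K by auto
  have "card (fst T) = 2"
    using sctD(3)[OF T] K by simp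
  then have "card (fst T - {{trivial_char G}}) = 1"
    using sct_trivial_char[OF T] by (simp add: card_Diff_singleton)
  then obtain Y where "fst T - {{trivial_char G}} = {Y}"
    using card_1_singletonE by blast
  then have Y: "fst T = {{trivial_char G}, Y}" "Y \<noteq> {trivial_char G}"
    using sct_trivial_char[OF T] by blast+
  have "trivial_char G \<notin> Y"
    using block_of_eq[OF X, of Y "trivial_char G"] block_of_eq[OF X, of "{trivial_char G}" "trivial_char G"] Y by auto
  then have "Y = Irr G - {trivial_char G}"
    using partition_onD1[OF X] Y by auto
  then show ?thesis
    using Y K R by (simp add: coarse_theory_def prod_eq_iff)
qed

lemma theory_of_superclass:
  assumes T: "supercharacter_theory G T" and S: "S \<in> snd T" "S \<in> candidates G"
  shows "theory_of G S \<in> step1 G" "refines (Irr G) (fst T) (fst (theory_of G S))"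
    "supercharacter_theory G (theory_of G S)" "S \<in> snd (theory_of G S)"
proof -
  have st: "stabilizes G S"
    using stabilizes_if_in_cl_part[OF candidatesD(3)[OF S(2)]] superclass_in_cl_part[OF T S(1)] .
  then show "theory_of G S \<in> step1 G"
    using S unfolding step1_def by blast
  show "refines (Irr G) (fst T) (fst (theory_of G S))"
    by (rule theory_of_coarsest[OF T hat_const_on_block[OF sctD(2)[OF T] S(1)]])
  show "supercharacter_theory G (theory_of G S)" "S \<in> snd (theory_of G S)"
    using theory_of_sct[OF candidatesD(3)[OF S(2)] st] by auto
qed

text \<open>A lower bound of the theories of the candidate superclasses has all candidate superclasses,
  and \<open>{\<one>}\<close>, as unions of its superclasses; at most one superclass of \<open>T\<close> is left,
  and it is the complement of their union.\<close>

lemma sct_is_meet: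
  assumes T: "supercharacter_theory G T"
  shows "greatest (SCT G) T (Lower (SCT G) (theory_of G ` (snd T \<inter> candidates G)))"
  unfolding greatest_def
proof (intro conjI ballI)
  let ?A = "theory_of G ` (snd T \<inter> candidates G)"
  have P: "partition_on (carrier G) (snd T)"
    by (rule sctD(2)[OF T])
  show "Lower (SCT G) ?A \<subseteq> carrier (SCT G)"
    by (rule Lower_closed)
  show "T \<in> Lower (SCT G) ?A"
    using T theory_of_superclass(2)[OF T] by (intro Lower_memI) auto
  fix U assume U: "U \<in> Lower (SCT G) ?A"
  have sub: "?A \<subseteq> carrier (SCT G)"
    using theory_of_superclass(3)[OF T] by auto
  have low: "supercharacter_theory G U" "\<And>V. V \<in> ?A \<Longrightarrow> refines (Irr G) (fst U) (fst V)"
    using U Lower_closed[of "SCT G" ?A] Lower_memD[OF U _ sub] unfolding SCT_simps by blast+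
  have QU: "partition_on (carrier G) (snd U)"
    by (rule sctD(2)[OF low(1)])
  have cand: "const_on (snd U) (hat B)" if B: "B \<in> snd T" "B \<in> candidates G" for B
  proof -
    have "refines (carrier G) (snd U) (snd (theory_of G B))"
      using sct_refines_iff[OF low(1) theory_of_superclass(3)[OF T B]] low(2) B by blast
    then show ?thesis
      by (rule const_on_refines)
        (rule hat_const_on_block[OF sctD(2)[OF theory_of_superclass(3)[OF T B]] theory_of_superclass(4)[OF T B]])
  qed
  have good: "const_on (snd U) (hat B)" if "B \<in> snd T" "B = {\<one>} \<or> B \<in> candidates G" for B
    using cand[of B] hat_const_on_block[OF QU sct_one[OF low(1)]] that by blast
  have "const_on (snd U) (hat B)" if B: "B \<in> snd T" for B
  proof (cases "B = {\<one>} \<or> B \<in> candidates G")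
    case True
    then show ?thesis
      by (rule good[OF B])
  next
    case False
    have "C \<subseteq> B" if C: "C \<in> snd U" and x: "x \<in> C" "x \<in> B" for C x
    proof
      fix y assume y: "y \<in> C"
      then have yG: "y \<in> carrier G"
        using partition_block_subset[OF QU C] by blast
      note b = block_of_mem[OF P yG]
      show "y \<in> B"
      proof (rule ccontr)
        assume "y \<notin> B"
        then have ne: "block_of (snd T) y \<noteq> B"
          using b(2) by blast
        then have "const_on (snd U) (hat (block_of (snd T) y))"
          using good[OF b(1)] noncandidate_superclass_unique[OF T, of B "block_of (snd T) y"] B b(1) False by blast
        then have "C \<subseteq> block_of (snd T) y"
          using hat_const_onD C y b(2) by metis
        then have "block_of (snd T) x = block_of (snd T) y"
          using x block_of_eq[OF P b(1)] by blast
        then show False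
          using block_of_eq[OF P B x(2)] ne by simp
      qed
    qed
    then show ?thesis
      unfolding const_on_def hat_def by (metis subsetD)
  qed
  then have "refines (carrier G) (snd U) (snd T)"
    by (rule refines_if_hats_const[OF QU P])
  then show "le (SCT G) U T"
    using sct_refines_iff[OF low(1) T] by simp
qed

lemma candidate_superclass_exists:
  assumes T: "supercharacter_theory G T" and nontriv: "carrier G \<noteq> {\<one>}" and ne: "T \<noteq> coarse_theory G"
  shows "snd T \<inter> candidates G \<noteq> {}"
proof
  assume empty: "snd T \<inter> candidates G = {}"
  have P: "partition_on (carrier G) (snd T)"
    by (rule sctD(2)[OF T])
  obtain x where x: "x \<in> carrier G" "x \<noteq> \<one>"
    using nontriv one_closed by blast
  define R where "R = block_of (snd T) x"
  have R: "R \<in> snd T" "x \<in> R"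
    using block_of_mem[OF P x(1)] by (auto simp: R_def)
  then have R1: "R \<noteq> {\<one>}"
    using x(2) by blast
  have "B = R" if "B \<in> snd T" "B \<noteq> {\<one>}" for B
    using noncandidate_superclass_unique[OF T, of B R] that R R1 empty by blast
  then have "snd T = {{\<one>}, R}"
    using sct_one[OF T] R(1) by blast
  then show False
    using sct_two_superclasses[OF T _ R1] ne by blast
qed

text \<open>The second step forms meets of at least two theories. If \<open>T\<close> has only one
  candidate superclass \<open>S\<close>, or if all of them give the same theory, then \<open>T\<close> is already \<open>theory_of G S\<close>.\<close>

lemma sct_in_step2:
  assumes T: "supercharacter_theory G T" and nontriv: "carrier G \<noteq> {\<one>}" and ne: "T \<noteq> coarse_theory G"
  shows "T \<in> step2 G (step1 G)"
proof -
  define A where "A = theory_of G ` (snd T \<inter> candidates G)"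
  have meet: "greatest (SCT G) T (Lower (SCT G) A)"
    unfolding A_def by (rule sct_is_meet[OF T])
  have fin: "finite A"
    unfolding A_def using finite_elements[OF fin sctD(2)[OF T]] by simp
  have sub: "A \<subseteq> step1 G"
    unfolding A_def using theory_of_superclass(1)[OF T] by blast
  have "A \<noteq> {}"
    unfolding A_def using candidate_superclass_exists[OF assms] by blast
  then have "card A \<noteq> 0"
    using fin by simp
  then consider "card A = 1" | "2 \<le> card A"
    by linarith
  then show ?thesis
  proof cases
    case 1
    then obtain V where V: "A = {V}"
      using card_1_singletonE by blast
    then obtain S where S: "S \<in> snd T" "S \<in> candidates G" "V = theory_of G S"
      unfolding A_def by blast
    have sV: "supercharacter_theory G V"
      unfolding S(3) by (rule theory_of_superclass(3)[OF T S(1,2)])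
    then have "V \<in> Lower (SCT G) A"
      unfolding V using sctD(1)[OF sV] by (intro Lower_memI) (auto intro: refines_refl)
    then have "refines (Irr G) (fst V) (fst T)"
      using meet unfolding greatest_def by simp
    moreover have "refines (Irr G) (fst T) (fst V)"
      unfolding S(3) by (rule theory_of_superclass(2)[OF T S(1,2)])
    ultimately have "T = V"
      using sct_antisym[OF T sV] by blast
    then show ?thesis
      using sub V unfolding step2_def by blast
  next
    case 2
    then show ?thesis
      using meet fin sub unfolding step2_def by blast
  qed
qed

lemma steps_sct:
  assumes "carrier G \<noteq> {\<one>}"
  shows "step3 G (step2 G (step1 G)) \<subseteq> {T. supercharacter_theory G T}"
proof -
  have "step1 G \<subseteq> {T. supercharacter_theory G T}"
    unfolding step1_def using theory_of_sct(1) candidatesD(3) by blast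
  moreover have "supercharacter_theory G T" if "greatest (SCT G) T (Lower (SCT G) A)" for T A
    using that Lower_closed[of "SCT G" A] unfolding greatest_def by auto
  ultimately show ?thesis
    unfolding step3_def step2_def using coarse_theory_sct[OF assms] by blast
qed

end

theorem mainTheorem4:
  fixes G :: "('a, 'm) monoid_scheme" (structure)
  assumes "group G" and "finite (carrier G)" and "carrier G \<noteq> {\<one>}"
  shows "(\<forall>S\<in>candidates G.
            ((\<exists>n\<ge>1. S \<notin> ((ClPt G \<circ> IrPt G) ^^ n) {S}) \<or> stabilizes G S) \<and>
            (stabilizes G S \<longrightarrow>
               greatest (SCT G) (theory_of G S) {T. supercharacter_theory G T \<and> S \<in> snd T})) \<and>
         step3 G (step2 G (step1 G)) = {T. supercharacter_theory G T}"
proof -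
  interpret fin_group G
    using assms by (intro fin_group.intro fin_group_axioms.intro)
  have "(\<exists>n\<ge>1. S \<notin> ((ClPt G \<circ> IrPt G) ^^ n) {S}) \<or> stabilizes G S" if S: "S \<in> candidates G" for S
  proof (rule disjCI)
    assume "\<not> stabilizes G S"
    then obtain n where "S \<notin> cl_part G S (Suc n)"
      using stabilizes_if_in_cl_part[OF candidatesD(3)[OF S]] by blast
    then show "\<exists>n\<ge>1. S \<notin> ((ClPt G \<circ> IrPt G) ^^ n) {S}"
      unfolding cl_part_def by (intro exI[of _ "Suc n"]) simp
  qed
  moreover have "greatest (SCT G) (theory_of G S) {T. supercharacter_theory G T \<and> S \<in> snd T}"
    if S: "S \<in> candidates G" and st: "stabilizes G S" for S
    using theory_of_sct[OF candidatesD(3)[OF S] st] theory_of_coarsest hat_const_on_block[OF sctD(2)]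
    unfolding greatest_def by auto
  moreover have "step3 G (step2 G (step1 G)) = {T. supercharacter_theory G T}"
    using steps_sct[OF assms(3)] sct_in_step2[OF _ assms(3)] unfolding step3_def by blast
  ultimately show ?thesis
    by blast
qed

end
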